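(* Let $G$ be an affine algebraic group over $k$, let $M$ be a finite dimensional rational $G$-module, let $\mathfrak g=\operatorname{Lie}(G)$ and let $r$ be a positive integer. Let $\epsilon\in\mathbb E(r,\mathfrak g)$, let $X=G\cdot\epsilon\subset\mathbb E(r,\mathfrak g)$ be its orbit under the adjoint action, and let $H\subset G$ be the (reduced) stabilizer of $\epsilon$. Assume that $X\simeq G/H$ (via the orbit map). Then for every $j$ with $1\le j\le (p-1)r$ there are isomorphisms of $G$-equivariant vector bundles $$\mathcal{I}m^{j,X}(M)\simeq\mathcal L_{G/H}(\operatorname{Rad}^j(\epsilon^*M)),\qquad \mathcal{K}er^{j,X}(M)\simeq\mathcal L_{G/H}(\operatorname{Soc}^j(\epsilon^*M))$$ as subbundles of the trivial bundle $\mathcal L_{G/H}(M)=M\otimes\mathcal O_X$, where $\operatorname{Rad}^j(\epsilon^*M)$ and $\operatorname{Soc}^j(\epsilon^*M)$ are endowed with the action of $H$ induced by the action of $G$ on $M$.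
   Context: Let $k$ be an algebraically closed field of characteristic $p>0$. Lie algebras are finite dimensional restricted Lie algebras over $k$ with $p$-operation $(-)^{[p]}$; $\mathfrak u(\mathfrak g)$ is the restricted enveloping algebra. An affine algebraic group is a reduced group scheme represented by a finitely generated integral $k$-algebra; a rational $G$-module is a comodule for $k[G]$; it is a $\mathfrak u(\mathfrak g)$-module for $\mathfrak g=\operatorname{Lie}(G)$ by differentiation. An elementary subalgebra of $\mathfrak g$ is an abelian Lie subalgebra $\epsilon$ with $x^{[p]}=0$ for all $x\in\epsilon$. For $0<r<\dim\mathfrak g$, $\mathbb E(r,\mathfrak g)\subset\operatorname{Grass}(r,\mathfrak g)$ is the closed subvariety of $r$-dimensional elementary subalgebras. Image and kernel sheaves. Let $\mathcal C^o$ be the quasi-projective variety of linearly independent $r$-tuples $(X_1,\dots,X_r)$ of pairwise commuting elements of $\mathfrak g$ with $X_s^{[p]}=0$; sending a tuple to its span makes $\mathcal C^o\to\mathbb E(r,\mathfrak g)$ a $\mathrm{GL}_r$-torsor. Fix a basis $x_1,\dots,x_n$ of $\mathfrak g$ and let $Y_{i,s}$ be the function on $\mathcal C^o$ giving the $i$-th coordinate of $X_s$. For a locally closed subvariety $X\subset\mathbb E(r,\mathfrak g)$ let $q:\widetilde X\to X$ be the restriction of this torsor to $X$. For a finite dimensional $\mathfrak u(\mathfrak g)$-module $M$ let $\Theta_s:M\otimes\mathcal O_{\widetilde X}\to M\otimes\mathcal O_{\widetilde X}$, $m\otimes f\mapsto\sum_i x_im\otimes Y_{i,s}f$ (these do not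 depend on the basis). For $1\le j\le(p-1)r$, the sum of the images of all $\Theta_1^{j_1}\cdots\Theta_r^{j_r}$ with $j_1+\dots+j_r=j$, $j_\ell\ge 0$, and the intersection of the kernels of these operators, are $\mathrm{GL}_r$-invariant coherent subsheaves of $M\otimes\mathcal O_{\widetilde X}$; by descent along $q$ they are the pull-backs of unique coherent subsheaves $\mathcal{I}m^{j,X}(M)$ and $\mathcal{K}er^{j,X}(M)$ of $M\otimes\mathcal O_X$, respectively. When $\mathfrak g=\operatorname{Lie}(G)$, $M$ is a rational $G$-module and $X$ is $G$-stable, these are $G$-equivariant. $\epsilon^*M$ is the restriction of $M$ to $\epsilon$; $\operatorname{Rad}^j(\epsilon^*M)=J^jM$ and $\operatorname{Soc}^j(\epsilon^*M)=\{m\in M: J^jm=0\}$, where $J$ is the Jacobson radical of $\mathfrak u(\epsilon)$. For a closed subgroup $H\subset G$ and a finite dimensional rational $H$-module $W$, $\mathcal L_{G/H}(W)$ is the $G$-equivariant vector bundle on $G/H$ whose sections over an open $U\subset G/H$ are the sections of $G\times^HW\to G/H$ above $U$; if $W$ is the restriction of a rational $G$-module, then $\mathcal L_{G/H}(W)\simeq W\otimes\mathcal O_{G/H}$. *)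

theory Defs
  imports
    "HOL-Computational_Algebra.Computational_Algebra"
    "HOL-Library.Function_Algebras"
    "HOL-Analysis.Abstract_Topology"
    "HOL-Algebra.QuotRing"
    "HOL-Algebra.Ideal_Product"
begin

section \<open>Varieties as spaces with functions\<close>

text \<open>
  The base field is algebraically closed and all schemes in sight are reduced, so varieties are
  treated classically: a set of closed points with its Zariski topology and, for every open
  \<open>U\<close>, the set of regular functions on \<open>U\<close>.  A function (or section) on \<open>U\<close> is always
  extended by zero outside \<open>U\<close>, so that equality of functions is equality on \<open>U\<close> and the
  pointwise operations of Function_Algebras apply.
\<close>

definition cut :: "'x set \<Rightarrow> ('x \<Rightarrow> 'c::zero) \<Rightarrow> 'x \<Rightarrow> 'c" where
  "cut U f = (\<lambda>x. if x \<in> U then f x else 0)"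

text \<open>The \<open>k\<close>-algebra of functions on \<open>P\<close> generated by \<open>S\<close>.\<close>

inductive_set fun_alg :: "'x set \<Rightarrow> ('x \<Rightarrow> 'k::comm_ring_1) set \<Rightarrow> ('x \<Rightarrow> 'k) set"
  for P S where
  const: "cut P (\<lambda>_. c) \<in> fun_alg P S"
| gen: "f \<in> S \<Longrightarrow> cut P f \<in> fun_alg P S"
| add: "f \<in> fun_alg P S \<Longrightarrow> g \<in> fun_alg P S \<Longrightarrow> f + g \<in> fun_alg P S"
| mult: "f \<in> fun_alg P S \<Longrightarrow> g \<in> fun_alg P S \<Longrightarrow> f * g \<in> fun_alg P S"

definition alg_character ::
  "'x set \<Rightarrow> ('x \<Rightarrow> 'k::field) set \<Rightarrow> (('x \<Rightarrow> 'k) \<Rightarrow> 'k) \<Rightarrow> bool" where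
  "alg_character P A \<phi> \<longleftrightarrow>
     \<phi> (cut P (\<lambda>_. 1)) = 1 \<and>
     (\<forall>f\<in>A. \<forall>g\<in>A. \<phi> (f + g) = \<phi> f + \<phi> g \<and> \<phi> (f * g) = \<phi> f * \<phi> g) \<and>
     (\<forall>c. \<forall>f\<in>A. \<phi> (\<lambda>x. c * f x) = c * \<phi> f)"

text \<open>
  An integral affine variety: \<open>A\<close> is a finitely generated integral \<open>k\<close>-algebra, and the points of
  \<open>P\<close> are exactly the \<open>k\<close>-points of its spectrum.  (Over an algebraically closed field every
  finitely generated domain is, by the Nullstellensatz, an algebra of functions on its \<open>k\<close>-points.)
\<close>

definition affine_variety :: "'x set \<Rightarrow> ('x \<Rightarrow> 'k::field) set \<Rightarrow> bool" where
  "affine_variety P A \<longleftrightarrow>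
     P \<noteq> {} \<and>
     (\<exists>S. finite S \<and> A = fun_alg P S) \<and>
     (\<forall>f\<in>A. \<forall>g\<in>A. f * g = 0 \<longrightarrow> f = 0 \<or> g = 0) \<and>
     (\<forall>\<phi>. alg_character P A \<phi> \<longrightarrow> (\<exists>!x. x \<in> P \<and> (\<forall>f\<in>A. \<phi> f = f x)))"

record ('x, 'k) fun_space =
  topo :: "'x topology"
  regf :: "'x set \<Rightarrow> ('x \<Rightarrow> 'k) set"

definition affine_space :: "'x set \<Rightarrow> ('x \<Rightarrow> 'k::field) set \<Rightarrow> ('x, 'k) fun_space" where
  "affine_space P A = (let T = topology_generated_by {{x \<in> P. f x \<noteq> 0} |f. f \<in> A} in
     \<lparr> topo = T,
       regf = (\<lambda>U. {s. (\<forall>x. x \<notin> U \<longrightarrow> s x = 0) \<and>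
                (\<forall>x\<in>U. \<exists>V a b. openin T V \<and> x \<in> V \<and> V \<subseteq> U \<and> a \<in> A \<and> b \<in> A \<and>
                    (\<forall>y\<in>V. b y \<noteq> 0 \<and> s y = a y / b y))}) \<rparr>)"

text \<open>The reduced structure induced on a (locally closed) subset.\<close>

definition sub_space :: "('x, 'k::field) fun_space \<Rightarrow> 'x set \<Rightarrow> ('x, 'k) fun_space" where
  "sub_space X S =
     \<lparr> topo = subtopology (topo X) S,
       regf = (\<lambda>U. {s. (\<forall>x. x \<notin> U \<longrightarrow> s x = 0) \<and>
                (\<forall>x\<in>U. \<exists>W t. openin (topo X) W \<and> x \<in> W \<and> t \<in> regf X W \<and>
                    (\<forall>y \<in> W \<inter> U. s y = t y))}) \<rparr>"

definition preim :: "'x topology \<Rightarrow> ('x \<Rightarrow> 'y) \<Rightarrow> 'y set \<Rightarrow> 'x set" where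
  "preim T \<pi> U = {x \<in> topspace T. \<pi> x \<in> U}"

definition quot_topology :: "'x topology \<Rightarrow> ('x \<Rightarrow> 'y) \<Rightarrow> 'y topology" where
  "quot_topology T \<pi> = topology (\<lambda>U. U \<subseteq> \<pi> ` topspace T \<and> openin T (preim T \<pi> U))"

lemma openin_quot_topology:
  "openin (quot_topology T \<pi>) U \<longleftrightarrow> U \<subseteq> \<pi> ` topspace T \<and> openin T (preim T \<pi> U)"
proof -
  have i: "preim T \<pi> (U \<inter> V) = preim T \<pi> U \<inter> preim T \<pi> V" for U V
    by (auto simp: preim_def)
  have u: "preim T \<pi> (\<Union>\<U>) = (\<Union>U\<in>\<U>. preim T \<pi> U)" for \<U>
    by (auto simp: preim_def)
  have "istopology (\<lambda>U. U \<subseteq> \<pi> ` topspace T \<and> openin T (preim T \<pi> U))"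
    unfolding istopology_def by (auto simp: i u)
  then show ?thesis
    unfolding quot_topology_def by (simp add: topology_inverse')
qed

text \<open>The quotient of a space with functions by the fibres of \<open>\<pi>\<close>.\<close>

definition quot_space :: "('x, 'k::field) fun_space \<Rightarrow> ('x \<Rightarrow> 'y) \<Rightarrow> ('y, 'k) fun_space" where
  "quot_space X \<pi> =
     \<lparr> topo = quot_topology (topo X) \<pi>,
       regf = (\<lambda>U. {s. (\<forall>y. y \<notin> U \<longrightarrow> s y = 0) \<and>
                cut (preim (topo X) \<pi> U) (s \<circ> \<pi>) \<in> regf X (preim (topo X) \<pi> U)}) \<rparr>"

definition fs_morphism ::
  "('x, 'k::field) fun_space \<Rightarrow> ('y, 'k) fun_space \<Rightarrow> ('x \<Rightarrow> 'y) \<Rightarrow> bool" where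
  "fs_morphism X Y \<phi> \<longleftrightarrow>
     continuous_map (topo X) (topo Y) \<phi> \<and>
     (\<forall>V s. openin (topo Y) V \<and> s \<in> regf Y V \<longrightarrow>
        cut (preim (topo X) \<phi> V) (s \<circ> \<phi>) \<in> regf X (preim (topo X) \<phi> V))"

definition fs_iso ::
  "('x, 'k::field) fun_space \<Rightarrow> ('y, 'k) fun_space \<Rightarrow> ('x \<Rightarrow> 'y) \<Rightarrow> bool" where
  "fs_iso X Y \<phi> \<longleftrightarrow>
     bij_betw \<phi> (topspace (topo X)) (topspace (topo Y)) \<and>
     fs_morphism X Y \<phi> \<and> fs_morphism Y X (the_inv_into (topspace (topo X)) \<phi>)"


section \<open>Affine algebraic groups, their Lie algebras and rational modules\<close>

text \<open>\<open>A\<close> is the coordinate algebra \<open>k[G]\<close>; the last two axioms give its comultiplication and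
  antipode.\<close>

locale affine_alg_group = group G for G (structure) +
  fixes A :: "('g \<Rightarrow> 'k::field) set"
  assumes variety: "affine_variety (carrier G) A"
    and comult: "f \<in> A \<Longrightarrow> \<exists>n::nat. \<exists>a b. (\<forall>i<n. a i \<in> A \<and> b i \<in> A) \<and>
          (\<forall>x\<in>carrier G. \<forall>y\<in>carrier G. f (x \<otimes> y) = (\<Sum>i<n. a i x * b i y))"
    and antipode: "f \<in> A \<Longrightarrow> cut (carrier G) (\<lambda>x. f (inv x)) \<in> A"

type_synonym ('g, 'k) oper = "('g \<Rightarrow> 'k) \<Rightarrow> ('g \<Rightarrow> 'k)"

definition oscale :: "'k::field \<Rightarrow> ('g, 'k) oper \<Rightarrow> ('g, 'k) oper" where
  "oscale c D = (\<lambda>f x. c * D f x)"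

definition ltrans :: "('g, 'q) monoid_scheme \<Rightarrow> 'g \<Rightarrow> ('g, 'k::field) oper" where
  "ltrans G g f = cut (carrier G) (\<lambda>x. f (inv\<^bsub>G\<^esub> g \<otimes>\<^bsub>G\<^esub> x))"

definition rtrans :: "('g, 'q) monoid_scheme \<Rightarrow> 'g \<Rightarrow> ('g, 'k::field) oper" where
  "rtrans G g f = cut (carrier G) (\<lambda>x. f (x \<otimes>\<^bsub>G\<^esub> g))"

text \<open>\<open>Lie(G)\<close> is the restricted Lie algebra of left invariant derivations of \<open>k[G]\<close>, with the
  commutator bracket and the \<open>p\<close>-th iterate as \<open>p\<close>-operation.  A derivation is extended
  by zero to functions not in \<open>k[G]\<close>.\<close>

definition Lie :: "('g, 'q) monoid_scheme \<Rightarrow> ('g \<Rightarrow> 'k::field) set \<Rightarrow> ('g, 'k) oper set" where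
  "Lie G A = {D. (\<forall>f\<in>A. D f \<in> A) \<and> (\<forall>f. f \<notin> A \<longrightarrow> D f = 0) \<and>
     (\<forall>f\<in>A. \<forall>g\<in>A. D (f + g) = D f + D g \<and> D (f * g) = f * D g + D f * g) \<and>
     (\<forall>c. \<forall>f\<in>A. D (\<lambda>x. c * f x) = (\<lambda>x. c * D f x)) \<and>
     (\<forall>g\<in>carrier G. \<forall>f\<in>A. D (ltrans G g f) = ltrans G g (D f))}"

definition bracket :: "('g, 'k::field) oper \<Rightarrow> ('g, 'k) oper \<Rightarrow> ('g, 'k) oper" where
  "bracket D D' = (D \<circ> D') - (D' \<circ> D)"

definition p_op :: "('g, 'k::field) oper \<Rightarrow> ('g, 'k) oper" where
  "p_op D = D ^^ CHAR('k)"

definition Ad ::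
  "('g, 'q) monoid_scheme \<Rightarrow> ('g \<Rightarrow> 'k::field) set \<Rightarrow> 'g \<Rightarrow> ('g, 'k) oper \<Rightarrow> ('g, 'k) oper" where
  "Ad G A g D = (\<lambda>f. if f \<in> A then rtrans G g (D (rtrans G (inv\<^bsub>G\<^esub> g) f)) else 0)"

definition lie_basis ::
  "('g, 'q) monoid_scheme \<Rightarrow> ('g \<Rightarrow> 'k::field) set \<Rightarrow> ('g, 'k) oper set \<Rightarrow> bool" where
  "lie_basis G A B \<longleftrightarrow> finite B \<and> \<not> Modules.module.dependent oscale B \<and>
     Modules.module.span oscale B = Lie G A"

text \<open>Modules are the whole type \<open>'m\<close>.  On points, a comodule structure \<open>m \<mapsto> \<Sum>\<^sub>i v\<^sub>i \<otimes> f\<^sub>i\<close> is a linear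
  action with \<open>g m = \<Sum>\<^sub>i f\<^sub>i(g) v\<^sub>i\<close>.\<close>

definition rational_module ::
  "('g, 'q) monoid_scheme \<Rightarrow> ('g \<Rightarrow> 'k::field) set \<Rightarrow> ('k \<Rightarrow> 'm::ab_group_add \<Rightarrow> 'm) \<Rightarrow>
   ('g \<Rightarrow> 'm \<Rightarrow> 'm) \<Rightarrow> bool" where
  "rational_module G A scale \<rho> \<longleftrightarrow>
     (\<forall>g\<in>carrier G. Vector_Spaces.linear scale scale (\<rho> g)) \<and>
     \<rho> \<one>\<^bsub>G\<^esub> = id \<and>
     (\<forall>g\<in>carrier G. \<forall>h\<in>carrier G. \<rho> (g \<otimes>\<^bsub>G\<^esub> h) = \<rho> g \<circ> \<rho> h) \<and>
     (\<forall>m. \<exists>n::nat. \<exists>f v. (\<forall>i<n. f i \<in> A) \<and>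
        (\<forall>g\<in>carrier G. \<rho> g m = (\<Sum>i<n. scale (f i g) (v i))))"

text \<open>The differentiated action: if \<open>g m = \<Sum>\<^sub>b f\<^sub>b(g) b\<close> over a basis, then
  \<open>D m = \<Sum>\<^sub>b (D f\<^sub>b)(1) b\<close>.\<close>

definition daction ::
  "('g, 'q) monoid_scheme \<Rightarrow> ('k::field \<Rightarrow> 'm::ab_group_add \<Rightarrow> 'm) \<Rightarrow> 'm set \<Rightarrow>
   ('g \<Rightarrow> 'm \<Rightarrow> 'm) \<Rightarrow> ('g, 'k) oper \<Rightarrow> 'm \<Rightarrow> 'm" where
  "daction G scale Basis \<rho> D m =
     (\<Sum>b\<in>Basis. scale
        (D (cut (carrier G) (\<lambda>g. Modules.module.representation scale Basis (\<rho> g m) b)) \<one>\<^bsub>G\<^esub>) b)"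


section \<open>Restricted enveloping algebras, radicals and socles\<close>

text \<open>The free associative algebra on the set \<open>V\<close>: finitely supported functions on words.\<close>

definition free_algebra :: "'v set \<Rightarrow> ('v list \<Rightarrow> 'k::field) ring" where
  "free_algebra V =
     \<lparr> carrier = {a. finite {w. a w \<noteq> 0} \<and> (\<forall>w. a w \<noteq> 0 \<longrightarrow> set w \<subseteq> V)},
       monoid.mult = (\<lambda>a b w. \<Sum>i\<le>length w. a (take i w) * b (drop i w)),
       one = (\<lambda>w. if w = [] then 1 else 0),
       zero = 0,
       add = (+) \<rparr>"

definition word :: "'v list \<Rightarrow> 'v list \<Rightarrow> 'k::field" where
  "word w = (\<lambda>v. if v = w then 1 else 0)"

text \<open>The relations of \<open>\<uu>(V)\<close> for a restricted Lie subalgebra \<open>V\<close>; the first two turn the free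
  algebra on the set \<open>V\<close> into the tensor algebra of the vector space \<open>V\<close>.\<close>

definition u_relations :: "('g, 'k::field) oper set \<Rightarrow> (('g, 'k) oper list \<Rightarrow> 'k) set" where
  "u_relations V =
     {word [x + y] - word [x] - word [y] |x y. x \<in> V \<and> y \<in> V} \<union>
     {word [oscale c x] - (\<lambda>w. c * word [x] w) |c x. x \<in> V} \<union>
     {word [x, y] - word [y, x] - word [bracket x y] |x y. x \<in> V \<and> y \<in> V} \<union>
     {word (replicate CHAR('k) x) - word [p_op x] |x. x \<in> V}"

definition u_alg :: "('g, 'k::field) oper set \<Rightarrow> (('g, 'k) oper list \<Rightarrow> 'k) set ring" where
  "u_alg V = free_algebra V Quot (Idl\<^bsub>free_algebra V\<^esub> (u_relations V))"

text \<open>For commutative rings; \<open>\<uu>(\<epsilon>)\<close> is commutative for abelian \<open>\<epsilon>\<close>.\<close>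

definition jacobson_radical :: "('a, 'b) ring_scheme \<Rightarrow> 'a set" where
  "jacobson_radical R = carrier R \<inter> \<Inter>{I. maximalideal I R}"

fun ideal_power :: "('a, 'b) ring_scheme \<Rightarrow> 'a set \<Rightarrow> nat \<Rightarrow> 'a set" where
  "ideal_power R I 0 = carrier R"
| "ideal_power R I (Suc n) = ideal_prod R I (ideal_power R I n)"

text \<open>An element of \<open>\<uu>(V)\<close> is a coset; it acts through any representative.  Here \<open>act\<close> is the
  action of \<open>V\<close>.\<close>

definition free_act ::
  "('k::field \<Rightarrow> 'm::ab_group_add \<Rightarrow> 'm) \<Rightarrow> ('v \<Rightarrow> 'm \<Rightarrow> 'm) \<Rightarrow> ('v list \<Rightarrow> 'k) \<Rightarrow> 'm \<Rightarrow> 'm" where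
  "free_act scale act a m = (\<Sum>w | a w \<noteq> 0. scale (a w) (foldr act w m))"

definition u_act ::
  "('k::field \<Rightarrow> 'm::ab_group_add \<Rightarrow> 'm) \<Rightarrow> ('v \<Rightarrow> 'm \<Rightarrow> 'm) \<Rightarrow> ('v list \<Rightarrow> 'k) set \<Rightarrow> 'm \<Rightarrow> 'm" where
  "u_act scale act u m = the_elem ((\<lambda>a. free_act scale act a m) ` u)"

definition Rad ::
  "('k::field \<Rightarrow> 'm::ab_group_add \<Rightarrow> 'm) \<Rightarrow> (('g, 'k) oper \<Rightarrow> 'm \<Rightarrow> 'm) \<Rightarrow>
   ('g, 'k) oper set \<Rightarrow> nat \<Rightarrow> 'm set" where
  "Rad scale act \<epsilon> j = Modules.module.span scale
     {u_act scale act u m |u m. u \<in> ideal_power (u_alg \<epsilon>) (jacobson_radical (u_alg \<epsilon>)) j}"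

definition Soc ::
  "('k::field \<Rightarrow> 'm::ab_group_add \<Rightarrow> 'm) \<Rightarrow> (('g, 'k) oper \<Rightarrow> 'm \<Rightarrow> 'm) \<Rightarrow>
   ('g, 'k) oper set \<Rightarrow> nat \<Rightarrow> 'm set" where
  "Soc scale act \<epsilon> j =
     {m. \<forall>u \<in> ideal_power (u_alg \<epsilon>) (jacobson_radical (u_alg \<epsilon>)) j. u_act scale act u m = 0}"


section \<open>Elementary subalgebras and the torsor of frames\<close>

text \<open>The underlying set of \<open>\<bbbE>(r, \<gg>)\<close>.\<close>

definition elem_subalgs ::
  "('g, 'q) monoid_scheme \<Rightarrow> ('g \<Rightarrow> 'k::field) set \<Rightarrow> nat \<Rightarrow> ('g, 'k) oper set set" where
  "elem_subalgs G A r = {\<epsilon>. \<epsilon> \<subseteq> Lie G A \<and> Modules.module.subspace oscale \<epsilon> \<and>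
     vector_space.dim oscale \<epsilon> = r \<and>
     (\<forall>x\<in>\<epsilon>. \<forall>y\<in>\<epsilon>. bracket x y = 0) \<and> (\<forall>x\<in>\<epsilon>. p_op x = 0)}"

text \<open>Tuples are indexed by \<open>0, \<dots>, r - 1\<close>; \<open>coordY B b s\<close> is the coordinate at the basis
  vector \<open>b\<close> of the \<open>s\<close>-th entry.\<close>

definition coordY ::
  "('g, 'k::field) oper set \<Rightarrow> ('g, 'k) oper \<Rightarrow> nat \<Rightarrow> (nat \<Rightarrow> ('g, 'k) oper) \<Rightarrow> 'k" where
  "coordY B b s x = Modules.module.representation oscale B (x s) b"

definition tuples ::
  "('g, 'q) monoid_scheme \<Rightarrow> ('g \<Rightarrow> 'k::field) set \<Rightarrow> nat \<Rightarrow> (nat \<Rightarrow> ('g, 'k) oper) set" where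
  "tuples G A r = {..<r} \<rightarrow>\<^sub>E Lie G A"

definition tuple_space ::
  "('g, 'q) monoid_scheme \<Rightarrow> ('g \<Rightarrow> 'k::field) set \<Rightarrow> ('g, 'k) oper set \<Rightarrow> nat \<Rightarrow>
   (nat \<Rightarrow> ('g, 'k) oper, 'k) fun_space" where
  "tuple_space G A B r = affine_space (tuples G A r)
     (fun_alg (tuples G A r) {coordY B b s |b s. b \<in> B \<and> s < r})"

definition frames ::
  "('g, 'q) monoid_scheme \<Rightarrow> ('g \<Rightarrow> 'k::field) set \<Rightarrow> nat \<Rightarrow> (nat \<Rightarrow> ('g, 'k) oper) set" where
  "frames G A r = {x \<in> tuples G A r. inj_on x {..<r} \<and>
     \<not> Modules.module.dependent oscale (x ` {..<r})}"

definition span_map :: "nat \<Rightarrow> (nat \<Rightarrow> ('g, 'k::field) oper) \<Rightarrow> ('g, 'k) oper set" where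
  "span_map r x = Modules.module.span oscale (x ` {..<r})"

text \<open>The Grassmannian, as the quotient of the frames by \<open>GL\<^sub>r\<close>.\<close>

definition Grass ::
  "('g, 'q) monoid_scheme \<Rightarrow> ('g \<Rightarrow> 'k::field) set \<Rightarrow> ('g, 'k) oper set \<Rightarrow> nat \<Rightarrow>
   (('g, 'k) oper set, 'k) fun_space" where
  "Grass G A B r = quot_space (sub_space (tuple_space G A B r) (frames G A r)) (span_map r)"

definition elem_frames ::
  "('g, 'q) monoid_scheme \<Rightarrow> ('g \<Rightarrow> 'k::field) set \<Rightarrow> nat \<Rightarrow> (nat \<Rightarrow> ('g, 'k) oper) set" where
  "elem_frames G A r = {x \<in> frames G A r.
     (\<forall>s<r. \<forall>t<r. bracket (x s) (x t) = 0) \<and> (\<forall>s<r. p_op (x s) = 0)}"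

text \<open>A subvariety \<open>X\<close> of \<open>\<bbbE>(r, \<gg>)\<close> and the restriction of the torsor to it.\<close>

definition base_space ::
  "('g, 'q) monoid_scheme \<Rightarrow> ('g \<Rightarrow> 'k::field) set \<Rightarrow> ('g, 'k) oper set \<Rightarrow> nat \<Rightarrow>
   ('g, 'k) oper set set \<Rightarrow> (('g, 'k) oper set, 'k) fun_space" where
  "base_space G A B r X = sub_space (Grass G A B r) X"

definition frame_space ::
  "('g, 'q) monoid_scheme \<Rightarrow> ('g \<Rightarrow> 'k::field) set \<Rightarrow> ('g, 'k) oper set \<Rightarrow> nat \<Rightarrow>
   ('g, 'k) oper set set \<Rightarrow> (nat \<Rightarrow> ('g, 'k) oper, 'k) fun_space" where
  "frame_space G A B r X =
     sub_space (tuple_space G A B r) {x \<in> elem_frames G A r. span_map r x \<in> X}"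


section \<open>Subsheaves of a trivial bundle\<close>

text \<open>The sheaf \<open>M \<otimes> \<O>\<^sub>X\<close>.\<close>

definition triv_sheaf ::
  "('x, 'k::field) fun_space \<Rightarrow> ('k \<Rightarrow> 'm::ab_group_add \<Rightarrow> 'm) \<Rightarrow> 'm set \<Rightarrow>
   'x set \<Rightarrow> ('x \<Rightarrow> 'm) set" where
  "triv_sheaf X scale Basis U =
     {\<lambda>x. \<Sum>b\<in>Basis. scale (f b x) b |f. \<forall>b\<in>Basis. f b \<in> regf X U}"

text \<open>\<open>\<O>\<close>-submodule sheaves of \<open>M \<otimes> \<O>\<^sub>X\<close>.  They are normalised to be empty on sets that are not
  open, so that equality of set-valued functions is equality of sheaves.\<close>

definition subsheaf ::
  "('x, 'k::field) fun_space \<Rightarrow> ('k \<Rightarrow> 'm::ab_group_add \<Rightarrow> 'm) \<Rightarrow> 'm set \<Rightarrow>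
   ('x set \<Rightarrow> ('x \<Rightarrow> 'm) set) \<Rightarrow> bool" where
  "subsheaf X scale Basis F \<longleftrightarrow>
     (\<forall>U. \<not> openin (topo X) U \<longrightarrow> F U = {}) \<and>
     (\<forall>U. openin (topo X) U \<longrightarrow>
        F U \<subseteq> triv_sheaf X scale Basis U \<and> 0 \<in> F U \<and>
        (\<forall>s\<in>F U. \<forall>t\<in>F U. s + t \<in> F U) \<and>
        (\<forall>f\<in>regf X U. \<forall>s\<in>F U. (\<lambda>x. scale (f x) (s x)) \<in> F U) \<and>
        (\<forall>V. openin (topo X) V \<and> V \<subseteq> U \<longrightarrow> (\<forall>s\<in>F U. cut V s \<in> F V)) \<and>
        (\<forall>s\<in>triv_sheaf X scale Basis U.
           (\<forall>x\<in>U. \<exists>V. openin (topo X) V \<and> x \<in> V \<and> V \<subseteq> U \<and> cut V s \<in> F V) \<longrightarrow> s \<in> F U))"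

text \<open>The sections \<open>s\<^sub>0, \<dots>, s\<^sub>n\<^sub>-\<^sub>1\<close> generate the sheaf \<open>F\<close> over \<open>U\<close>.\<close>

definition generates ::
  "('x, 'k::field) fun_space \<Rightarrow> ('k \<Rightarrow> 'm::ab_group_add \<Rightarrow> 'm) \<Rightarrow>
   ('x set \<Rightarrow> ('x \<Rightarrow> 'm) set) \<Rightarrow> 'x set \<Rightarrow> nat \<Rightarrow> (nat \<Rightarrow> 'x \<Rightarrow> 'm) \<Rightarrow> bool" where
  "generates X scale F U n s \<longleftrightarrow> (\<forall>i<n. s i \<in> F U) \<and>
     (\<forall>V. openin (topo X) V \<and> V \<subseteq> U \<longrightarrow> (\<forall>u\<in>F V. \<forall>x\<in>V. \<exists>W a.
        openin (topo X) W \<and> x \<in> W \<and> W \<subseteq> V \<and> (\<forall>i<n. a i \<in> regf X W) \<and>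
        (\<forall>y\<in>W. u y = (\<Sum>i<n. scale (a i y) (s i y)))))"

text \<open>The kernel of \<open>\<O>\<^sup>n \<rightarrow> M \<otimes> \<O>\<close> given by \<open>s\<^sub>0, \<dots>, s\<^sub>n\<^sub>-\<^sub>1\<close>.\<close>

definition relation_sheaf ::
  "('x, 'k::field) fun_space \<Rightarrow> ('k \<Rightarrow> 'm::ab_group_add \<Rightarrow> 'm) \<Rightarrow> nat \<Rightarrow> (nat \<Rightarrow> 'x \<Rightarrow> 'm) \<Rightarrow>
   'x set \<Rightarrow> ('x \<Rightarrow> nat \<Rightarrow> 'k) set" where
  "relation_sheaf X scale n s V =
     {a. (\<forall>i<n. (\<lambda>x. a x i) \<in> regf X V) \<and> (\<forall>i\<ge>n. \<forall>x. a x i = 0) \<and>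
         (\<forall>x\<in>V. (\<Sum>i<n. scale (a x i) (s i x)) = 0)}"

text \<open>Coherent, in the form valid on locally Noetherian schemes: locally the cokernel of a map
  between free modules of finite rank.\<close>

definition coherent_subsheaf ::
  "('x, 'k::field) fun_space \<Rightarrow> ('k \<Rightarrow> 'm::ab_group_add \<Rightarrow> 'm) \<Rightarrow> 'm set \<Rightarrow>
   ('x set \<Rightarrow> ('x \<Rightarrow> 'm) set) \<Rightarrow> bool" where
  "coherent_subsheaf X scale Basis F \<longleftrightarrow> subsheaf X scale Basis F \<and>
     (\<forall>x\<in>topspace (topo X). \<exists>U n s l t. openin (topo X) U \<and> x \<in> U \<and>
        generates X scale F U n s \<and>
        generates X (\<lambda>c v i. c * v i) (relation_sheaf X scale n s) U l t)"

text \<open>The pull-back of a subsheaf along a flat \<open>q\<close>, as a subsheaf of \<open>M \<otimes> \<O>\<^sub>Y\<close>: the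
  \<open>\<O>\<^sub>Y\<close>-submodule generated by the sections \<open>t \<circ> q\<close>.\<close>

definition pullback_sheaf ::
  "('y, 'k::field) fun_space \<Rightarrow> ('x, 'k) fun_space \<Rightarrow> ('y \<Rightarrow> 'x) \<Rightarrow>
   ('k \<Rightarrow> 'm::ab_group_add \<Rightarrow> 'm) \<Rightarrow> 'm set \<Rightarrow>
   ('x set \<Rightarrow> ('x \<Rightarrow> 'm) set) \<Rightarrow> 'y set \<Rightarrow> ('y \<Rightarrow> 'm) set" where
  "pullback_sheaf Y X q scale Basis F V = (if \<not> openin (topo Y) V then {} else
     {s \<in> triv_sheaf Y scale Basis V. \<forall>y\<in>V. \<exists>W U n f t.
        openin (topo Y) W \<and> y \<in> W \<and> W \<subseteq> V \<and> openin (topo X) U \<and> q ` W \<subseteq> U \<and>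
        (\<forall>i<(n::nat). f i \<in> regf Y W \<and> t i \<in> F U) \<and>
        (\<forall>z\<in>W. s z = (\<Sum>i<n. scale (f i z) (t i (q z))))})"


section \<open>Image and kernel sheaves\<close>

definition theta ::
  "('k::field \<Rightarrow> 'm::ab_group_add \<Rightarrow> 'm) \<Rightarrow> (('g, 'k) oper \<Rightarrow> 'm \<Rightarrow> 'm) \<Rightarrow> ('g, 'k) oper set \<Rightarrow>
   nat \<Rightarrow> ((nat \<Rightarrow> ('g, 'k) oper) \<Rightarrow> 'm) \<Rightarrow> ((nat \<Rightarrow> ('g, 'k) oper) \<Rightarrow> 'm)" where
  "theta scale act B s t = (\<lambda>x. \<Sum>b\<in>B. scale (coordY B b s x) (act b (t x)))"

definition theta_monomial ::
  "('k::field \<Rightarrow> 'm::ab_group_add \<Rightarrow> 'm) \<Rightarrow> (('g, 'k) oper \<Rightarrow> 'm \<Rightarrow> 'm) \<Rightarrow> ('g, 'k) oper set \<Rightarrow>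
   nat \<Rightarrow> (nat \<Rightarrow> nat) \<Rightarrow> ((nat \<Rightarrow> ('g, 'k) oper) \<Rightarrow> 'm) \<Rightarrow> ((nat \<Rightarrow> ('g, 'k) oper) \<Rightarrow> 'm)" where
  "theta_monomial scale act B r J = foldr (\<lambda>s. theta scale act B s ^^ J s) [0..<r]"

definition multi_indices :: "nat \<Rightarrow> nat \<Rightarrow> (nat \<Rightarrow> nat) set" where
  "multi_indices r j = {J. (\<forall>s\<ge>r. J s = 0) \<and> (\<Sum>s<r. J s) = j}"

definition im_frames ::
  "(nat \<Rightarrow> ('g, 'k::field) oper, 'k) fun_space \<Rightarrow> ('k \<Rightarrow> 'm::ab_group_add \<Rightarrow> 'm) \<Rightarrow> 'm set \<Rightarrow>
   (('g, 'k) oper \<Rightarrow> 'm \<Rightarrow> 'm) \<Rightarrow> ('g, 'k) oper set \<Rightarrow> nat \<Rightarrow> nat \<Rightarrow>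
   (nat \<Rightarrow> ('g, 'k) oper) set \<Rightarrow> ((nat \<Rightarrow> ('g, 'k) oper) \<Rightarrow> 'm) set" where
  "im_frames Y scale Basis act B r j V = (if \<not> openin (topo Y) V then {} else
     {s \<in> triv_sheaf Y scale Basis V. \<forall>x\<in>V. \<exists>W t.
        openin (topo Y) W \<and> x \<in> W \<and> W \<subseteq> V \<and>
        (\<forall>J\<in>multi_indices r j. t J \<in> triv_sheaf Y scale Basis W) \<and>
        cut W s = (\<Sum>J\<in>multi_indices r j. theta_monomial scale act B r J (t J))})"

definition ker_frames ::
  "(nat \<Rightarrow> ('g, 'k::field) oper, 'k) fun_space \<Rightarrow> ('k \<Rightarrow> 'm::ab_group_add \<Rightarrow> 'm) \<Rightarrow> 'm set \<Rightarrow>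
   (('g, 'k) oper \<Rightarrow> 'm \<Rightarrow> 'm) \<Rightarrow> ('g, 'k) oper set \<Rightarrow> nat \<Rightarrow> nat \<Rightarrow>
   (nat \<Rightarrow> ('g, 'k) oper) set \<Rightarrow> ((nat \<Rightarrow> ('g, 'k) oper) \<Rightarrow> 'm) set" where
  "ker_frames Y scale Basis act B r j V = (if \<not> openin (topo Y) V then {} else
     {s \<in> triv_sheaf Y scale Basis V.
        \<forall>J\<in>multi_indices r j. theta_monomial scale act B r J s = 0})"

text \<open>The unique coherent subsheaf whose pull-back along \<open>q\<close> is \<open>E\<close>.\<close>

definition descend ::
  "('y, 'k::field) fun_space \<Rightarrow> ('x, 'k) fun_space \<Rightarrow> ('y \<Rightarrow> 'x) \<Rightarrow>
   ('k \<Rightarrow> 'm::ab_group_add \<Rightarrow> 'm) \<Rightarrow> 'm set \<Rightarrow>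
   ('y set \<Rightarrow> ('y \<Rightarrow> 'm) set) \<Rightarrow> 'x set \<Rightarrow> ('x \<Rightarrow> 'm) set" where
  "descend Y X q scale Basis E =
     (THE F. coherent_subsheaf X scale Basis F \<and> pullback_sheaf Y X q scale Basis F = E)"

definition Im_sheaf where
  "Im_sheaf G A B r X scale Basis \<rho> j =
     descend (frame_space G A B r X) (base_space G A B r X) (span_map r) scale Basis
       (im_frames (frame_space G A B r X) scale Basis (daction G scale Basis \<rho>) B r j)"

definition Ker_sheaf where
  "Ker_sheaf G A B r X scale Basis \<rho> j =
     descend (frame_space G A B r X) (base_space G A B r X) (span_map r) scale Basis
       (ker_frames (frame_space G A B r X) scale Basis (daction G scale Basis \<rho>) B r j)"


section \<open>The bundles associated to H-modules\<close>

definition coset_space ::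
  "('g, 'q) monoid_scheme \<Rightarrow> ('g \<Rightarrow> 'k::field) set \<Rightarrow> 'g set \<Rightarrow> ('g set, 'k) fun_space" where
  "coset_space G A H = quot_space (affine_space (carrier G) A) (\<lambda>g. g <#\<^bsub>G\<^esub> H)"

text \<open>\<open>W\<close> is an \<open>H\<close>-stable subspace of \<open>M\<close>.  The class of \<open>(x, w)\<close> in \<open>G \<times>\<^sup>H W\<close> is the
  set \<open>{(x h, h\<^sup>-\<^sup>1 w) | h \<in> H}\<close>; the bundle projection to \<open>G/H\<close> is therefore the image
  under \<open>fst\<close>.\<close>

definition twist ::
  "('g, 'q) monoid_scheme \<Rightarrow> 'g set \<Rightarrow> ('g \<Rightarrow> 'm \<Rightarrow> 'm) \<Rightarrow> 'g \<times> 'm \<Rightarrow> ('g \<times> 'm) set" where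
  "twist G H \<rho> = (\<lambda>(x, w). (\<lambda>h. (x \<otimes>\<^bsub>G\<^esub> h, \<rho> (inv\<^bsub>G\<^esub> h) w)) ` H)"

definition prod_alg ::
  "('g, 'q) monoid_scheme \<Rightarrow> ('g \<Rightarrow> 'k::field) set \<Rightarrow> ('k \<Rightarrow> 'm::ab_group_add \<Rightarrow> 'm) \<Rightarrow> 'm set \<Rightarrow>
   'm set \<Rightarrow> ('g \<times> 'm \<Rightarrow> 'k) set" where
  "prod_alg G A scale Basis W = fun_alg (carrier G \<times> W)
     ({f \<circ> fst |f. f \<in> A} \<union>
      {(\<lambda>m. Modules.module.representation scale Basis m b) \<circ> snd |b. b \<in> Basis})"

definition assoc_bundle ::
  "('g, 'q) monoid_scheme \<Rightarrow> ('g \<Rightarrow> 'k::field) set \<Rightarrow> 'g set \<Rightarrow>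
   ('k \<Rightarrow> 'm::ab_group_add \<Rightarrow> 'm) \<Rightarrow> 'm set \<Rightarrow> ('g \<Rightarrow> 'm \<Rightarrow> 'm) \<Rightarrow> 'm set \<Rightarrow>
   (('g \<times> 'm) set, 'k) fun_space" where
  "assoc_bundle G A H scale Basis \<rho> W =
     quot_space (affine_space (carrier G \<times> W) (prod_alg G A scale Basis W)) (twist G H \<rho>)"

definition L_sheaf ::
  "('g, 'q) monoid_scheme \<Rightarrow> ('g \<Rightarrow> 'k::field) set \<Rightarrow> 'g set \<Rightarrow>
   ('k \<Rightarrow> 'm::ab_group_add \<Rightarrow> 'm) \<Rightarrow> 'm set \<Rightarrow> ('g \<Rightarrow> 'm \<Rightarrow> 'm) \<Rightarrow> 'm set \<Rightarrow>
   'g set set \<Rightarrow> ('g set \<Rightarrow> ('g \<times> 'm) set) set" where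
  "L_sheaf G A H scale Basis \<rho> W U =
     {\<sigma> \<in> extensional U.
        fs_morphism (sub_space (coset_space G A H) U) (assoc_bundle G A H scale Basis \<rho> W) \<sigma> \<and>
        (\<forall>y\<in>U. fst ` \<sigma> y = y)}"

text \<open>\<open>[x, v] + [x, w] = [x, v + w]\<close>, \<open>a [x, w] = [x, a w]\<close> and \<open>g [x, w] = [g x, w]\<close>.\<close>

definition cls_add :: "('g \<times> 'm::ab_group_add) set \<Rightarrow> ('g \<times> 'm) set \<Rightarrow> ('g \<times> 'm) set" where
  "cls_add c d = {(x, v + w) |x v w. (x, v) \<in> c \<and> (x, w) \<in> d}"

definition cls_scale :: "('k \<Rightarrow> 'm \<Rightarrow> 'm) \<Rightarrow> 'k \<Rightarrow> ('g \<times> 'm) set \<Rightarrow> ('g \<times> 'm) set" where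
  "cls_scale scale a c = {(x, scale a w) |x w. (x, w) \<in> c}"

definition cls_trans ::
  "('g, 'q) monoid_scheme \<Rightarrow> 'g \<Rightarrow> ('g \<times> 'm) set \<Rightarrow> ('g \<times> 'm) set" where
  "cls_trans G g c = (\<lambda>(x, w). (g \<otimes>\<^bsub>G\<^esub> x, w)) ` c"

text \<open>The action \<open>(g \<sigma>)(y) = g \<sigma>(g\<^sup>-\<^sup>1 y)\<close> on sections, taking sections over \<open>U\<close> to sections over
  \<open>g U\<close>, for \<open>\<L>\<^sub>G\<^sub>/\<^sub>H(W)\<close> and for \<open>M \<otimes> \<O>\<^sub>X\<close> with its diagonal equivariant structure.\<close>

definition L_trans ::
  "('g, 'q) monoid_scheme \<Rightarrow> 'g \<Rightarrow> 'g set set \<Rightarrow> ('g set \<Rightarrow> ('g \<times> 'm) set) \<Rightarrow>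
   ('g set \<Rightarrow> ('g \<times> 'm) set)" where
  "L_trans G g U \<sigma> = restrict (\<lambda>y. cls_trans G g (\<sigma> (inv\<^bsub>G\<^esub> g <#\<^bsub>G\<^esub> y))) ((\<lambda>y. g <#\<^bsub>G\<^esub> y) ` U)"

definition triv_trans ::
  "('g, 'q) monoid_scheme \<Rightarrow> ('g \<Rightarrow> 'k::field) set \<Rightarrow> ('g \<Rightarrow> 'm::ab_group_add \<Rightarrow> 'm) \<Rightarrow> 'g \<Rightarrow>
   ('g, 'k) oper set set \<Rightarrow> (('g, 'k) oper set \<Rightarrow> 'm) \<Rightarrow> (('g, 'k) oper set \<Rightarrow> 'm)" where
  "triv_trans G A \<rho> g U s =
     cut ((`) (Ad G A g) ` U) (\<lambda>x. \<rho> g (s (Ad G A (inv\<^bsub>G\<^esub> g) ` x)))"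

text \<open>\<open>F\<close> is a \<open>G\<close>-stable subbundle of \<open>M \<otimes> \<O>\<^sub>X\<close>: locally there is a frame of \<open>M \<otimes> \<O>\<^sub>X\<close> whose
  first \<open>d\<close> members are a frame of \<open>F\<close>.\<close>

definition equivariant_subbundle ::
  "('g, 'q) monoid_scheme \<Rightarrow> ('g \<Rightarrow> 'k::field) set \<Rightarrow> (('g, 'k) oper set, 'k) fun_space \<Rightarrow>
   ('k \<Rightarrow> 'm::ab_group_add \<Rightarrow> 'm) \<Rightarrow> 'm set \<Rightarrow> ('g \<Rightarrow> 'm \<Rightarrow> 'm) \<Rightarrow>
   (('g, 'k) oper set set \<Rightarrow> (('g, 'k) oper set \<Rightarrow> 'm) set) \<Rightarrow> bool" where
  "equivariant_subbundle G A X scale Basis \<rho> F \<longleftrightarrow>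
     subsheaf X scale Basis F \<and>
     (\<forall>x\<in>topspace (topo X). \<exists>U e d. openin (topo X) U \<and> x \<in> U \<and> d \<le> card Basis \<and>
        (\<forall>i<card Basis. e i \<in> triv_sheaf X scale Basis U) \<and>
        (\<forall>y\<in>U. inj_on (\<lambda>i. e i y) {..<card Basis} \<and>
           \<not> Modules.module.dependent scale ((\<lambda>i. e i y) ` {..<card Basis}) \<and>
           Modules.module.span scale ((\<lambda>i. e i y) ` {..<card Basis}) = UNIV) \<and>
        (\<forall>V. openin (topo X) V \<and> V \<subseteq> U \<longrightarrow>
           F V = {\<lambda>y. \<Sum>i<d. scale (a i y) (e i y) |a. \<forall>i<d. a i \<in> regf X V})) \<and>
     (\<forall>g\<in>carrier G. \<forall>U. openin (topo X) U \<longrightarrow>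
        (\<forall>s\<in>F U. triv_trans G A \<rho> g U s \<in> F ((`) (Ad G A g) ` U)))"

text \<open>\<open>\<Phi>\<close> is an isomorphism of \<open>G\<close>-equivariant sheaves of \<open>\<O>\<close>-modules from \<open>\<L>\<^sub>G\<^sub>/\<^sub>H(W)\<close> to the subsheaf
  \<open>F\<close> of \<open>M \<otimes> \<O>\<^sub>X\<close>, where \<open>G/H\<close> and \<open>X\<close> are identified through \<open>orb\<close>.  As \<open>G\<close> is reduced,
  equivariance is tested on the points of \<open>G\<close>.\<close>

definition equivariant_iso ::
  "('g, 'q) monoid_scheme \<Rightarrow> ('g \<Rightarrow> 'k::field) set \<Rightarrow> 'g set \<Rightarrow>
   ('k \<Rightarrow> 'm::ab_group_add \<Rightarrow> 'm) \<Rightarrow> 'm set \<Rightarrow> ('g \<Rightarrow> 'm \<Rightarrow> 'm) \<Rightarrow> 'm set \<Rightarrow>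
   (('g, 'k) oper set, 'k) fun_space \<Rightarrow> ('g set \<Rightarrow> ('g, 'k) oper set) \<Rightarrow>
   (('g, 'k) oper set set \<Rightarrow> (('g, 'k) oper set \<Rightarrow> 'm) set) \<Rightarrow>
   ('g set set \<Rightarrow> ('g set \<Rightarrow> ('g \<times> 'm) set) \<Rightarrow> ('g, 'k) oper set \<Rightarrow> 'm) \<Rightarrow> bool" where
  "equivariant_iso G A H scale Basis \<rho> W X orb F \<Phi> \<longleftrightarrow>
     (\<forall>U. openin (topo (coset_space G A H)) U \<longrightarrow>
        (let L = L_sheaf G A H scale Basis \<rho> W U in
          bij_betw (\<Phi> U) L (F (orb ` U)) \<and>
          (\<forall>\<sigma>\<in>L. \<forall>\<tau>\<in>L. \<Phi> U (\<lambda>y\<in>U. cls_add (\<sigma> y) (\<tau> y)) = \<Phi> U \<sigma> + \<Phi> U \<tau>) \<and>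
          (\<forall>f\<in>regf X (orb ` U). \<forall>\<sigma>\<in>L.
             \<Phi> U (\<lambda>y\<in>U. cls_scale scale (f (orb y)) (\<sigma> y)) = (\<lambda>x. scale (f x) (\<Phi> U \<sigma> x))) \<and>
          (\<forall>V. openin (topo (coset_space G A H)) V \<and> V \<subseteq> U \<longrightarrow>
             (\<forall>\<sigma>\<in>L. \<Phi> V (restrict \<sigma> V) = cut (orb ` V) (\<Phi> U \<sigma>))) \<and>
          (\<forall>g\<in>carrier G. \<forall>\<sigma>\<in>L.
             \<Phi> ((\<lambda>y. g <#\<^bsub>G\<^esub> y) ` U) (L_trans G g U \<sigma>) = triv_trans G A \<rho> g (orb ` U) (\<Phi> U \<sigma>))))"

text \<open>The identification \<open>\<L>\<^sub>G\<^sub>/\<^sub>H(M) \<simeq> M \<otimes> \<O>\<^sub>X\<close> takes the class of \<open>(x, m)\<close> to \<open>x m\<close>.  The inclusion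
  \<open>\<L>\<^sub>G\<^sub>/\<^sub>H(W) \<subseteq> \<L>\<^sub>G\<^sub>/\<^sub>H(M)\<close> is the identity on classes, so the following says that \<open>\<Phi>\<close> is compatible
  with the embeddings of \<open>\<L>\<^sub>G\<^sub>/\<^sub>H(W)\<close> and \<open>F\<close> into the trivial bundle.\<close>

definition over_trivial_bundle ::
  "('g, 'q) monoid_scheme \<Rightarrow> ('g \<Rightarrow> 'k::field) set \<Rightarrow> 'g set \<Rightarrow>
   ('k \<Rightarrow> 'm::ab_group_add \<Rightarrow> 'm) \<Rightarrow> 'm set \<Rightarrow> ('g \<Rightarrow> 'm \<Rightarrow> 'm) \<Rightarrow> 'm set \<Rightarrow>
   ('g set \<Rightarrow> ('g, 'k) oper set) \<Rightarrow>
   ('g set set \<Rightarrow> ('g set \<Rightarrow> ('g \<times> 'm) set) \<Rightarrow> ('g, 'k) oper set \<Rightarrow> 'm) \<Rightarrow> bool" where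
  "over_trivial_bundle G A H scale Basis \<rho> W orb \<Phi> \<longleftrightarrow>
     (\<forall>U. openin (topo (coset_space G A H)) U \<longrightarrow>
        (\<forall>\<sigma>\<in>L_sheaf G A H scale Basis \<rho> W U. \<forall>y\<in>U. \<forall>(x, m)\<in>\<sigma> y. \<Phi> U \<sigma> (orb y) = \<rho> x m))"


section \<open>Orbits\<close>

definition orbit ::
  "('g, 'q) monoid_scheme \<Rightarrow> ('g \<Rightarrow> 'k::field) set \<Rightarrow> ('g, 'k) oper set \<Rightarrow>
   ('g, 'k) oper set set" where
  "orbit G A \<epsilon> = (\<lambda>g. Ad G A g ` \<epsilon>) ` carrier G"

definition stabilizer ::
  "('g, 'q) monoid_scheme \<Rightarrow> ('g \<Rightarrow> 'k::field) set \<Rightarrow> ('g, 'k) oper set \<Rightarrow> 'g set" where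
  "stabilizer G A \<epsilon> = {g \<in> carrier G. Ad G A g ` \<epsilon> = \<epsilon>}"

definition orbit_map ::
  "('g, 'q) monoid_scheme \<Rightarrow> ('g \<Rightarrow> 'k::field) set \<Rightarrow> ('g, 'k) oper set \<Rightarrow>
   'g set \<Rightarrow> ('g, 'k) oper set" where
  "orbit_map G A \<epsilon> c = the_elem ((\<lambda>g. Ad G A g ` \<epsilon>) ` c)"

end

theory Submission
  imports Defs
begin

text \<open>
  Write \<open>\<pi>(g) = Ad(g) \<epsilon>\<close>.  The ideal \<open>J\<close> of \<open>\<uu>(x)\<close> is generated by the commuting nilpotent elements of \<open>x\<close>, so
  the fibre \<open>E(x)\<close> at \<open>x \<in> X\<close> of the image or kernel sheaf is described by the words of length \<open>j\<close>
  in \<open>x\<close> acting on \<open>M\<close>, and \<open>E(\<pi>(g)) = \<rho>(g) W\<close> with \<open>W\<close> the \<open>j\<close>-th radical or socle layer.  Pulled back to \<open>G\<close>,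
  \<open>E\<close> is spanned by the sections \<open>g \<mapsto> \<rho>(g) w\<close>.  Gauss-Jordan elimination turns these locally into
  an echelon frame, which is determined by \<open>E\<close> and therefore descends along the open map \<open>\<pi>\<close>.  Hence
  the sections with values in \<open>E\<close> form a subbundle of \<open>M \<otimes> \<O>\<^sub>X\<close>.  The same elimination on the torsor of
  frames shows that the image sheaf consists of all sections with values in the pull-back of \<open>E\<close>, and
  on \<open>X\<close> that a subsheaf is determined by its pull-back.  Finally a section \<open>g H \<mapsto> [g, w]\<close> of
  \<open>\<L>\<^sub>G\<^sub>/\<^sub>H(W)\<close> is the same as the function \<open>\<pi>(g) \<mapsto> \<rho>(g) w\<close> with values in \<open>E\<close>.
\<close>

section \<open>Spaces with functions\<close>

text \<open>The projection from G to G/H need not have local sections in the Zariski topology, so a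
  basis of W cannot be carried to X along such a section; this is why a frame in normal form is
  wanted. The elimination depends on constant rank, and this comes from homogeneity: over a general
  locally closed X the dimension of the fibres may jump, and the two sheaves need not be bundles.
  The hypothesis X \<simeq> G/H acts mainly through \<open>openin_XX\<close> and
  \<open>regf_XX\<close>: a subset of X is open, and a function on an open set is regular, exactly
  if its pull-back to G is. So regularity on X, which is defined by way of the Grassmannian, can be
  tested on G. The image and kernel sheaves are given by a definite description, hence both
  existence and uniqueness of the descended sheaf have to be shown. For this purpose every sheaf is
  compared with \<open>bundle_sections\<close> of a family E of subspaces, which reduces questions
  about stalks to values at points. Only \<epsilon> itself is related to the Jacobson radical; the
  other points of X are reached from it by Ad.\<close>

lemma cut_in [simp]: "x \<in> U \<Longrightarrow> cut U f x = f x"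
  and cut_out [simp]: "x \<notin> U \<Longrightarrow> cut U f x = 0"
  by (auto simp: cut_def)

text \<open>Affine spaces, their subsets and their quotients are all handled through these axioms.
  Openness of the non-vanishing set together with regularity of the inverse replaces local rings.
  \<open>regf_local\<close> states gluing and, because the neighbourhoods V need not lie in U, also
  restriction. Since \<open>inverse 0 = 0\<close>, the inverse is already extended by zero.\<close>

locale function_space =
  fixes Y :: "('x, 'k::field) fun_space"
  assumes regf_out: "f \<in> regf Y U \<Longrightarrow> x \<notin> U \<Longrightarrow> f x = 0"
    and regf_const: "openin (topo Y) U \<Longrightarrow> cut U (\<lambda>_. c) \<in> regf Y U"
    and regf_add: "\<lbrakk>openin (topo Y) U; f \<in> regf Y U; g \<in> regf Y U\<rbrakk> \<Longrightarrow> f + g \<in> regf Y U"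
    and regf_mult: "\<lbrakk>openin (topo Y) U; f \<in> regf Y U; g \<in> regf Y U\<rbrakk> \<Longrightarrow> f * g \<in> regf Y U"
    and openin_nonzero: "\<lbrakk>openin (topo Y) U; f \<in> regf Y U\<rbrakk> \<Longrightarrow> openin (topo Y) {x \<in> U. f x \<noteq> 0}"
    and regf_inverse: "\<lbrakk>openin (topo Y) U; f \<in> regf Y U\<rbrakk> \<Longrightarrow>
          (\<lambda>x. inverse (f x)) \<in> regf Y {x \<in> U. f x \<noteq> 0}"
    and regf_local: "\<lbrakk>openin (topo Y) U; \<And>x. x \<notin> U \<Longrightarrow> s x = 0;
          \<And>x. x \<in> U \<Longrightarrow> \<exists>V t. openin (topo Y) V \<and> x \<in> V \<and> t \<in> regf Y V \<and> (\<forall>y\<in>V \<inter> U. s y = t y)\<rbrakk>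
          \<Longrightarrow> s \<in> regf Y U"
begin

lemma regf_cut:
  assumes "openin (topo Y) U" "f \<in> regf Y U" "openin (topo Y) V" "V \<subseteq> U"
  shows "cut V f \<in> regf Y V"
  using assms by (intro regf_local) (auto simp: cut_def)

lemma regf_0: "openin (topo Y) U \<Longrightarrow> 0 \<in> regf Y U"
  using regf_const[of U 0] by (simp add: cut_def zero_fun_def)

lemma regf_cmult:
  assumes "openin (topo Y) U" "f \<in> regf Y U"
  shows "(\<lambda>x. c * f x) \<in> regf Y U"
proof -
  have "(\<lambda>x. c * f x) = cut U (\<lambda>_. c) * f"
    using regf_out[OF assms(2)] by (auto simp: fun_eq_iff cut_def)
  then show ?thesis
    using regf_mult regf_const assms by simp
qed

lemma regf_mult': "\<lbrakk>openin (topo Y) U; f \<in> regf Y U; g \<in> regf Y U\<rbrakk> \<Longrightarrow> (\<lambda>x. f x * g x) \<in> regf Y U"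
  using regf_mult[of U f g] by (simp add: times_fun_def)

lemma regf_add': "\<lbrakk>openin (topo Y) U; f \<in> regf Y U; g \<in> regf Y U\<rbrakk> \<Longrightarrow> (\<lambda>x. f x + g x) \<in> regf Y U"
  using regf_add[of U f g] by (simp add: plus_fun_def)

lemma regf_sum:
  assumes "openin (topo Y) U" "\<And>i. i \<in> I \<Longrightarrow> f i \<in> regf Y U"
  shows "(\<lambda>x. \<Sum>i\<in>I. f i x) \<in> regf Y U"
  using assms(2)
proof (induction I rule: infinite_finite_induct)
  case (insert i I)
  then show ?case
    using regf_add'[OF assms(1), of "f i" "\<lambda>x. \<Sum>i\<in>I. f i x"] by simp
qed (use regf_0[OF assms(1)] in \<open>simp_all add: zero_fun_def\<close>)

end

section \<open>Affine spaces\<close>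

definition function_algebra :: "'x set \<Rightarrow> ('x \<Rightarrow> 'k::comm_ring_1) set \<Rightarrow> bool" where
  "function_algebra P A \<longleftrightarrow> (\<forall>f\<in>A. \<forall>x. x \<notin> P \<longrightarrow> f x = 0) \<and> (\<forall>c. cut P (\<lambda>_. c) \<in> A) \<and>
     (\<forall>f\<in>A. \<forall>g\<in>A. f + g \<in> A \<and> f * g \<in> A)"

lemma function_algebra_fun_alg: "function_algebra P (fun_alg P S)"
proof -
  have "f x = 0" if "f \<in> fun_alg P S" "x \<notin> P" for f x
    using that by (induction rule: fun_alg.induct) auto
  then show ?thesis
    unfolding function_algebra_def by (simp add: fun_alg.const fun_alg.add fun_alg.mult)
qed

lemma function_algebra_cmult:
  assumes "function_algebra P A" "f \<in> A"
  shows "(\<lambda>x. c * f x) \<in> A"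
proof -
  have "(\<lambda>x. c * f x) = cut P (\<lambda>_. c) * f"
    using assms by (auto simp: function_algebra_def cut_def fun_eq_iff)
  then show ?thesis
    using assms by (simp add: function_algebra_def)
qed

lemma function_algebra_0: "function_algebra P A \<Longrightarrow> 0 \<in> A"
proof -
  assume "function_algebra P A"
  then have "cut P (\<lambda>_. 0) \<in> A"
    by (simp add: function_algebra_def)
  moreover have "cut P (\<lambda>_. 0) = 0"
    by (auto simp: cut_def)
  ultimately show ?thesis
    by metis
qed

lemma function_algebra_sum:
  assumes "function_algebra P A" "\<And>i. i \<in> I \<Longrightarrow> f i \<in> A"
  shows "(\<lambda>x. \<Sum>i\<in>I. f i x) \<in> A"
  using assms(2)
proof (induction I rule: infinite_finite_induct)
  case (insert i I)
  then have "f i + (\<lambda>x. \<Sum>i\<in>I. f i x) \<in> A"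
    using assms(1) by (simp add: function_algebra_def)
  then show ?case
    using insert by (simp add: plus_fun_def)
qed (use function_algebra_0[OF assms(1)] in \<open>simp_all add: zero_fun_def\<close>)

lemma openin_affine_space_basic:
  "f \<in> A \<Longrightarrow> openin (topo (affine_space P A)) {x \<in> P. f x \<noteq> 0}"
  by (auto simp: affine_space_def Let_def intro!: topology_generated_by_Basis)

lemma topspace_affine_space:
  assumes "function_algebra P A"
  shows "topspace (topo (affine_space P A)) = P"
proof -
  have "cut P (\<lambda>_. 1) \<in> A"
    using assms by (auto simp: function_algebra_def)
  then have "x \<in> \<Union>{{x \<in> P. f x \<noteq> 0} |f. f \<in> A}" if "x \<in> P" for x
    using that by (intro UnionI[of "{x \<in> P. cut P (\<lambda>_. 1) x \<noteq> 0}"]) auto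
  then show ?thesis
    by (auto simp: affine_space_def Let_def)
qed

lemma regf_affine_space:
  "s \<in> regf (affine_space P A) U \<longleftrightarrow> (\<forall>x. x \<notin> U \<longrightarrow> s x = 0) \<and>
     (\<forall>x\<in>U. \<exists>V a b. openin (topo (affine_space P A)) V \<and> x \<in> V \<and> V \<subseteq> U \<and> a \<in> A \<and> b \<in> A \<and>
        (\<forall>y\<in>V. b y \<noteq> 0 \<and> s y = a y / b y))"
  by (auto simp: affine_space_def Let_def)

text \<open>Regular functions are locally fractions with numerator and denominator in A, so the
  axioms are identities of fractions on a common neighbourhood; a reciprocal exists where the
  numerator does not vanish, which is a basic open set.\<close>

lemma function_space_affine_space:
  assumes A: "function_algebra P A"
  shows "function_space (affine_space P A)" (is "function_space ?Y")
proof -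
  have one: "cut P (\<lambda>_. c) \<in> A" for c
    using A by (auto simp: function_algebra_def)
  have ts: "openin (topo ?Y) U \<Longrightarrow> U \<subseteq> P" for U
    using openin_subset topspace_affine_space[OF A] by metis
  have nz: "openin (topo ?Y) {x \<in> U. f x \<noteq> 0}"
    and inv: "(\<lambda>x. inverse (f x)) \<in> regf ?Y {x \<in> U. f x \<noteq> 0}"
    if U: "openin (topo ?Y) U" and f: "f \<in> regf ?Y U" for U f
  proof -
    have *: "\<exists>V a b. openin (topo ?Y) V \<and> x \<in> V \<and> V \<subseteq> {x \<in> U. f x \<noteq> 0} \<and> a \<in> A \<and> b \<in> A \<and>
        (\<forall>y\<in>V. b y \<noteq> 0 \<and> inverse (f y) = a y / b y)" if x: "x \<in> U" "f x \<noteq> 0" for x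
    proof -
      obtain V a b where V: "openin (topo ?Y) V" "x \<in> V" "V \<subseteq> U" "a \<in> A" "b \<in> A"
        "\<forall>y\<in>V. b y \<noteq> 0 \<and> f y = a y / b y"
        using f x by (auto simp: regf_affine_space)
      have "openin (topo ?Y) (V \<inter> {x \<in> P. a x \<noteq> 0})"
        using V by (intro openin_Int openin_affine_space_basic)
      moreover have "x \<in> V \<inter> {x \<in> P. a x \<noteq> 0}"
        using V x ts[OF V(1)] by auto
      ultimately show ?thesis
        using V by (intro exI[of _ "V \<inter> {x \<in> P. a x \<noteq> 0}"] exI[of _ b] exI[of _ a]) auto
    qed
    show "openin (topo ?Y) {x \<in> U. f x \<noteq> 0}"
      using * by (subst openin_subopen) blast
    show "(\<lambda>x. inverse (f x)) \<in> regf ?Y {x \<in> U. f x \<noteq> 0}"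
      unfolding regf_affine_space using * that(2) by (auto simp: regf_affine_space)
  qed
  \<comment> \<open>Handles sum and product together: h is any function whose fraction can be
    computed from those of f and g.\<close>
  have binop: "h \<in> regf ?Y U"
    if U: "openin (topo ?Y) U" and f: "f \<in> regf ?Y U" "g \<in> regf ?Y U"
      and out: "\<And>x. x \<notin> U \<Longrightarrow> h x = 0"
      and h: "\<And>a b c d. \<lbrakk>a \<in> A; b \<in> A; c \<in> A; d \<in> A\<rbrakk> \<Longrightarrow> \<exists>a'\<in>A. \<exists>b'\<in>A. \<forall>y. b y \<noteq> 0 \<longrightarrow> d y \<noteq> 0 \<longrightarrow>
         f y = a y / b y \<longrightarrow> g y = c y / d y \<longrightarrow> b' y \<noteq> 0 \<and> h y = a' y / b' y" for U f g h
    unfolding regf_affine_space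
  proof (intro conjI allI ballI impI)
    fix x assume x: "x \<in> U"
    obtain V a b where V: "openin (topo ?Y) V" "x \<in> V" "V \<subseteq> U" "a \<in> A" "b \<in> A"
      "\<forall>y\<in>V. b y \<noteq> 0 \<and> f y = a y / b y"
      using f(1) x unfolding regf_affine_space by blast
    obtain V' c d where V': "openin (topo ?Y) V'" "x \<in> V'" "V' \<subseteq> U" "c \<in> A" "d \<in> A"
      "\<forall>y\<in>V'. d y \<noteq> 0 \<and> g y = c y / d y"
      using f(2) x unfolding regf_affine_space by blast
    obtain a' b' where "a' \<in> A" "b' \<in> A" "\<forall>y. b y \<noteq> 0 \<longrightarrow> d y \<noteq> 0 \<longrightarrow>
         f y = a y / b y \<longrightarrow> g y = c y / d y \<longrightarrow> b' y \<noteq> 0 \<and> h y = a' y / b' y"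
      using h[OF V(4,5) V'(4,5)] by blast
    then show "\<exists>V a b. openin (topo ?Y) V \<and> x \<in> V \<and> V \<subseteq> U \<and> a \<in> A \<and> b \<in> A \<and>
        (\<forall>y\<in>V. b y \<noteq> 0 \<and> h y = a y / b y)"
      using V V' by (intro exI[of _ "V \<inter> V'"] exI[of _ a'] exI[of _ b']) auto
  qed (use out in auto)
  show ?thesis
  proof
    show "f x = 0" if "f \<in> regf ?Y U" "x \<notin> U" for f U x
      using that by (auto simp: regf_affine_space)
    show "cut U (\<lambda>_. c) \<in> regf ?Y U" if "openin (topo ?Y) U" for U c
      unfolding regf_affine_space
    proof (intro conjI allI ballI impI)
      fix x assume "x \<in> U"
      then show "\<exists>V a b. openin (topo ?Y) V \<and> x \<in> V \<and> V \<subseteq> U \<and> a \<in> A \<and> b \<in> A \<and>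
        (\<forall>y\<in>V. b y \<noteq> 0 \<and> cut U (\<lambda>_. c) y = a y / b y)"
        using that one ts[OF that]
        by (intro exI[of _ U] exI[of _ "cut P (\<lambda>_. c)"] exI[of _ "cut P (\<lambda>_. 1)"]) (auto simp: subset_iff)
    qed simp
    show "f + g \<in> regf ?Y U" if "openin (topo ?Y) U" "f \<in> regf ?Y U" "g \<in> regf ?Y U" for U f g
    proof (rule binop[OF that])
      fix a b c d assume "a \<in> A" "b \<in> A" "c \<in> A" "d \<in> A"
      then have "a * d + c * b \<in> A" "b * d \<in> A"
        using A by (auto simp: function_algebra_def)
      then show "\<exists>a'\<in>A. \<exists>b'\<in>A. \<forall>y. b y \<noteq> 0 \<longrightarrow> d y \<noteq> 0 \<longrightarrow>
         f y = a y / b y \<longrightarrow> g y = c y / d y \<longrightarrow> b' y \<noteq> 0 \<and> (f + g) y = a' y / b' y"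
        by (intro bexI[of _ "a * d + c * b"] bexI[of _ "b * d"]) (auto simp: add_frac_eq)
    qed (use that in \<open>auto simp: regf_affine_space\<close>)
    show "f * g \<in> regf ?Y U" if "openin (topo ?Y) U" "f \<in> regf ?Y U" "g \<in> regf ?Y U" for U f g
    proof (rule binop[OF that])
      fix a b c d assume "a \<in> A" "b \<in> A" "c \<in> A" "d \<in> A"
      then have "a * c \<in> A" "b * d \<in> A"
        using A by (auto simp: function_algebra_def)
      then show "\<exists>a'\<in>A. \<exists>b'\<in>A. \<forall>y. b y \<noteq> 0 \<longrightarrow> d y \<noteq> 0 \<longrightarrow>
         f y = a y / b y \<longrightarrow> g y = c y / d y \<longrightarrow> b' y \<noteq> 0 \<and> (f * g) y = a' y / b' y"
        by (intro bexI[of _ "a * c"] bexI[of _ "b * d"]) auto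
    qed (use that in \<open>auto simp: regf_affine_space\<close>)
    show "s \<in> regf ?Y U" if U: "openin (topo ?Y) U" and out: "\<And>x. x \<notin> U \<Longrightarrow> s x = 0"
      and loc: "\<And>x. x \<in> U \<Longrightarrow> \<exists>V t. openin (topo ?Y) V \<and> x \<in> V \<and> t \<in> regf ?Y V \<and> (\<forall>y\<in>V \<inter> U. s y = t y)" for U s
      unfolding regf_affine_space
    proof (intro conjI allI ballI impI)
      fix x assume "x \<in> U"
      obtain V t where V: "openin (topo ?Y) V" "x \<in> V" "t \<in> regf ?Y V" "\<forall>y\<in>V \<inter> U. s y = t y"
        using loc[OF \<open>x \<in> U\<close>] by blast
      obtain V' a b where V': "openin (topo ?Y) V'" "x \<in> V'" "V' \<subseteq> V" "a \<in> A" "b \<in> A"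
        "\<forall>y\<in>V'. b y \<noteq> 0 \<and> t y = a y / b y"
        using V unfolding regf_affine_space by blast
      show "\<exists>V a b. openin (topo ?Y) V \<and> x \<in> V \<and> V \<subseteq> U \<and> a \<in> A \<and> b \<in> A \<and>
        (\<forall>y\<in>V. b y \<noteq> 0 \<and> s y = a y / b y)"
        using V V' U \<open>x \<in> U\<close>
        by (intro exI[of _ "V' \<inter> U"] exI[of _ a] exI[of _ b]) auto
    qed (use out in auto)
  qed (use nz inv in auto)
qed

lemma regf_affine_space_top:
  assumes "function_algebra P A" "f \<in> A"
  shows "f \<in> regf (affine_space P A) P"
proof -
  have "openin (topo (affine_space P A)) P"
    using topspace_affine_space[OF assms(1)] by (metis openin_topspace)
  moreover have "cut P (\<lambda>_. 1) \<in> A"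
    using assms by (auto simp: function_algebra_def)
  ultimately have "\<exists>V a b. openin (topo (affine_space P A)) V \<and> x \<in> V \<and> V \<subseteq> P \<and> a \<in> A \<and> b \<in> A \<and>
        (\<forall>y\<in>V. b y \<noteq> 0 \<and> f y = a y / b y)" if "x \<in> P" for x
    using that assms(2) by (intro exI[of _ P] exI[of _ f] exI[of _ "cut P (\<lambda>_. 1)"]) auto
  then show ?thesis
    unfolding regf_affine_space using assms by (auto simp: function_algebra_def)
qed

section \<open>Induced structures on subsets\<close>

lemma openin_sub_space: "openin (topo (sub_space Y S)) U \<longleftrightarrow> (\<exists>T. openin (topo Y) T \<and> U = T \<inter> S)"
  by (auto simp: sub_space_def openin_subtopology)

lemma topspace_sub_space: "topspace (topo (sub_space Y S)) = topspace (topo Y) \<inter> S"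
  by (simp add: sub_space_def)

lemma regf_sub_space:
  "s \<in> regf (sub_space Y S) U \<longleftrightarrow> (\<forall>x. x \<notin> U \<longrightarrow> s x = 0) \<and>
     (\<forall>x\<in>U. \<exists>W t. openin (topo Y) W \<and> x \<in> W \<and> t \<in> regf Y W \<and> (\<forall>y \<in> W \<inter> U. s y = t y))"
  by (auto simp: sub_space_def)

lemma (in function_space) function_space_sub_space: "function_space (sub_space Y S)" (is "function_space ?Y")
proof
  show "f x = 0" if "f \<in> regf ?Y U" "x \<notin> U" for f U x
    using that by (auto simp: regf_sub_space)
  show "cut U (\<lambda>_. c) \<in> regf ?Y U" if U: "openin (topo ?Y) U" for U c
  proof -
    obtain T where "openin (topo Y) T" "U = T \<inter> S"
      using U unfolding openin_sub_space by blast
    then have "\<exists>W t. openin (topo Y) W \<and> x \<in> W \<and> t \<in> regf Y W \<and> (\<forall>y \<in> W \<inter> U. cut U (\<lambda>_. c) y = t y)"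
      if "x \<in> U" for x
      using that by (intro exI[of _ T] exI[of _ "cut T (\<lambda>_. c)"]) (auto intro: regf_const)
    then show ?thesis
      by (auto simp: regf_sub_space)
  qed
  \<comment> \<open>H is the operation in the ambient space; it is applied to local extensions of f
    and g, cut down to a common neighbourhood.\<close>
  have binop: "h \<in> regf ?Y U"
    if f: "f \<in> regf ?Y U" "g \<in> regf ?Y U"
      and out: "\<And>x. x \<notin> U \<Longrightarrow> h x = 0"
      and H: "\<And>W s t. \<lbrakk>openin (topo Y) W; s \<in> regf Y W; t \<in> regf Y W\<rbrakk> \<Longrightarrow> H s t \<in> regf Y W"
      and h: "\<And>s t y. s y = f y \<Longrightarrow> t y = g y \<Longrightarrow> h y = H s t y" for U f g h H
    unfolding regf_sub_space
  proof (intro conjI allI ballI impI)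
    fix x assume x: "x \<in> U"
    obtain W t where W: "openin (topo Y) W" "x \<in> W" "t \<in> regf Y W" "\<forall>y\<in>W \<inter> U. f y = t y"
      using f(1) x unfolding regf_sub_space by blast
    obtain W' t' where W': "openin (topo Y) W'" "x \<in> W'" "t' \<in> regf Y W'" "\<forall>y\<in>W' \<inter> U. g y = t' y"
      using f(2) x unfolding regf_sub_space by blast
    have "H (cut (W \<inter> W') t) (cut (W \<inter> W') t') \<in> regf Y (W \<inter> W')"
      using W W' by (intro H regf_cut[where V = "W \<inter> W'"]) auto
    then show "\<exists>W t. openin (topo Y) W \<and> x \<in> W \<and> t \<in> regf Y W \<and> (\<forall>y\<in>W \<inter> U. h y = t y)"
      using W W' by (intro exI[of _ "W \<inter> W'"] exI[of _ "H (cut (W \<inter> W') t) (cut (W \<inter> W') t')"])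
        (auto intro!: h)
  qed (use out in auto)
  show "f + g \<in> regf ?Y U" if "openin (topo ?Y) U" "f \<in> regf ?Y U" "g \<in> regf ?Y U" for U f g
    by (rule binop[OF that(2,3), where H = "(+)"]) (use that in \<open>auto simp: regf_sub_space intro: regf_add\<close>)
  show "f * g \<in> regf ?Y U" if "openin (topo ?Y) U" "f \<in> regf ?Y U" "g \<in> regf ?Y U" for U f g
    by (rule binop[OF that(2,3), where H = "(*)"]) (use that in \<open>auto simp: regf_sub_space intro: regf_mult\<close>)
  have *: "\<exists>W t. openin (topo Y) W \<and> x \<in> W \<and> t \<in> regf Y W \<and> W \<inter> U \<subseteq> {x \<in> U. f x \<noteq> 0} \<and>
        (\<forall>y\<in>W \<inter> U. inverse (f y) = t y)" if f: "f \<in> regf ?Y U" and x: "x \<in> U" "f x \<noteq> 0" for U f x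
  proof -
    obtain W t where W: "openin (topo Y) W" "x \<in> W" "t \<in> regf Y W" "\<forall>y\<in>W \<inter> U. f y = t y"
      using f x unfolding regf_sub_space by blast
    then show ?thesis
      using x by (intro exI[of _ "{x \<in> W. t x \<noteq> 0}"] exI[of _ "\<lambda>x. inverse (t x)"])
        (auto intro: regf_inverse openin_nonzero)
  qed
  show "openin (topo ?Y) {x \<in> U. f x \<noteq> 0}" if U: "openin (topo ?Y) U" and f: "f \<in> regf ?Y U" for U f
  proof (subst openin_subopen, intro ballI)
    fix x assume "x \<in> {x \<in> U. f x \<noteq> 0}"
    then obtain W where W: "openin (topo Y) W" "x \<in> W" "W \<inter> U \<subseteq> {x \<in> U. f x \<noteq> 0}"
      using *[OF f] by blast
    obtain T where T: "openin (topo Y) T" "U = T \<inter> S"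
      using U by (auto simp: openin_sub_space)
    have "openin (topo ?Y) (W \<inter> U)"
      unfolding openin_sub_space using W T by (intro exI[of _ "W \<inter> T"]) auto
    then show "\<exists>T. openin (topo ?Y) T \<and> x \<in> T \<and> T \<subseteq> {x \<in> U. f x \<noteq> 0}"
      using W \<open>x \<in> {x \<in> U. f x \<noteq> 0}\<close> by blast
  qed
  show "(\<lambda>x. inverse (f x)) \<in> regf ?Y {x \<in> U. f x \<noteq> 0}" if f: "f \<in> regf ?Y U" for U f
    unfolding regf_sub_space
  proof (intro conjI allI ballI impI)
    fix x assume "x \<in> {x \<in> U. f x \<noteq> 0}"
    then have x: "x \<in> U" "f x \<noteq> 0"
      by auto
    show "\<exists>W t. openin (topo Y) W \<and> x \<in> W \<and> t \<in> regf Y W \<and>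
        (\<forall>y\<in>W \<inter> {x \<in> U. f x \<noteq> 0}. inverse (f y) = t y)"
      using *[OF f x] by (metis (no_types, lifting) IntD1 IntD2 IntI mem_Collect_eq)
  qed (use f in \<open>auto simp: regf_sub_space\<close>)
  show "s \<in> regf ?Y U" if U: "openin (topo ?Y) U" and out: "\<And>x. x \<notin> U \<Longrightarrow> s x = 0"
    and loc: "\<And>x. x \<in> U \<Longrightarrow> \<exists>V t. openin (topo ?Y) V \<and> x \<in> V \<and> t \<in> regf ?Y V \<and> (\<forall>y\<in>V \<inter> U. s y = t y)" for U s
    unfolding regf_sub_space
  proof (intro conjI allI ballI impI)
    fix x assume x: "x \<in> U"
    obtain V t where V: "openin (topo ?Y) V" "x \<in> V" "t \<in> regf ?Y V" "\<forall>y\<in>V \<inter> U. s y = t y"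
      using loc[OF x] by blast
    obtain T where T: "openin (topo Y) T" "V = T \<inter> S"
      using V by (auto simp: openin_sub_space)
    obtain W t' where W: "openin (topo Y) W" "x \<in> W" "t' \<in> regf Y W" "\<forall>y\<in>W \<inter> V. t y = t' y"
      using V unfolding regf_sub_space by blast
    have "U \<subseteq> S"
      using U by (auto simp: openin_sub_space)
    then show "\<exists>W t. openin (topo Y) W \<and> x \<in> W \<and> t \<in> regf Y W \<and> (\<forall>y\<in>W \<inter> U. s y = t y)"
      using V W T x by (intro exI[of _ "W \<inter> T"] exI[of _ "cut (W \<inter> T) t'"]) (auto intro: regf_cut)
  qed (use out in auto)
qed

text \<open>\<open>sub_space\<close> changes the topology, while its regular functions on V are the
  local restrictions of ambient ones; on an ambient open V these are regular by locality.\<close>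

lemma (in function_space) sub_space_open:
  assumes U: "openin (topo Y) U"
  shows "openin (topo (sub_space Y U)) V \<longleftrightarrow> openin (topo Y) V \<and> V \<subseteq> U"
    and "openin (topo Y) V \<Longrightarrow> regf (sub_space Y U) V = regf Y V"
proof -
  show "openin (topo (sub_space Y U)) V \<longleftrightarrow> openin (topo Y) V \<and> V \<subseteq> U"
    using U by (auto simp: openin_sub_space)
  assume V: "openin (topo Y) V"
  show "regf (sub_space Y U) V = regf Y V"
  proof (intro equalityI subsetI)
    fix s assume "s \<in> regf (sub_space Y U) V"
    then show "s \<in> regf Y V"
      unfolding regf_sub_space using V by (intro regf_local) auto
  next
    fix s assume "s \<in> regf Y V"
    then show "s \<in> regf (sub_space Y U) V"
      unfolding regf_sub_space using V regf_out by blast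
  qed
qed

section \<open>Quotients by the fibres of a map\<close>

lemma openin_quot_space:
  "openin (topo (quot_space Y \<pi>)) U \<longleftrightarrow>
     U \<subseteq> \<pi> ` topspace (topo Y) \<and> openin (topo Y) (preim (topo Y) \<pi> U)"
  by (simp add: quot_space_def openin_quot_topology)

lemma topspace_quot_space: "topspace (topo (quot_space Y \<pi>)) = \<pi> ` topspace (topo Y)"
proof -
  have "preim (topo Y) \<pi> (\<pi> ` topspace (topo Y)) = topspace (topo Y)"
    by (auto simp: preim_def)
  then have "openin (topo (quot_space Y \<pi>)) (\<pi> ` topspace (topo Y))"
    by (simp add: openin_quot_space)
  then show ?thesis
    by (metis openin_quot_space openin_subset openin_topspace subset_antisym)
qed

lemma regf_quot_space:
  "s \<in> regf (quot_space Y \<pi>) U \<longleftrightarrow> (\<forall>y. y \<notin> U \<longrightarrow> s y = 0) \<and>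
     cut (preim (topo Y) \<pi> U) (s \<circ> \<pi>) \<in> regf Y (preim (topo Y) \<pi> U)"
  by (simp add: quot_space_def)

lemma (in function_space) function_space_quot_space: "function_space (quot_space Y \<pi>)" (is "function_space ?Y")
proof
  let ?p = "preim (topo Y) \<pi>"
  show "f x = 0" if "f \<in> regf ?Y U" "x \<notin> U" for f U x
    using that by (auto simp: regf_quot_space)
  have op: "openin (topo Y) (?p U)" if "openin (topo ?Y) U" for U
    using that by (auto simp: openin_quot_space)
  show "cut U (\<lambda>_. c) \<in> regf ?Y U" if "openin (topo ?Y) U" for U c
  proof -
    have "cut (?p U) (cut U (\<lambda>_. c) \<circ> \<pi>) = cut (?p U) (\<lambda>_. c)"
      by (auto simp: cut_def preim_def)
    then show ?thesis
      using regf_const[OF op[OF that], of c] by (simp add: regf_quot_space)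
  qed
  show "f + g \<in> regf ?Y U" if "openin (topo ?Y) U" "f \<in> regf ?Y U" "g \<in> regf ?Y U" for U f g
  proof -
    have "cut (?p U) ((f + g) \<circ> \<pi>) = cut (?p U) (f \<circ> \<pi>) + cut (?p U) (g \<circ> \<pi>)"
      by (auto simp: cut_def fun_eq_iff)
    then show ?thesis
      using that op[OF that(1)] by (simp add: regf_quot_space regf_add)
  qed
  show "f * g \<in> regf ?Y U" if "openin (topo ?Y) U" "f \<in> regf ?Y U" "g \<in> regf ?Y U" for U f g
  proof -
    have "cut (?p U) ((f * g) \<circ> \<pi>) = cut (?p U) (f \<circ> \<pi>) * cut (?p U) (g \<circ> \<pi>)"
      by (auto simp: cut_def fun_eq_iff)
    then show ?thesis
      using that op[OF that(1)] by (simp add: regf_quot_space regf_mult)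
  qed
  have pnz: "?p {x \<in> U. f x \<noteq> 0} = {x \<in> ?p U. cut (?p U) (f \<circ> \<pi>) x \<noteq> 0}" for U and f :: "_ \<Rightarrow> 'k"
    by (auto simp: preim_def cut_def)
  show "openin (topo ?Y) {x \<in> U. f x \<noteq> 0}" if "openin (topo ?Y) U" "f \<in> regf ?Y U" for U f
  proof -
    have "openin (topo Y) (?p {x \<in> U. f x \<noteq> 0})"
      using that openin_nonzero[OF op[OF that(1)]] by (simp add: pnz regf_quot_space)
    then show ?thesis
      using that(1) by (auto simp: openin_quot_space)
  qed
  show "(\<lambda>x. inverse (f x)) \<in> regf ?Y {x \<in> U. f x \<noteq> 0}" if "openin (topo ?Y) U" "f \<in> regf ?Y U" for U f
  proof -
    have "cut (?p {x \<in> U. f x \<noteq> 0}) ((\<lambda>x. inverse (f x)) \<circ> \<pi>) =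
      (\<lambda>x. inverse (cut (?p U) (f \<circ> \<pi>) x))"
      by (auto simp: cut_def preim_def)
    moreover have "(\<lambda>x. inverse (cut (?p U) (f \<circ> \<pi>) x)) \<in> regf Y (?p {x \<in> U. f x \<noteq> 0})"
      unfolding pnz using that by (intro regf_inverse[OF op[OF that(1)]]) (simp add: regf_quot_space)
    moreover have "\<forall>y. y \<notin> {x \<in> U. f x \<noteq> 0} \<longrightarrow> inverse (f y) = 0"
      using that by (auto simp: regf_quot_space)
    ultimately show ?thesis
      by (simp add: regf_quot_space)
  qed
  show "s \<in> regf ?Y U" if U: "openin (topo ?Y) U" and out: "\<And>x. x \<notin> U \<Longrightarrow> s x = 0"
    and loc: "\<And>x. x \<in> U \<Longrightarrow> \<exists>V t. openin (topo ?Y) V \<and> x \<in> V \<and> t \<in> regf ?Y V \<and> (\<forall>y\<in>V \<inter> U. s y = t y)" for U s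
    unfolding regf_quot_space
  proof (intro conjI)
    show "cut (?p U) (s \<circ> \<pi>) \<in> regf Y (?p U)"
    proof (rule regf_local[OF op[OF U]])
      fix x assume x: "x \<in> ?p U"
      then obtain V t where V: "openin (topo ?Y) V" "\<pi> x \<in> V" "t \<in> regf ?Y V" "\<forall>y\<in>V \<inter> U. s y = t y"
        using loc[of "\<pi> x"] by (auto simp: preim_def)
      then show "\<exists>V t. openin (topo Y) V \<and> x \<in> V \<and> t \<in> regf Y V \<and>
          (\<forall>y\<in>V \<inter> ?p U. cut (?p U) (s \<circ> \<pi>) y = t y)"
        using x op[OF V(1)] by (intro exI[of _ "?p V"] exI[of _ "cut (?p V) (t \<circ> \<pi>)"])
          (auto simp: regf_quot_space, auto simp: preim_def)
    qed simp
  qed (use out in auto)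
qed

section \<open>Morphisms\<close>

lemma fs_morphismD:
  assumes "fs_morphism Y Z \<psi>"
  shows "openin (topo Z) V \<Longrightarrow> openin (topo Y) (preim (topo Y) \<psi> V)"
    and "openin (topo Z) V \<Longrightarrow> s \<in> regf Z V \<Longrightarrow>
      cut (preim (topo Y) \<psi> V) (s \<circ> \<psi>) \<in> regf Y (preim (topo Y) \<psi> V)"
    and "y \<in> topspace (topo Y) \<Longrightarrow> \<psi> y \<in> topspace (topo Z)"
  using assms by (auto simp: fs_morphism_def continuous_map_def preim_def)

lemma fs_morphismI:
  assumes "\<And>y. y \<in> topspace (topo Y) \<Longrightarrow> \<psi> y \<in> topspace (topo Z)"
    and "\<And>V. openin (topo Z) V \<Longrightarrow> openin (topo Y) (preim (topo Y) \<psi> V)"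
    and "\<And>V s. openin (topo Z) V \<Longrightarrow> s \<in> regf Z V \<Longrightarrow>
      cut (preim (topo Y) \<psi> V) (s \<circ> \<psi>) \<in> regf Y (preim (topo Y) \<psi> V)"
  shows "fs_morphism Y Z \<psi>"
  using assms by (auto simp: fs_morphism_def continuous_map_def preim_def)

text \<open>Coordinates suffice: pulling back commutes with sums, products and reciprocals of
  nowhere vanishing functions, so it is enough to control the generators S. Continuity follows, as
  the topology is generated by non-vanishing sets.\<close>

lemma (in function_space) fs_morphism_affine_space:
  assumes "\<psi> ` topspace (topo Y) \<subseteq> P"
    and S: "\<And>f. f \<in> S \<Longrightarrow> cut (topspace (topo Y)) (f \<circ> \<psi>) \<in> regf Y (topspace (topo Y))"
  shows "fs_morphism Y (affine_space P (fun_alg P S)) \<psi>" (is "fs_morphism Y ?Z \<psi>")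
proof -
  let ?T = "topspace (topo Y)" and ?p = "preim (topo Y) \<psi>"
  note FA = function_algebra_fun_alg[of P S]
  have *: "cut ?T (f \<circ> \<psi>) \<in> regf Y ?T" if "f \<in> fun_alg P S" for f
    using that
  proof (induction rule: fun_alg.induct)
    case (const c)
    have "cut ?T (cut P (\<lambda>_. c) \<circ> \<psi>) = cut ?T (\<lambda>_. c)"
      using assms(1) by (auto simp: cut_def fun_eq_iff)
    then show ?case
      by (metis regf_const openin_topspace)
  next
    case (gen f)
    have "cut ?T (cut P f \<circ> \<psi>) = cut ?T (f \<circ> \<psi>)"
      using assms(1) by (auto simp: cut_def fun_eq_iff)
    then show ?case
      using S[OF gen] by metis
  next
    case (add f g)
    have "cut ?T ((f + g) \<circ> \<psi>) = cut ?T (f \<circ> \<psi>) + cut ?T (g \<circ> \<psi>)"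
      by (auto simp: cut_def)
    then show ?case
      using regf_add[OF _ add.IH] by (metis openin_topspace)
  next
    case (mult f g)
    have "cut ?T ((f * g) \<circ> \<psi>) = cut ?T (f \<circ> \<psi>) * cut ?T (g \<circ> \<psi>)"
      by (auto simp: cut_def)
    then show ?case
      using regf_mult[OF _ mult.IH] by (metis openin_topspace)
  qed
  have "continuous_map (topo Y) (topo ?Z) \<psi>"
  proof -
    have op: "openin (topo Y) (\<psi> -` {x \<in> P. f x \<noteq> 0} \<inter> ?T)" if "f \<in> fun_alg P S" for f
    proof -
      have "\<psi> -` {x \<in> P. f x \<noteq> 0} \<inter> ?T = {x \<in> ?T. cut ?T (f \<circ> \<psi>) x \<noteq> 0}"
        using assms(1) by auto
      then show ?thesis
        using openin_nonzero[OF _ *[OF that]] by simp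
    qed
    have "\<psi> ` ?T \<subseteq> \<Union>{{x \<in> P. f x \<noteq> 0} |f. f \<in> fun_alg P S}"
      using topspace_affine_space[OF FA] assms(1) by (simp add: affine_space_def Let_def)
    then show ?thesis
      unfolding affine_space_def Let_def fun_space.simps
      by (intro continuous_on_generated_topo) (auto intro: op)
  qed
  then have cont: "openin (topo Y) (?p V)" if "openin (topo ?Z) V" for V
    using that by (auto simp: continuous_map_def preim_def)
  show ?thesis
  proof (rule fs_morphismI)
    fix V s assume V: "openin (topo ?Z) V" and s: "s \<in> regf ?Z V"
    show "cut (?p V) (s \<circ> \<psi>) \<in> regf Y (?p V)"
    proof (rule regf_local[OF cont[OF V]])
      fix x assume x: "x \<in> ?p V"
      then obtain W a b where W: "openin (topo ?Z) W" "\<psi> x \<in> W" "W \<subseteq> V" "a \<in> fun_alg P S"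
        "b \<in> fun_alg P S" "\<forall>y\<in>W. b y \<noteq> 0 \<and> s y = a y / b y"
        using s unfolding regf_affine_space preim_def by blast
      let ?a = "cut (?p W) (cut ?T (a \<circ> \<psi>))" and ?b = "cut (?p W) (cut ?T (b \<circ> \<psi>))"
      have W': "openin (topo Y) (?p W)" "?p W \<subseteq> ?T"
        using cont[OF W(1)] by (auto simp: preim_def)
      then have ab: "?a \<in> regf Y (?p W)" "?b \<in> regf Y (?p W)"
        by (auto intro!: regf_cut[OF _ *[OF W(4)] W'] regf_cut[OF _ *[OF W(5)] W'])
      \<comment> \<open>The denominator has no zero on W, so its reciprocal is regular on the whole
        preimage.\<close>
      have "{x \<in> ?p W. ?b x \<noteq> 0} = ?p W"
        using W W' by (auto simp: preim_def)
      with regf_inverse[OF W'(1) ab(2)] have "(\<lambda>x. inverse (?b x)) \<in> regf Y (?p W)"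
        by simp
      then have "(\<lambda>x. ?a x * inverse (?b x)) \<in> regf Y (?p W)"
        using W' ab by (intro regf_mult') auto
      then show "\<exists>V' t. openin (topo Y) V' \<and> x \<in> V' \<and> t \<in> regf Y V' \<and>
        (\<forall>y\<in>V' \<inter> ?p V. cut (?p V) (s \<circ> \<psi>) y = t y)"
        using W W' x by (intro exI[of _ "?p W"] exI[of _ "\<lambda>x. ?a x * inverse (?b x)"])
          (auto simp: preim_def field_simps)
    qed simp
  qed (use cont topspace_affine_space[OF FA] assms(1) in auto)
qed

lemma fs_morphism_quot_space: "fs_morphism Y (quot_space Y \<pi>) \<pi>"
  by (rule fs_morphismI) (auto simp: openin_quot_space regf_quot_space topspace_quot_space)

lemma fs_morphism_comp:
  assumes f: "fs_morphism X Y f" and g: "fs_morphism Y Z g"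
  shows "fs_morphism X Z (g \<circ> f)"
proof -
  have *: "preim (topo X) (g \<circ> f) V = preim (topo X) f (preim (topo Y) g V)" for V
    using fs_morphismD(3)[OF f] by (auto simp: preim_def)
  show ?thesis
  proof (rule fs_morphismI)
    fix V s assume "openin (topo Z) V" "s \<in> regf Z V"
    then have "cut (preim (topo X) f (preim (topo Y) g V)) (cut (preim (topo Y) g V) (s \<circ> g) \<circ> f) \<in>
      regf X (preim (topo X) f (preim (topo Y) g V))"
      by (intro fs_morphismD[OF f] fs_morphismD[OF g])
    moreover have "cut (preim (topo X) f (preim (topo Y) g V)) (cut (preim (topo Y) g V) (s \<circ> g) \<circ> f) =
        cut (preim (topo X) (g \<circ> f) V) (s \<circ> (g \<circ> f))"
      unfolding * by (auto simp: cut_def preim_def)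
    ultimately show "cut (preim (topo X) (g \<circ> f) V) (s \<circ> (g \<circ> f)) \<in> regf X (preim (topo X) (g \<circ> f) V)"
      by (simp add: *)
  next
    fix V assume "openin (topo Z) V"
    then show "openin (topo X) (preim (topo X) (g \<circ> f) V)"
      unfolding * by (intro fs_morphismD[OF f] fs_morphismD[OF g])
  qed (use fs_morphismD(3)[OF f] fs_morphismD(3)[OF g] in auto)
qed

lemma fs_morphism_sub_space: "fs_morphism (sub_space Y S) Y id" if "function_space Y"
proof -
  interpret function_space Y by fact
  have *: "preim (topo (sub_space Y S)) id V = V \<inter> S" if "openin (topo Y) V" for V
    using openin_subset[OF that] by (auto simp: preim_def topspace_sub_space)
  show ?thesis
    by (rule fs_morphismI) (auto simp: * topspace_sub_space openin_sub_space regf_sub_space)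
qed

section \<open>Bundles of subspaces of a trivial bundle\<close>

text \<open>E is any family of subsets, with no regularity built in; that it varies regularly is
  expressed by the existence of frames below. The value on sets that are not open matches the
  normalisation in \<open>subsheaf\<close>.\<close>

definition bundle_sections ::
  "('x, 'k::field) fun_space \<Rightarrow> ('k \<Rightarrow> 'm::ab_group_add \<Rightarrow> 'm) \<Rightarrow> 'm set \<Rightarrow> ('x \<Rightarrow> 'm set) \<Rightarrow>
   'x set \<Rightarrow> ('x \<Rightarrow> 'm) set" where
  "bundle_sections Y scale Basis E U =
     (if openin (topo Y) U then {s \<in> triv_sheaf Y scale Basis U. \<forall>y\<in>U. s y \<in> E y} else {})"

text \<open>A frame \<open>v\<^sub>0, \<dots>, v\<^sub>d\<^sub>-\<^sub>1\<close> of \<open>E\<close> in reduced echelon form, with pivots \<open>bb 0, \<dots>, bb (d - 1)\<close>.  Such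
  a frame is determined by \<open>E\<close> and the pivots, which makes it descend along quotients.\<close>

definition echelon_frame ::
  "('x, 'k::field) fun_space \<Rightarrow> ('k \<Rightarrow> 'm::ab_group_add \<Rightarrow> 'm) \<Rightarrow> 'm set \<Rightarrow> ('x \<Rightarrow> 'm set) \<Rightarrow>
   'x set \<Rightarrow> nat \<Rightarrow> (nat \<Rightarrow> 'm) \<Rightarrow> (nat \<Rightarrow> 'x \<Rightarrow> 'm) \<Rightarrow> bool" where
  "echelon_frame Y scale Basis E U d bb v \<longleftrightarrow> openin (topo Y) U \<and>
     (\<forall>i<d. bb i \<in> Basis \<and> v i \<in> bundle_sections Y scale Basis E U) \<and>
     (\<forall>y\<in>U. \<forall>i<d. \<forall>l<d.
        Modules.module.representation scale Basis (v i y) (bb l) = (if i = l then 1 else 0)) \<and>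
     (\<forall>y\<in>U. \<forall>e\<in>E y.
        e = (\<Sum>i<d. scale (Modules.module.representation scale Basis e (bb i)) (v i y)))"

text \<open>The rank is one number for the whole space, which is the situation on an orbit.\<close>

definition vector_subbundle ::
  "('x, 'k::field) fun_space \<Rightarrow> ('k \<Rightarrow> 'm::ab_group_add \<Rightarrow> 'm) \<Rightarrow> 'm set \<Rightarrow> ('x \<Rightarrow> 'm set) \<Rightarrow>
   nat \<Rightarrow> bool" where
  "vector_subbundle Y scale Basis E d \<longleftrightarrow>
     (\<forall>y\<in>topspace (topo Y). Modules.module.subspace scale (E y) \<and> vector_space.dim scale (E y) = d \<and>
        (\<exists>U bb v. y \<in> U \<and> echelon_frame Y scale Basis E U d bb v))"

section \<open>Coordinates in a fixed basis of M\<close>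

context finite_dimensional_vector_space
begin

abbreviation coord :: "'b \<Rightarrow> 'b \<Rightarrow> 'a" where
  "coord b v \<equiv> representation Basis v b"

lemma coord_simps [simp]:
  "coord b 0 = 0" "coord b (v + w) = coord b v + coord b w" "coord b (v - w) = coord b v - coord b w"
  "coord b (scale c v) = c * coord b v"
  by (simp_all add: representation_zero representation_add representation_diff representation_scale
      independent_Basis span_Basis)

lemma coord_sum [simp]: "coord b (\<Sum>i\<in>I. f i) = (\<Sum>i\<in>I. coord b (f i))"
  by (simp add: representation_sum independent_Basis span_Basis)

lemma coord_Basis: "c \<in> Basis \<Longrightarrow> coord b c = (if b = c then 1 else 0)"
  by (simp add: representation_basis independent_Basis)

lemma sum_coord: "(\<Sum>b\<in>Basis. scale (coord b v) b) = v"
  by (rule sum_representation_eq) (auto simp: independent_Basis span_Basis finite_Basis)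

lemma coord_eqI: "(\<And>b. b \<in> Basis \<Longrightarrow> coord b v = coord b w) \<Longrightarrow> v = w"
  by (metis (no_types, lifting) sum.cong sum_coord)

end

section \<open>Sections of the trivial bundle and its subsheaves\<close>

locale trivial_bundle = finite_dimensional_vector_space scale Basis + function_space Y
  for scale :: "'k::field \<Rightarrow> 'm::ab_group_add \<Rightarrow> 'm" and Basis :: "'m set"
    and Y :: "('x, 'k) fun_space"
begin

abbreviation "triv \<equiv> triv_sheaf Y scale Basis"
abbreviation "bsec \<equiv> bundle_sections Y scale Basis"

lemma triv_iff: "s \<in> triv U \<longleftrightarrow> (\<forall>b\<in>Basis. (\<lambda>x. coord b (s x)) \<in> regf Y U)"
proof
  assume "s \<in> triv U"
  then obtain f where f: "s = (\<lambda>x. \<Sum>b\<in>Basis. scale (f b x) b)" "\<forall>b\<in>Basis. f b \<in> regf Y U"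
    by (auto simp: triv_sheaf_def)
  have "(\<lambda>x. coord b (s x)) = f b" if "b \<in> Basis" for b
  proof
    fix x
    have "coord b (s x) = (\<Sum>c\<in>Basis. f c x * (if b = c then 1 else 0))"
      by (simp add: f coord_Basis)
    then show "coord b (s x) = f b x"
      using that finite_Basis by (simp add: if_distrib cong: if_cong)
  qed
  with f show "\<forall>b\<in>Basis. (\<lambda>x. coord b (s x)) \<in> regf Y U"
    by simp
next
  assume "\<forall>b\<in>Basis. (\<lambda>x. coord b (s x)) \<in> regf Y U"
  then show "s \<in> triv U"
    unfolding triv_sheaf_def by (auto simp: sum_coord intro!: exI[of _ "\<lambda>b x. coord b (s x)"])
qed

lemma triv_out: "s \<in> triv U \<Longrightarrow> x \<notin> U \<Longrightarrow> s x = 0"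
  by (rule coord_eqI) (auto simp: triv_iff dest: regf_out)

lemma regf_coord:
  assumes "s \<in> triv U" and U: "openin (topo Y) U"
  shows "(\<lambda>x. coord b (s x)) \<in> regf Y U"
proof (cases "b \<in> Basis")
  case False
  then have "coord b v = 0" for v
    using representation_ne_zero by blast
  then show ?thesis
    using regf_0[OF U] by (simp add: zero_fun_def)
qed (use assms in \<open>simp add: triv_iff\<close>)

lemma triv_0: "openin (topo Y) U \<Longrightarrow> 0 \<in> triv U"
  using regf_0 by (auto simp: triv_iff zero_fun_def)

lemma triv_add: "\<lbrakk>openin (topo Y) U; s \<in> triv U; t \<in> triv U\<rbrakk> \<Longrightarrow> s + t \<in> triv U"
  by (auto simp: triv_iff intro: regf_add')

lemma triv_smult: "\<lbrakk>openin (topo Y) U; f \<in> regf Y U; s \<in> triv U\<rbrakk> \<Longrightarrow> (\<lambda>x. scale (f x) (s x)) \<in> triv U"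
  by (auto simp: triv_iff intro: regf_mult')

lemma triv_sum:
  "\<lbrakk>openin (topo Y) U; \<And>i. i \<in> I \<Longrightarrow> s i \<in> triv U\<rbrakk> \<Longrightarrow> (\<lambda>x. \<Sum>i\<in>I. s i x) \<in> triv U"
  by (auto simp: triv_iff intro: regf_sum)

lemma triv_const: "openin (topo Y) U \<Longrightarrow> cut U (\<lambda>_. m) \<in> triv U"
proof -
  have "(\<lambda>x. coord b (cut U (\<lambda>_. m) x)) = cut U (\<lambda>_. coord b m)" for b
    by (auto simp: cut_def)
  then show "openin (topo Y) U \<Longrightarrow> ?thesis"
    by (auto simp: triv_iff regf_const)
qed

lemma triv_local:
  assumes U: "openin (topo Y) U" and out: "\<And>x. x \<notin> U \<Longrightarrow> s x = 0"
    and loc: "\<And>x. x \<in> U \<Longrightarrow> \<exists>V t. openin (topo Y) V \<and> x \<in> V \<and> t \<in> triv V \<and> (\<forall>y\<in>V \<inter> U. s y = t y)"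
  shows "s \<in> triv U"
  unfolding triv_iff
proof (intro ballI regf_local[OF U])
  fix b x assume b: "b \<in> Basis" and x: "x \<in> U"
  obtain V t where "openin (topo Y) V \<and> x \<in> V \<and> t \<in> triv V \<and> (\<forall>y\<in>V \<inter> U. s y = t y)"
    using loc[OF x] by blast
  then show "\<exists>V t. openin (topo Y) V \<and> x \<in> V \<and> t \<in> regf Y V \<and> (\<forall>y\<in>V \<inter> U. coord b (s y) = t y)"
    using b by (intro exI[of _ V] exI[of _ "\<lambda>y. coord b (t y)"]) (auto simp: triv_iff)
qed (simp add: out)

lemma triv_cut:
  assumes "openin (topo Y) U" "s \<in> triv U" "openin (topo Y) V" "V \<subseteq> U"
  shows "cut V s \<in> triv V"
  using assms by (intro triv_local) (auto intro: exI[of _ U])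

lemma bsec_subsheaf:
  assumes "\<And>y. y \<in> topspace (topo Y) \<Longrightarrow> subspace (E y)"
  shows "subsheaf Y scale Basis (bsec E)"
proof -
  have E: "subspace (E y)" if "openin (topo Y) U" "y \<in> U" for y U
    using assms that openin_subset by blast
  show ?thesis
    unfolding subsheaf_def
  proof (intro conjI allI impI)
    fix U assume U: "openin (topo Y) U"
    show "0 \<in> bsec E U"
      using U E[OF U] by (auto simp: bundle_sections_def triv_0 subspace_0)
    show "\<forall>s\<in>bsec E U. \<forall>t\<in>bsec E U. s + t \<in> bsec E U"
      using U E[OF U] by (auto simp: bundle_sections_def triv_add subspace_add)
    show "\<forall>f\<in>regf Y U. \<forall>s\<in>bsec E U. (\<lambda>x. scale (f x) (s x)) \<in> bsec E U"
      using U E[OF U] by (auto simp: bundle_sections_def triv_smult subspace_scale)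
    show "\<forall>s\<in>bsec E U. cut V s \<in> bsec E V" if "openin (topo Y) V \<and> V \<subseteq> U" for V
      using U that by (auto simp: bundle_sections_def triv_cut)
    show "\<forall>s\<in>triv U. (\<forall>x\<in>U. \<exists>V. openin (topo Y) V \<and> x \<in> V \<and> V \<subseteq> U \<and> cut V s \<in> bsec E V) \<longrightarrow> s \<in> bsec E U"
    proof (intro ballI impI)
      fix s assume s: "s \<in> triv U"
        and loc: "\<forall>x\<in>U. \<exists>V. openin (topo Y) V \<and> x \<in> V \<and> V \<subseteq> U \<and> cut V s \<in> bsec E V"
      have "s x \<in> E x" if x: "x \<in> U" for x
      proof -
        obtain V where "openin (topo Y) V" "x \<in> V" "cut V s \<in> bsec E V"
          using bspec[OF loc x] by auto
        then have "cut V s x \<in> E x"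
          by (simp add: bundle_sections_def)
        then show ?thesis
          using \<open>x \<in> V\<close> by simp
      qed
      then show "s \<in> bsec E U"
        using U s by (simp add: bundle_sections_def)
    qed
  qed (auto simp: bundle_sections_def)
qed

lemma subsheaf_D:
  assumes F: "subsheaf Y scale Basis F"
  shows "\<not> openin (topo Y) U \<Longrightarrow> F U = {}"
    and "s \<in> F U \<Longrightarrow> openin (topo Y) U"
    and "s \<in> F U \<Longrightarrow> s \<in> triv U"
    and "openin (topo Y) U \<Longrightarrow> 0 \<in> F U"
    and "\<lbrakk>s \<in> F U; t \<in> F U\<rbrakk> \<Longrightarrow> (\<lambda>x. s x + t x) \<in> F U"
    and "\<lbrakk>f \<in> regf Y U; s \<in> F U\<rbrakk> \<Longrightarrow> (\<lambda>x. scale (f x) (s x)) \<in> F U"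
    and "\<lbrakk>s \<in> F U; openin (topo Y) V; V \<subseteq> U\<rbrakk> \<Longrightarrow> cut V s \<in> F V"
    and "\<lbrakk>s \<in> triv U; openin (topo Y) U;
      \<And>x. x \<in> U \<Longrightarrow> \<exists>V. openin (topo Y) V \<and> x \<in> V \<and> V \<subseteq> U \<and> cut V s \<in> F V\<rbrakk> \<Longrightarrow> s \<in> F U"
proof -
  show op: "s \<in> F U \<Longrightarrow> openin (topo Y) U" for s
    using F by (auto simp: subsheaf_def)
  show "s \<in> F U \<Longrightarrow> s \<in> triv U"
  proof -
    assume s: "s \<in> F U"
    have "openin (topo Y) U \<longrightarrow> F U \<subseteq> triv U"
      using F by (simp add: subsheaf_def)
    with s op show "s \<in> triv U"
      by blast
  qed
  show "\<lbrakk>s \<in> F U; t \<in> F U\<rbrakk> \<Longrightarrow> (\<lambda>x. s x + t x) \<in> F U"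
  proof -
    assume st: "s \<in> F U" "t \<in> F U"
    have "openin (topo Y) U \<longrightarrow> (\<forall>s\<in>F U. \<forall>t\<in>F U. s + t \<in> F U)"
      using F by (simp add: subsheaf_def)
    with st op have "s + t \<in> F U"
      by simp
    then show "(\<lambda>x. s x + t x) \<in> F U"
      by (simp add: plus_fun_def)
  qed
  show "\<lbrakk>f \<in> regf Y U; s \<in> F U\<rbrakk> \<Longrightarrow> (\<lambda>x. scale (f x) (s x)) \<in> F U"
  proof -
    assume fs: "f \<in> regf Y U" "s \<in> F U"
    have "openin (topo Y) U \<longrightarrow> (\<forall>f\<in>regf Y U. \<forall>s\<in>F U. (\<lambda>x. scale (f x) (s x)) \<in> F U)"
      using F by (simp add: subsheaf_def)
    with fs op show "(\<lambda>x. scale (f x) (s x)) \<in> F U"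
      by simp
  qed
  show "\<lbrakk>s \<in> F U; openin (topo Y) V; V \<subseteq> U\<rbrakk> \<Longrightarrow> cut V s \<in> F V"
  proof -
    assume s: "s \<in> F U" and V: "openin (topo Y) V" "V \<subseteq> U"
    have "openin (topo Y) U \<longrightarrow> (\<forall>V. openin (topo Y) V \<and> V \<subseteq> U \<longrightarrow> (\<forall>s\<in>F U. cut V s \<in> F V))"
      using F by (simp add: subsheaf_def)
    with s V op show "cut V s \<in> F V"
      by simp
  qed
  show "\<lbrakk>s \<in> triv U; openin (topo Y) U;
      \<And>x. x \<in> U \<Longrightarrow> \<exists>V. openin (topo Y) V \<and> x \<in> V \<and> V \<subseteq> U \<and> cut V s \<in> F V\<rbrakk> \<Longrightarrow> s \<in> F U"
  proof -
    assume s: "s \<in> triv U" and U: "openin (topo Y) U"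
      and loc: "\<And>x. x \<in> U \<Longrightarrow> \<exists>V. openin (topo Y) V \<and> x \<in> V \<and> V \<subseteq> U \<and> cut V s \<in> F V"
    have "openin (topo Y) U \<longrightarrow> (\<forall>s\<in>triv U.
        (\<forall>x\<in>U. \<exists>V. openin (topo Y) V \<and> x \<in> V \<and> V \<subseteq> U \<and> cut V s \<in> F V) \<longrightarrow> s \<in> F U)"
      using F by (simp add: subsheaf_def)
    with s U loc show "s \<in> F U"
      by simp
  qed
qed (use F in \<open>auto simp: subsheaf_def\<close>)

lemma subsheaf_sum:
  assumes F: "subsheaf Y scale Basis F" and "openin (topo Y) U" "\<And>i. i \<in> I \<Longrightarrow> s i \<in> F U"
  shows "(\<lambda>x. \<Sum>i\<in>I. s i x) \<in> F U"
  using assms(3)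
proof (induction I rule: infinite_finite_induct)
  case (insert i I)
  then show ?case
    using subsheaf_D(5)[OF F, of "s i" U "\<lambda>x. \<Sum>i\<in>I. s i x"] by simp
qed (use subsheaf_D(4)[OF F assms(2)] in \<open>simp_all add: zero_fun_def\<close>)

lemma subsheaf_diff:
  assumes F: "subsheaf Y scale Basis F" and s: "s \<in> F U" and t: "t \<in> F U"
  shows "(\<lambda>x. s x - t x) \<in> F U"
proof -
  have U: "openin (topo Y) U"
    using subsheaf_D(2)[OF F s] .
  have t': "(\<lambda>x. scale (cut U (\<lambda>_. - 1) x) (t x)) \<in> F U"
    by (intro subsheaf_D(6)[OF F _ t] regf_const U)
  have "(\<lambda>x. s x - t x) = (\<lambda>x. s x + scale (cut U (\<lambda>_. - 1) x) (t x))"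
    using triv_out[OF subsheaf_D(3)[OF F t]] by (auto simp: fun_eq_iff cut_def)
  then show ?thesis
    using subsheaf_D(5)[OF F s t'] by simp
qed

text \<open>Gauss-Jordan elimination works on germs because a pivot that is nonzero at \<open>y0\<close> is invertible near \<open>y0\<close>.\<close>

lemma echelon_germs:
  fixes n :: nat
  assumes F: "subsheaf Y scale Basis F"
    and u: "\<And>i. i < n \<Longrightarrow> y0 \<in> U i \<and> u i \<in> F (U i)"
    and indep: "\<And>i. i < n \<Longrightarrow> u i y0 \<notin> span ((\<lambda>l. u l y0) ` {..<i})"
    and y0: "y0 \<in> topspace (topo Y)"
  shows "\<exists>N bb v. openin (topo Y) N \<and> y0 \<in> N \<and>
    (\<forall>i<n. bb i \<in> Basis \<and> v i \<in> F N \<and> v i y0 \<in> span ((\<lambda>l. u l y0) ` {..<n})) \<and>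
    (\<forall>y\<in>N. \<forall>i<n. \<forall>l<n. coord (bb l) (v i y) = (if i = l then 1 else 0))"
  using u indep
proof (induction n)
  case 0
  then show ?case
    using y0 by (intro exI[of _ "topspace (topo Y)"]) auto
next
  case (Suc n)
  have "\<exists>N bb v. openin (topo Y) N \<and> y0 \<in> N \<and>
    (\<forall>i<n. bb i \<in> Basis \<and> v i \<in> F N \<and> v i y0 \<in> span ((\<lambda>l. u l y0) ` {..<n})) \<and>
    (\<forall>y\<in>N. \<forall>i<n. \<forall>l<n. coord (bb l) (v i y) = (if i = l then 1 else 0))"
    by (rule Suc.IH) (use Suc.prems less_SucI in blast)+
  then obtain N bb v where "openin (topo Y) N \<and> y0 \<in> N \<and>
    (\<forall>i<n. bb i \<in> Basis \<and> v i \<in> F N \<and> v i y0 \<in> span ((\<lambda>l. u l y0) ` {..<n})) \<and>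
    (\<forall>y\<in>N. \<forall>i<n. \<forall>l<n. coord (bb l) (v i y) = (if i = l then 1 else 0))"
    by (elim exE) (rule that)
  then have N: "openin (topo Y) N" "y0 \<in> N"
    and v: "\<And>i. i < n \<Longrightarrow> bb i \<in> Basis \<and> v i \<in> F N \<and> v i y0 \<in> span ((\<lambda>l. u l y0) ` {..<n})"
    and delta: "\<And>y i l. y \<in> N \<Longrightarrow> i < n \<Longrightarrow> l < n \<Longrightarrow> coord (bb l) (v i y) = (if i = l then 1 else 0)"
    by auto
  have un: "y0 \<in> U n" "u n \<in> F (U n)" "openin (topo Y) (U n)"
    using Suc.prems(1)[of n] subsheaf_D(2)[OF F] by auto
  define N1 where "N1 = N \<inter> U n"
  have N1: "openin (topo Y) N1" "y0 \<in> N1" "N1 \<subseteq> N" "N1 \<subseteq> U n"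
    using N un by (auto simp: N1_def)
  define u1 where "u1 = cut N1 (u n)"
  define w where "w i = cut N1 (v i)" for i
  have u1: "u1 \<in> F N1"
    unfolding u1_def by (rule subsheaf_D(7)[OF F un(2) N1(1,4)])
  have w: "w i \<in> F N1" if "i < n" for i
    unfolding w_def by (rule subsheaf_D(7)[OF F _ N1(1,3)]) (use v[OF that] in simp)
  have wdelta: "coord (bb l) (w i y) = (if i = l then 1 else 0)" if "y \<in> N1" "i < n" "l < n" for y i l
    using delta[of y i l] that N1 by (auto simp: w_def)
  \<comment> \<open>The new germ with its components along the old pivots removed, so that all old
    pivot columns are zero (\<open>u2c\<close>).\<close>
  define u2 where "u2 = (\<lambda>y. u1 y - (\<Sum>i<n. scale (coord (bb i) (u1 y)) (w i y)))"
  have u2: "u2 \<in> F N1"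
    unfolding u2_def
    by (intro subsheaf_diff[OF F] u1 subsheaf_sum[OF F] N1 subsheaf_D(6)[OF F] regf_coord
        subsheaf_D(3)[OF F u1] w) auto
  have u2c: "coord (bb l) (u2 y) = 0" if "y \<in> N1" "l < n" for y l
  proof -
    have "coord (bb l) (u2 y) = coord (bb l) (u1 y) - (\<Sum>i<n. coord (bb i) (u1 y) * (if i = l then 1 else 0))"
      using that by (simp add: u2_def wdelta)
    then show ?thesis
      using that by (simp add: if_distrib cong: if_cong)
  qed
  let ?S = "span ((\<lambda>l. u l y0) ` {..<Suc n})"
  have S: "v i y0 \<in> ?S" if "i < n" for i
  proof -
    have "(\<lambda>l. u l y0) ` {..<n} \<subseteq> (\<lambda>l. u l y0) ` {..<Suc n}"
      by (intro image_mono) auto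
    then show ?thesis
      using v[OF that] span_mono by blast
  qed
  \<comment> \<open>Independence is used here, and only at y0: the v i y0 stay in the span of the
    earlier u l y0, so a zero would put u n y0 into that span. This is why the induction carries the
    span condition along.\<close>
  have "u2 y0 \<noteq> 0"
  proof
    assume "u2 y0 = 0"
    then have "u n y0 = (\<Sum>i<n. scale (coord (bb i) (u1 y0)) (v i y0))"
      using N1 by (simp add: u2_def u1_def w_def)
    also have "\<dots> \<in> span ((\<lambda>l. u l y0) ` {..<n})"
      using v by (intro span_sum span_scale) auto
    finally show False
      using Suc.prems(2)[of n] by simp
  qed
  \<comment> \<open>A new pivot is chosen at y0; N2 below is the neighbourhood where it remains
    invertible.\<close>
  then obtain b where b: "b \<in> Basis" "coord b (u2 y0) \<noteq> 0"
    using coord_eqI[of "u2 y0" 0] by auto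
  define c where "c = (\<lambda>y. coord b (u2 y))"
  have c: "c \<in> regf Y N1"
    unfolding c_def by (rule regf_coord[OF subsheaf_D(3)[OF F u2] N1(1)])
  define N2 where "N2 = {y \<in> N1. c y \<noteq> 0}"
  have N2: "openin (topo Y) N2" "y0 \<in> N2" "N2 \<subseteq> N1"
    using openin_nonzero[OF N1(1) c] N1 b by (auto simp: N2_def c_def)
  have cinv: "(\<lambda>y. inverse (c y)) \<in> regf Y N2"
    using regf_inverse[OF N1(1) c] by (simp add: N2_def)
  define vn where "vn = (\<lambda>y. scale (inverse (c y)) (cut N2 u2 y))"
  have vn: "vn \<in> F N2"
    unfolding vn_def by (intro subsheaf_D(6)[OF F] cinv subsheaf_D(7)[OF F u2] N2)
  \<comment> \<open>Clears the new pivot column in the old vectors; their old columns are unchanged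
    because vn is zero there.\<close>
  define v' where "v' i = (\<lambda>y. cut N2 (w i) y - scale (coord b (cut N2 (w i) y)) (vn y))" for i
  have v': "v' i \<in> F N2" if "i < n" for i
  proof -
    have "cut N2 (w i) \<in> F N2"
      using subsheaf_D(7)[OF F w[OF that]] N2 by simp
    then show ?thesis
      unfolding v'_def
      by (intro subsheaf_diff[OF F] subsheaf_D(6)[OF F] regf_coord vn subsheaf_D(3)[OF F] N2)
  qed
  have u2S: "u2 y0 \<in> ?S"
    unfolding u2_def u1_def w_def using N1(2) S
    by (intro span_diff span_sum span_scale) (auto intro: span_base)
  define bb'' where "bb'' i = (if i = n then b else bb i)" for i
  define v'' where "v'' i = (if i = n then vn else v' i)" for i
  show ?case
  proof (intro exI[of _ N2] exI[of _ bb''] exI[of _ v''] conjI allI impI ballI)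
    fix i assume i: "i < Suc n"
    show "bb'' i \<in> Basis"
      using i v b by (auto simp: bb''_def)
    show "v'' i \<in> F N2"
      using i vn v' by (auto simp: v''_def)
    show "v'' i y0 \<in> ?S"
    proof (cases "i = n")
      case True
      then show ?thesis
        using u2S N2 by (simp add: v''_def vn_def span_scale)
    next
      case False
      then have "v i y0 \<in> ?S"
        using i S by simp
      then show ?thesis
        using False u2S N2 N1(2) by (simp add: v''_def v'_def vn_def w_def span_scale span_diff)
    qed
  next
    fix y i l assume y: "y \<in> N2" and i: "i < Suc n" and l: "l < Suc n"
    then have y1: "y \<in> N1" "c y \<noteq> 0"
      by (auto simp: N2_def)
    have 1: "coord b (vn y) = 1"
      using y y1 by (simp add: vn_def c_def)
    have 2: "coord (bb l) (vn y) = 0" if "l < n" for l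
      using y y1 that by (simp add: vn_def u2c)
    show "coord (bb'' l) (v'' i y) = (if i = l then 1 else 0)"
      using i l y y1 1 2 by (auto simp: bb''_def v''_def v'_def wdelta less_Suc_eq)
  qed (use N2 in auto)
qed

text \<open>Germs of F lifting a basis of the single fibre E y0 suffice. After elimination the pivot
  columns form an identity matrix, so the d vectors stay independent at all nearby points, and since
  dim (E y) = d they span there too. Constant rank is what turns a frame taken from F into a frame
  of E.\<close>

lemma echelon_frame_exists:
  assumes F: "subsheaf Y scale Basis F" and FE: "\<And>U. F U \<subseteq> bsec E U"
    and E: "\<And>y. y \<in> topspace (topo Y) \<Longrightarrow> subspace (E y) \<and> dim (E y) = d"
    and y0: "y0 \<in> topspace (topo Y)"
    and germs: "\<And>w. w \<in> E y0 \<Longrightarrow> \<exists>U s. y0 \<in> U \<and> s \<in> F U \<and> s y0 = w"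
  shows "\<exists>N bb v. y0 \<in> N \<and> echelon_frame Y scale Basis E N d bb v \<and> (\<forall>i<d. v i \<in> F N)"
proof -
  obtain C where C: "finite C" "C \<subseteq> E y0" "independent C" "span C = E y0" "card C = d"
    using E[OF y0] by (metis basis_subspace_exists)
  obtain c where c: "bij_betw c {0..<d} C"
    using ex_bij_betw_nat_finite[OF C(1)] C(5) by auto
  have cC: "c i \<in> C" if "i < d" for i
    using c that by (auto simp: bij_betw_def)
  have "\<exists>U s. y0 \<in> U \<and> s \<in> F U \<and> s y0 = c i" if "i < d" for i
    using germs cC[OF that] C by blast
  then obtain U u where u: "\<And>i. i < d \<Longrightarrow> y0 \<in> U i \<and> u i \<in> F (U i) \<and> u i y0 = c i"
    by metis
  have indep: "u i y0 \<notin> span ((\<lambda>l. u l y0) ` {..<i})" if "i < d" for i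
  proof -
    have "(\<lambda>l. u l y0) ` {..<i} \<subseteq> C - {c i}"
    proof clarify
      fix l assume l: "l < i"
      then have "c l \<noteq> c i"
        using c that by (auto simp: bij_betw_def dest: inj_onD)
      then show "u l y0 \<in> C - {c i}"
        using l that u[of l] cC[of l] by simp
    qed
    then have "span ((\<lambda>l. u l y0) ` {..<i}) \<subseteq> span (C - {c i})"
      by (rule span_mono)
    moreover have "c i \<notin> span (C - {c i})"
      using C(3) cC[OF that] by (auto simp: dependent_def)
    ultimately show ?thesis
      using u[OF that] by auto
  qed
  have "\<exists>N bb v. openin (topo Y) N \<and> y0 \<in> N \<and>
    (\<forall>i<d. bb i \<in> Basis \<and> v i \<in> F N \<and> v i y0 \<in> span ((\<lambda>l. u l y0) ` {..<d})) \<and>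
    (\<forall>y\<in>N. \<forall>i<d. \<forall>l<d. coord (bb l) (v i y) = (if i = l then 1 else 0))"
    by (rule echelon_germs[OF F, where U = U]) (use u indep y0 in auto)
  then obtain N bb v where "openin (topo Y) N \<and> y0 \<in> N \<and>
    (\<forall>i<d. bb i \<in> Basis \<and> v i \<in> F N \<and> v i y0 \<in> span ((\<lambda>l. u l y0) ` {..<d})) \<and>
    (\<forall>y\<in>N. \<forall>i<d. \<forall>l<d. coord (bb l) (v i y) = (if i = l then 1 else 0))"
    by (elim exE) (rule that)
  then have N: "openin (topo Y) N" "y0 \<in> N"
    and v: "\<And>i. i < d \<Longrightarrow> bb i \<in> Basis \<and> v i \<in> F N"
    and delta: "\<And>y i l. y \<in> N \<Longrightarrow> i < d \<Longrightarrow> l < d \<Longrightarrow> coord (bb l) (v i y) = (if i = l then 1 else 0)"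
    by auto
  have "e = (\<Sum>i<d. scale (coord (bb i) e) (v i y))" if y: "y \<in> N" and e: "e \<in> E y" for y e
  proof -
    let ?B = "(\<lambda>i. v i y) ` {..<d}"
    have inj: "inj_on (\<lambda>i. v i y) {..<d}"
      by (rule inj_onI) (metis delta y lessThan_iff one_neq_zero)
    \<comment> \<open>At its pivot coordinate this vector is 1 and all other vectors of ?B vanish,
      so it is not in their span.\<close>
    have "independent ?B"
      unfolding dependent_def
    proof (clarify)
      fix i assume i: "i < d" "v i y \<in> span (?B - {v i y})"
      have "subspace {x. coord (bb i) x = 0}"
        by (auto simp: subspace_def)
      moreover have "?B - {v i y} \<subseteq> {x. coord (bb i) x = 0}"
        using delta[OF y _ i(1)] by auto
      ultimately have "v i y \<in> {x. coord (bb i) x = 0}"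
        using span_minimal i(2) by blast
      then show False
        using delta[OF y i(1) i(1)] by simp
    qed
    moreover have yT: "y \<in> topspace (topo Y)"
      using y N openin_subset by blast
    moreover have "?B \<subseteq> E y"
      using v FE[of N] N y by (auto simp: bundle_sections_def)
    moreover have "card ?B = d"
      using inj by (simp add: card_image)
    ultimately have "e \<in> span ?B"
      using card_ge_dim_independent[of ?B "E y"] E[OF yT] e by auto
    \<comment> \<open>The vectors reproduced by their pivot coordinates form a subspace; it contains
      ?B, hence E y.\<close>
    moreover have "subspace {e. e = (\<Sum>i<d. scale (coord (bb i) e) (v i y))}"
      unfolding subspace_def
    proof (intro conjI ballI allI CollectI; (elim CollectE)?)
      fix x c assume x: "x = (\<Sum>i<d. scale (coord (bb i) x) (v i y))"
      have "scale c x = scale c (\<Sum>i<d. scale (coord (bb i) x) (v i y))"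
        using x by (rule arg_cong)
      also have "\<dots> = (\<Sum>i<d. scale (coord (bb i) (scale c x)) (v i y))"
        by (simp add: scale_sum_right)
      finally show "scale c x = (\<Sum>i<d. scale (coord (bb i) (scale c x)) (v i y))" .
    next
      fix x z assume "x = (\<Sum>i<d. scale (coord (bb i) x) (v i y))" "z = (\<Sum>i<d. scale (coord (bb i) z) (v i y))"
      then have "x + z = (\<Sum>i<d. scale (coord (bb i) x) (v i y)) + (\<Sum>i<d. scale (coord (bb i) z) (v i y))"
        by (rule arg_cong2)
      also have "\<dots> = (\<Sum>i<d. scale (coord (bb i) (x + z)) (v i y))"
        by (simp add: scale_left_distrib sum.distrib)
      finally show "x + z = (\<Sum>i<d. scale (coord (bb i) (x + z)) (v i y))" .
    qed simp
    moreover have "?B \<subseteq> {e. e = (\<Sum>i<d. scale (coord (bb i) e) (v i y))}"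
    proof clarify
      fix l assume l: "l < d"
      have "(\<Sum>i<d. scale (coord (bb i) (v l y)) (v i y)) = (\<Sum>i<d. if i = l then v i y else 0)"
        using delta[OF y l] by (intro sum.cong) auto
      then show "v l y = (\<Sum>i<d. scale (coord (bb i) (v l y)) (v i y))"
        using l by simp
    qed
    ultimately show ?thesis
      using span_minimal by blast
  qed
  then have "echelon_frame Y scale Basis E N d bb v"
    unfolding echelon_frame_def using N v FE[of N] delta by blast
  then show ?thesis
    using N v by blast
qed

text \<open>The coefficients are coordinates of s itself, hence regular without any solving of
  equations; this is the point of the normalised pivots.\<close>

lemma echelon_frame_sections:
  assumes fr: "echelon_frame Y scale Basis E U d bb v"
    and V: "openin (topo Y) V" "V \<subseteq> U" and s: "s \<in> bsec E V"
  shows "s = (\<lambda>y. \<Sum>i<d. scale (coord (bb i) (s y)) (v i y))"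
    and "\<And>i. (\<lambda>y. coord (bb i) (s y)) \<in> regf Y V"
proof -
  have s': "s \<in> triv V" "\<And>y. y \<in> V \<Longrightarrow> s y \<in> E y"
    using s V by (auto simp: bundle_sections_def)
  show "\<And>i. (\<lambda>y. coord (bb i) (s y)) \<in> regf Y V"
    using regf_coord[OF s'(1) V(1)] .
  show "s = (\<lambda>y. \<Sum>i<d. scale (coord (bb i) (s y)) (v i y))"
  proof
    fix y show "s y = (\<Sum>i<d. scale (coord (bb i) (s y)) (v i y))"
    proof (cases "y \<in> V")
      case True
      then show ?thesis
        using fr s'(2) V by (auto simp: echelon_frame_def)
    qed (simp add: triv_out[OF s'(1)])
  qed
qed

text \<open>A form of Nakayama's lemma. If the values of sections of F fill each E y, then a frame
  of E can be taken from F, and every section of E is locally a combination of it with regular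
  coefficients. An equality of sheaves becomes a check at points.\<close>

lemma subsheaf_eq_bsec:
  assumes F: "subsheaf Y scale Basis F" and FE: "\<And>U. F U \<subseteq> bsec E U"
    and E: "\<And>y. y \<in> topspace (topo Y) \<Longrightarrow> subspace (E y) \<and> dim (E y) = d"
    and germs: "\<And>y w. y \<in> topspace (topo Y) \<Longrightarrow> w \<in> E y \<Longrightarrow> \<exists>U s. y \<in> U \<and> s \<in> F U \<and> s y = w"
  shows "F = bsec E"
proof
  fix U show "F U = bsec E U"
  proof (cases "openin (topo Y) U")
    case U: True
    have "s \<in> F U" if s: "s \<in> bsec E U" for s
    proof (rule subsheaf_D(8)[OF F _ U])
      show "s \<in> triv U"
        using s U by (simp add: bundle_sections_def)
      fix y assume y: "y \<in> U"
      then have yT: "y \<in> topspace (topo Y)"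
        using U openin_subset by blast
      obtain N bb v where N: "y \<in> N" and fr: "echelon_frame Y scale Basis E N d bb v"
        and v: "\<And>i. i < d \<Longrightarrow> v i \<in> F N"
        using echelon_frame_exists[OF F FE E yT germs[OF yT]] by blast
      let ?V = "N \<inter> U"
      have V: "openin (topo Y) ?V"
        using U fr by (auto simp: echelon_frame_def)
      have sV: "cut ?V s \<in> bsec E ?V"
        using s U V by (auto simp: bundle_sections_def intro: triv_cut)
      note fs = echelon_frame_sections[OF fr V _ sV]
      have "(\<lambda>y. \<Sum>i<d. scale (coord (bb i) (cut ?V s y)) (cut ?V (v i) y)) \<in> F ?V"
        using fs V v by (intro subsheaf_sum[OF F] subsheaf_D(6)[OF F] subsheaf_D(7)[OF F v]) auto
      moreover have "(\<Sum>i<d. scale (coord (bb i) (cut ?V s y)) (cut ?V (v i) y)) =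
          (\<Sum>i<d. scale (coord (bb i) (cut ?V s y)) (v i y))" for y
        by (cases "y \<in> ?V") auto
      ultimately have "cut ?V s \<in> F ?V"
        using fs(1) by simp
      then show "\<exists>V. openin (topo Y) V \<and> y \<in> V \<and> V \<subseteq> U \<and> cut V s \<in> F V"
        using V N y by blast
    qed
    then show ?thesis
      using FE by blast
  qed (use FE[of U] in \<open>simp add: bundle_sections_def\<close>)
qed

lemma vector_subbundle_subsheaf:
  "vector_subbundle Y scale Basis E d \<Longrightarrow> subsheaf Y scale Basis (bsec E)"
  by (rule bsec_subsheaf) (auto simp: vector_subbundle_def)

lemma vector_subbundle_section:
  assumes E: "vector_subbundle Y scale Basis E d" and y: "y \<in> topspace (topo Y)" and w: "w \<in> E y"
  obtains U s where "openin (topo Y) U" "y \<in> U" "s \<in> bsec E U" "s y = w"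
proof -
  note sub = vector_subbundle_subsheaf[OF E]
  obtain U bb v where U: "y \<in> U" and fr: "echelon_frame Y scale Basis E U d bb v"
    using E y by (auto simp: vector_subbundle_def)
  then have V: "openin (topo Y) U" "\<And>i. i < d \<Longrightarrow> v i \<in> bsec E U"
    by (auto simp: echelon_frame_def)
  let ?s = "\<lambda>x. \<Sum>i<d. scale (cut U (\<lambda>_. coord (bb i) w) x) (v i x)"
  have "?s \<in> bsec E U"
    using V by (intro subsheaf_sum[OF sub] subsheaf_D(6)[OF sub] regf_const) auto
  moreover have "?s y = w"
    using fr U w by (simp add: echelon_frame_def)
  ultimately show ?thesis
    using that U V by blast
qed

text \<open>An echelon frame makes the sheaf locally free: a pivot coordinate of a relation is one
  of its coefficients, so all relations vanish and the family of length zero generates them.\<close>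

lemma coherent_bsec:
  assumes E: "vector_subbundle Y scale Basis E d"
  shows "coherent_subsheaf Y scale Basis (bsec E)"
  unfolding coherent_subsheaf_def
proof (intro conjI ballI vector_subbundle_subsheaf[OF E])
  fix y assume "y \<in> topspace (topo Y)"
  then obtain U bb v where U: "y \<in> U" and fr: "echelon_frame Y scale Basis E U d bb v"
    using E by (auto simp: vector_subbundle_def)
  have "generates Y scale (bsec E) U d v"
    unfolding generates_def
  proof (intro conjI allI impI ballI)
    fix V u x assume V: "openin (topo Y) V \<and> V \<subseteq> U" and u: "u \<in> bsec E V" and x: "x \<in> V"
    show "\<exists>W a. openin (topo Y) W \<and> x \<in> W \<and> W \<subseteq> V \<and> (\<forall>i<d. a i \<in> regf Y W) \<and>
        (\<forall>y\<in>W. u y = (\<Sum>i<d. scale (a i y) (v i y)))"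
      using V x echelon_frame_sections(2)[OF fr _ _ u] fun_cong[OF echelon_frame_sections(1)[OF fr _ _ u]]
      by (intro exI[of _ V] exI[of _ "\<lambda>i y. coord (bb i) (u y)"]) auto
  qed (use fr in \<open>auto simp: echelon_frame_def\<close>)
  moreover have "generates Y (\<lambda>c v i. c * v i) (relation_sheaf Y scale d v) U 0 (\<lambda>_ _ _. 0)"
    unfolding generates_def
  proof (intro conjI allI impI ballI)
    fix V u x assume V: "openin (topo Y) V \<and> V \<subseteq> U" and u: "u \<in> relation_sheaf Y scale d v V" and x: "x \<in> V"
    have "u y = 0" if y: "y \<in> V" for y
    proof
      fix l show "u y l = 0 l"
      proof (cases "l < d")
        case True
        have "0 = coord (bb l) (\<Sum>i<d. scale (u y i) (v i y))"
          using u y by (simp add: relation_sheaf_def)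
        also have "\<dots> = (\<Sum>i<d. u y i * (if i = l then 1 else 0))"
          using fr V y True by (auto simp: echelon_frame_def)
        also have "\<dots> = u y l"
          using True by (simp add: if_distrib cong: if_cong)
        finally show ?thesis
          by simp
      qed (use u in \<open>simp add: relation_sheaf_def\<close>)
    qed
    then show "\<exists>W a. openin (topo Y) W \<and> x \<in> W \<and> W \<subseteq> V \<and> (\<forall>i<(0::nat). a i \<in> regf Y W) \<and>
        (\<forall>y\<in>W. u y = (\<Sum>i<0. (\<lambda>j. a i y * 0)))"
      using V x by (intro exI[of _ V]) auto
  qed simp
  ultimately show "\<exists>U n s l t. openin (topo Y) U \<and> y \<in> U \<and> generates Y scale (bsec E) U n s \<and>
        generates Y (\<lambda>c v i. c * v i) (relation_sheaf Y scale n s) U l t"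
    using fr U unfolding echelon_frame_def by blast
qed

text \<open>The frame of E is completed by the constant sections at the non-pivot vectors of Basis.
  In coordinates the two groups form a block triangular matrix with identity blocks, which is
  invertible at every point.\<close>

lemma vector_subbundle_frame:
  assumes E: "vector_subbundle Y scale Basis E d" and x: "x \<in> topspace (topo Y)"
  shows "\<exists>U e d. openin (topo Y) U \<and> x \<in> U \<and> d \<le> card Basis \<and>
        (\<forall>i<card Basis. e i \<in> triv U) \<and>
        (\<forall>y\<in>U. inj_on (\<lambda>i. e i y) {..<card Basis} \<and>
           \<not> dependent ((\<lambda>i. e i y) ` {..<card Basis}) \<and>
           span ((\<lambda>i. e i y) ` {..<card Basis}) = UNIV) \<and>
        (\<forall>V. openin (topo Y) V \<and> V \<subseteq> U \<longrightarrow>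
           bsec E V = {\<lambda>y. \<Sum>i<d. scale (a i y) (e i y) |a. \<forall>i<d. a i \<in> regf Y V})"
proof -
  note sub = vector_subbundle_subsheaf[OF E]
  obtain U bb v where U: "x \<in> U" and fr: "echelon_frame Y scale Basis E U d bb v"
    using E x by (auto simp: vector_subbundle_def)
  have oU: "openin (topo Y) U" and v: "\<And>i. i < d \<Longrightarrow> bb i \<in> Basis \<and> v i \<in> bsec E U"
    and delta: "\<And>y i l. y \<in> U \<Longrightarrow> i < d \<Longrightarrow> l < d \<Longrightarrow> coord (bb l) (v i y) = (if i = l then 1 else 0)"
    using fr by (auto simp: echelon_frame_def)
  have vt: "v i \<in> triv U" if "i < d" for i
    using v[OF that] oU by (simp add: bundle_sections_def)
  let ?n = "card Basis" and ?I = "bb ` {..<d}"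
  have I: "?I \<subseteq> Basis" "finite ?I"
    using v by auto
  have injb: "inj_on bb {..<d}"
    by (rule inj_onI) (metis delta U lessThan_iff one_neq_zero)
  then have cI: "card ?I = d"
    by (simp add: card_image)
  then have dn: "d \<le> ?n"
    using card_mono[OF finite_Basis I(1)] by simp
  have "card (Basis - ?I) = ?n - d"
    using card_Diff_subset[OF I(2,1)] cI by simp
  then obtain c where c: "bij_betw c {d..<?n} (Basis - ?I)"
    using finite_same_card_bij[of "{d..<?n}" "Basis - ?I"] finite_Basis by auto
  define e where "e i = (if i < d then v i else cut U (\<lambda>_. c i))" for i
  have et: "e i \<in> triv U" for i
    by (simp add: e_def vt triv_const oU)
  have spn: "span ((\<lambda>i. e i y) ` {..<?n}) = UNIV" (is "span ?E = _") if y: "y \<in> U" for y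
  proof -
    have 1: "b \<in> span ?E" if "b \<in> Basis - ?I" for b
    proof -
      obtain i where "i \<in> {d..<?n}" "c i = b"
        using bij_betw_imp_surj_on[OF c] \<open>b \<in> Basis - ?I\<close> by (metis imageE)
      then have "b = e i y" "i < ?n"
        using y by (auto simp: e_def)
      then show ?thesis
        by (auto intro: span_base)
    qed
    \<comment> \<open>Solving for a pivot vector: v l y is bb l plus a combination of non-pivot
      vectors.\<close>
    have 2: "bb l \<in> span ?E" if l: "l < d" for l
    proof -
      have "v l y = (\<Sum>b\<in>?I. scale (coord b (v l y)) b) + (\<Sum>b\<in>Basis - ?I. scale (coord b (v l y)) b)"
        using sum.subset_diff[OF I(1) finite_Basis, of "\<lambda>b. scale (coord b (v l y)) b"]
        by (simp add: sum_coord add.commute)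
      also have "(\<Sum>b\<in>?I. scale (coord b (v l y)) b) = (\<Sum>b\<in>?I. if b = bb l then b else 0)"
      proof (intro sum.cong refl)
        fix b assume "b \<in> ?I"
        then obtain i where i: "i < d" "b = bb i"
          by auto
        then have "b = bb l \<longleftrightarrow> l = i"
          using inj_onD[OF injb, of i l] l by auto
        then show "scale (coord b (v l y)) b = (if b = bb l then b else 0)"
          using delta[OF y l i(1)] i by auto
      qed
      also have "\<dots> = bb l"
        using I(2) l by simp
      finally have "bb l = v l y - (\<Sum>b\<in>Basis - ?I. scale (coord b (v l y)) b)"
        unfolding eq_diff_eq by (rule sym)
      also have "\<dots> \<in> span ?E"
        using l dn 1 by (intro span_diff span_sum span_scale span_base[of "v l y"])
          (auto simp: e_def intro!: image_eqI[of _ _ l])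
      finally show ?thesis .
    qed
    have "Basis \<subseteq> span ?E"
      using 1 2 by blast
    then show ?thesis
      using span_minimal[OF _ subspace_span, of Basis ?E] span_Basis by auto
  qed
  \<comment> \<open>There are as many spanning vectors as the dimension, so counting shows that they
    are distinct and independent.\<close>
  have card: "card ((\<lambda>i. e i y) ` {..<?n}) = ?n" if "y \<in> U" for y
  proof (rule antisym)
    show "card ((\<lambda>i. e i y) ` {..<?n}) \<le> ?n"
      using card_image_le[of "{..<?n}" "\<lambda>i. e i y"] by simp
    show "?n \<le> card ((\<lambda>i. e i y) ` {..<?n})"
      using dim_le_card[of UNIV "(\<lambda>i. e i y) ` {..<?n}"] spn[OF that] by simp
  qed
  have secs: "bsec E V = {\<lambda>y. \<Sum>i<d. scale (a i y) (e i y) |a. \<forall>i<d. a i \<in> regf Y V}"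
    if V: "openin (topo Y) V" "V \<subseteq> U" for V
  proof (intro equalityI subsetI)
    fix s assume s: "s \<in> bsec E V"
    show "s \<in> {\<lambda>y. \<Sum>i<d. scale (a i y) (e i y) |a. \<forall>i<d. a i \<in> regf Y V}"
      using echelon_frame_sections[OF fr V s]
      by (auto simp: e_def intro!: exI[of _ "\<lambda>i y. coord (bb i) (s y)"])
  next
    fix s assume "s \<in> {\<lambda>y. \<Sum>i<d. scale (a i y) (e i y) |a. \<forall>i<d. a i \<in> regf Y V}"
    then obtain a where a: "s = (\<lambda>y. \<Sum>i<d. scale (a i y) (e i y))" "\<And>i. i < d \<Longrightarrow> a i \<in> regf Y V"
      by auto
    have "(\<lambda>y. \<Sum>i<d. scale (a i y) (cut V (e i) y)) \<in> bsec E V"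
      using a v V by (intro subsheaf_sum[OF sub] subsheaf_D(6)[OF sub] subsheaf_D(7)[OF sub]) (auto simp: e_def)
    moreover have "scale (a i y) (cut V (e i) y) = scale (a i y) (e i y)" if "i < d" for i y
      using regf_out[OF a(2)[OF that]] by (cases "y \<in> V") auto
    ultimately show "s \<in> bsec E V"
      by (simp add: a)
  qed
  show ?thesis
  proof (intro exI[of _ U] exI[of _ e] exI[of _ d] conjI ballI allI impI)
    fix y assume y: "y \<in> U"
    show "inj_on (\<lambda>i. e i y) {..<?n}"
      using card[OF y] by (intro eq_card_imp_inj_on) auto
    show "\<not> dependent ((\<lambda>i. e i y) ` {..<?n})"
      using card[OF y] spn[OF y] by (intro card_le_dim_spanning[of _ UNIV]) auto
    show "span ((\<lambda>i. e i y) ` {..<?n}) = UNIV"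
      by (rule spn[OF y])
  qed (use oU U dn et secs in auto)
qed

end

section \<open>Pull-back and descent along a morphism\<close>

locale bundle_morphism =
  Y: trivial_bundle scale Basis Y + X: trivial_bundle scale Basis X
  for scale :: "'k::field \<Rightarrow> 'm::ab_group_add \<Rightarrow> 'm" and Basis :: "'m set"
    and Y :: "('y, 'k) fun_space" and X :: "('x, 'k) fun_space" +
  fixes q :: "'y \<Rightarrow> 'x"
  assumes q: "fs_morphism Y X q"
begin

abbreviation "pre \<equiv> preim (topo Y) q"

lemma openin_pre: "openin (topo X) U \<Longrightarrow> openin (topo Y) (pre U)"
  by (rule fs_morphismD(1)[OF q])

lemma triv_pullback:
  assumes U: "openin (topo X) U" and t: "t \<in> X.triv U"
  shows "cut (pre U) (t \<circ> q) \<in> Y.triv (pre U)"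
  unfolding Y.triv_iff
proof
  fix b assume "b \<in> Basis"
  then have "cut (pre U) ((\<lambda>x. Y.coord b (t x)) \<circ> q) \<in> regf Y (pre U)"
    using fs_morphismD(2)[OF q U] t by (simp add: X.triv_iff)
  moreover have "(\<lambda>x. Y.coord b (cut (pre U) (t \<circ> q) x)) = cut (pre U) ((\<lambda>x. Y.coord b (t x)) \<circ> q)"
    by (auto simp: cut_def)
  ultimately show "(\<lambda>x. Y.coord b (cut (pre U) (t \<circ> q) x)) \<in> regf Y (pre U)"
    by simp
qed

lemma bsec_pullback:
  assumes U: "openin (topo X) U" and t: "t \<in> X.bsec E U"
  shows "cut (pre U) (t \<circ> q) \<in> Y.bsec (E \<circ> q) (pre U)"
  using assms triv_pullback[OF U, of t] openin_pre[OF U]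
  by (auto simp: bundle_sections_def preim_def)

text \<open>A section with values in E \<circ> q is expanded along the frame of E composed with q;
  its coefficients are pivot coordinates and hence regular on Y.\<close>

lemma pullback_bsec:
  assumes E: "vector_subbundle X scale Basis E d"
  shows "pullback_sheaf Y X q scale Basis (X.bsec E) = Y.bsec (E \<circ> q)"
proof
  fix V show "pullback_sheaf Y X q scale Basis (X.bsec E) V = Y.bsec (E \<circ> q) V"
  proof (cases "openin (topo Y) V")
    case V: True
    show ?thesis
    proof (intro equalityI subsetI)
      fix s assume "s \<in> pullback_sheaf Y X q scale Basis (X.bsec E) V"
      then have s: "s \<in> Y.triv V" and loc: "\<forall>y\<in>V. \<exists>W U n f t.
        openin (topo Y) W \<and> y \<in> W \<and> W \<subseteq> V \<and> openin (topo X) U \<and> q ` W \<subseteq> U \<and>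
        (\<forall>i<(n::nat). f i \<in> regf Y W \<and> t i \<in> X.bsec E U) \<and>
        (\<forall>z\<in>W. s z = (\<Sum>i<n. scale (f i z) (t i (q z))))"
        using V by (simp_all add: pullback_sheaf_def)
      have "s y \<in> E (q y)" if y: "y \<in> V" for y
      proof -
        obtain W U n f t where W: "y \<in> W" "openin (topo X) U" "q ` W \<subseteq> U"
          and t: "\<forall>i<(n::nat). f i \<in> regf Y W \<and> t i \<in> X.bsec E U"
          and sy: "\<forall>z\<in>W. s z = (\<Sum>i<n. scale (f i z) (t i (q z)))"
          using bspec[OF loc y] by (elim exE conjE) (rule that)
        have "q y \<in> U"
          using W by auto
        then have "t i (q y) \<in> E (q y)" if "i < n" for i
          using t that W by (simp add: bundle_sections_def)
        moreover have "Y.subspace (E (q y))"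
          using E W \<open>q y \<in> U\<close> openin_subset[of "topo X" U] by (auto simp: vector_subbundle_def)
        ultimately show ?thesis
          using sy W by (auto intro!: Y.subspace_sum Y.subspace_scale)
      qed
      then show "s \<in> Y.bsec (E \<circ> q) V"
        using s V by (simp add: bundle_sections_def)
    next
      fix s assume "s \<in> Y.bsec (E \<circ> q) V"
      then have s: "s \<in> Y.triv V" "\<And>y. y \<in> V \<Longrightarrow> s y \<in> E (q y)"
        using V by (auto simp: bundle_sections_def)
      have "\<exists>W U n f t.
        openin (topo Y) W \<and> y \<in> W \<and> W \<subseteq> V \<and> openin (topo X) U \<and> q ` W \<subseteq> U \<and>
        (\<forall>i<(n::nat). f i \<in> regf Y W \<and> t i \<in> X.bsec E U) \<and>
        (\<forall>z\<in>W. s z = (\<Sum>i<n. scale (f i z) (t i (q z))))" if y: "y \<in> V" for y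
      proof -
        have yT: "y \<in> topspace (topo Y)"
          using y V openin_subset by blast
        obtain U bb v where U: "q y \<in> U" and fr: "echelon_frame X scale Basis E U d bb v"
          using E fs_morphismD(3)[OF q yT] by (auto simp: vector_subbundle_def)
        have oU: "openin (topo X) U" and v: "\<And>i. i < d \<Longrightarrow> v i \<in> X.bsec E U"
          and ev: "\<And>y e. y \<in> U \<Longrightarrow> e \<in> E y \<Longrightarrow> e = (\<Sum>i<d. scale (Y.coord (bb i) e) (v i y))"
          using fr by (auto simp: echelon_frame_def)
        let ?W = "pre U \<inter> V"
        have W: "openin (topo Y) ?W"
          using V openin_pre[OF oU] by auto
        have "cut ?W s \<in> Y.triv ?W"
          using Y.triv_cut[OF V s(1) W] by simp
        then have "(\<lambda>y. Y.coord (bb i) (cut ?W s y)) \<in> regf Y ?W" for i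
          using W by (rule Y.regf_coord)
        moreover have "s z = (\<Sum>i<d. scale (Y.coord (bb i) (cut ?W s z)) (v i (q z)))" if z: "z \<in> ?W" for z
        proof -
          have "q z \<in> U" "s z \<in> E (q z)"
            using z s by (auto simp: preim_def)
          then show ?thesis
            using ev[of "q z" "s z"] z by simp
        qed
        moreover have "q ` ?W \<subseteq> U" "y \<in> ?W"
          using yT U y by (auto simp: preim_def)
        ultimately show ?thesis
          using W oU v by (intro exI[of _ ?W] exI[of _ U] exI[of _ d]
              exI[of _ "\<lambda>i y. Y.coord (bb i) (cut ?W s y)"] exI[of _ v]) auto
      qed
      then show "s \<in> pullback_sheaf Y X q scale Basis (X.bsec E) V"
        using s V by (simp add: pullback_sheaf_def)
    qed
  qed (simp add: pullback_sheaf_def bundle_sections_def)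
qed

text \<open>A subsheaf with the same pull-back has the same germs up to the maximal ideals, and Gauss-Jordan
  elimination lifts this to equality.\<close>

lemma pullback_bsec_unique:
  assumes E: "vector_subbundle X scale Basis E d" and surj: "q ` topspace (topo Y) = topspace (topo X)"
    and F: "subsheaf X scale Basis F" and pF: "pullback_sheaf Y X q scale Basis F = Y.bsec (E \<circ> q)"
  shows "F = X.bsec E"
proof (rule X.subsheaf_eq_bsec[OF F])
  show "F U \<subseteq> X.bsec E U" for U
  proof
    fix s assume s: "s \<in> F U"
    note U = X.subsheaf_D(2)[OF F s]
    note st = X.subsheaf_D(3)[OF F s]
    \<comment> \<open>One generator suffices here: s itself, with coefficient 1 on the preimage of
      U.\<close>
    have "\<exists>W U' n f t.
        openin (topo Y) W \<and> y \<in> W \<and> W \<subseteq> pre U \<and> openin (topo X) U' \<and> q ` W \<subseteq> U' \<and>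
        (\<forall>i<(n::nat). f i \<in> regf Y W \<and> t i \<in> F U') \<and>
        (\<forall>z\<in>W. cut (pre U) (s \<circ> q) z = (\<Sum>i<n. scale (f i z) (t i (q z))))" if "y \<in> pre U" for y
      using that U s openin_pre[OF U]
      by (intro exI[of _ "pre U"] exI[of _ U] exI[of _ 1] exI[of _ "\<lambda>_. cut (pre U) (\<lambda>_. 1)"] exI[of _ "\<lambda>_. s"])
        (auto simp: Y.regf_const, auto simp: preim_def)
    then have "cut (pre U) (s \<circ> q) \<in> pullback_sheaf Y X q scale Basis F (pre U)"
      using triv_pullback[OF U st] openin_pre[OF U] by (simp add: pullback_sheaf_def)
    then have *: "\<forall>y\<in>pre U. s (q y) \<in> E (q y)"
      unfolding pF using openin_pre[OF U] by (auto simp: bundle_sections_def)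
    have "s x \<in> E x" if x: "x \<in> U" for x
    proof -
      have "x \<in> q ` topspace (topo Y)"
        using surj x openin_subset[OF U] by auto
      then show ?thesis
        using * x by (auto simp: preim_def)
    qed
    then show "s \<in> X.bsec E U"
      using U st by (simp add: bundle_sections_def)
  qed
  show "\<exists>U s. x \<in> U \<and> s \<in> F U \<and> s x = w" if x: "x \<in> topspace (topo X)" and w: "w \<in> E x" for x w
  proof -
    obtain N t where N: "openin (topo X) N" "x \<in> N" and t: "t \<in> X.bsec E N" "t x = w"
      using X.vector_subbundle_section[OF E x w] by blast
    obtain y where y: "y \<in> topspace (topo Y)" "q y = x"
      using x surj by (metis imageE)
    have "cut (pre N) (t \<circ> q) \<in> pullback_sheaf Y X q scale Basis F (pre N)"
      unfolding pF by (rule bsec_pullback[OF N(1) t(1)])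
    then have loc: "\<forall>y\<in>pre N. \<exists>W U n f t'.
        openin (topo Y) W \<and> y \<in> W \<and> W \<subseteq> pre N \<and> openin (topo X) U \<and> q ` W \<subseteq> U \<and>
        (\<forall>i<(n::nat). f i \<in> regf Y W \<and> t' i \<in> F U) \<and>
        (\<forall>z\<in>W. cut (pre N) (t \<circ> q) z = (\<Sum>i<n. scale (f i z) (t' i (q z))))"
      using openin_pre[OF N(1)] by (simp add: pullback_sheaf_def)
    have yN: "y \<in> pre N"
      using y N by (simp add: preim_def)
    obtain W U n f t' where W: "y \<in> W" "openin (topo X) U" "q ` W \<subseteq> U"
      and t': "\<forall>i<(n::nat). f i \<in> regf Y W \<and> t' i \<in> F U"
      and eq: "\<forall>z\<in>W. cut (pre N) (t \<circ> q) z = (\<Sum>i<n. scale (f i z) (t' i (q z)))"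
      using bspec[OF loc yN] by (elim exE conjE) (rule that)
    \<comment> \<open>Only the value at x is wanted, so the coefficients, which live on Y, are
      frozen at their values at y; this gives a section over X.\<close>
    have "(\<lambda>x. \<Sum>i<n. scale (cut U (\<lambda>_. f i y) x) (t' i x)) \<in> F U"
      using t' W by (intro X.subsheaf_sum[OF F] X.subsheaf_D(6)[OF F] X.regf_const) auto
    moreover have "x \<in> U"
      using W y by auto
    moreover have "w = (\<Sum>i<n. scale (f i y) (t' i x))"
      using bspec[OF eq W(1)] yN y t by simp
    ultimately show ?thesis
      by (intro exI[of _ U] exI[of _ "\<lambda>x. \<Sum>i<n. scale (cut U (\<lambda>_. f i y) x) (t' i x)"]) simp
  qed
qed (use E in \<open>auto simp: vector_subbundle_def\<close>)

text \<open>Evaluates the definite description in \<open>descend\<close> once the sheaf upstairs is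
  known to consist of all sections with values in E \<circ> q.\<close>

lemma descend_bsec:
  assumes E: "vector_subbundle X scale Basis E d" and surj: "q ` topspace (topo Y) = topspace (topo X)"
  shows "descend Y X q scale Basis (Y.bsec (E \<circ> q)) = X.bsec E"
  unfolding descend_def
proof (rule the_equality)
  show "coherent_subsheaf X scale Basis (X.bsec E) \<and>
      pullback_sheaf Y X q scale Basis (X.bsec E) = Y.bsec (E \<circ> q)"
    using X.coherent_bsec[OF E] pullback_bsec[OF E] by blast
  show "F = X.bsec E" if "coherent_subsheaf X scale Basis F \<and>
      pullback_sheaf Y X q scale Basis F = Y.bsec (E \<circ> q)" for F
    using that pullback_bsec_unique[OF E surj] by (auto simp: coherent_subsheaf_def)
qed

end

section \<open>The differentiated action\<close>

lemma vector_space_oscale: "vector_space (oscale :: 'k::field \<Rightarrow> ('g, 'k) oper \<Rightarrow> ('g, 'k) oper)"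
  by unfold_locales (auto simp: oscale_def fun_eq_iff algebra_simps)

global_interpretation op: vector_space "oscale :: 'k::field \<Rightarrow> ('g, 'k) oper \<Rightarrow> ('g, 'k) oper"
  by (rule vector_space_oscale)

text \<open>Composites of derivations are in general not derivations, but they remain linear and
  left invariant. These two properties are what multiplicativity of the action rests on
  (\<open>act_comp\<close>, \<open>act_funpow\<close>).\<close>

definition invariant_operator ::
  "('g, 'q) monoid_scheme \<Rightarrow> ('g \<Rightarrow> 'k::field) set \<Rightarrow> ('g, 'k) oper \<Rightarrow> bool" where
  "invariant_operator G A D \<longleftrightarrow> (\<forall>f\<in>A. D f \<in> A) \<and> (\<forall>f\<in>A. \<forall>g\<in>A. D (f + g) = D f + D g) \<and>
     (\<forall>c. \<forall>f\<in>A. D (\<lambda>x. c * f x) = (\<lambda>x. c * D f x)) \<and>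
     (\<forall>g\<in>carrier G. \<forall>f\<in>A. D (ltrans G g f) = ltrans G g (D f))"

lemma invariant_operator_Lie: "D \<in> Lie G A \<Longrightarrow> invariant_operator G A D"
  by (auto simp: Lie_def invariant_operator_def)

lemma invariant_operator_comp:
  "invariant_operator G A D \<Longrightarrow> invariant_operator G A D' \<Longrightarrow> invariant_operator G A (D \<circ> D')"
  by (auto simp: invariant_operator_def)

lemma invariant_operator_funpow: "invariant_operator G A D \<Longrightarrow> invariant_operator G A (D ^^ n)"
proof (induction n)
  case (Suc n)
  then show ?case
    using invariant_operator_comp by (metis funpow.simps(2))
qed (auto simp: invariant_operator_def)

text \<open>The layers without the enveloping algebra: for an elementary V they are
  \<open>Rad\<close> and \<open>Soc\<close> (\<open>Rad_eq\<close>, \<open>Soc_eq\<close>). Words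
  behave well under Ad and can be sorted into monomials in a frame, which connects them with the
  operators Theta.\<close>

definition Rad_words ::
  "('k::field \<Rightarrow> 'm::ab_group_add \<Rightarrow> 'm) \<Rightarrow> ('v \<Rightarrow> 'm \<Rightarrow> 'm) \<Rightarrow> 'v set \<Rightarrow> nat \<Rightarrow> 'm set" where
  "Rad_words scale act V j =
     Modules.module.span scale {foldr act w m |w m. length w = j \<and> set w \<subseteq> V}"

definition Soc_words :: "('v \<Rightarrow> 'm \<Rightarrow> 'm) \<Rightarrow> 'v set \<Rightarrow> nat \<Rightarrow> 'm::ab_group_add set" where
  "Soc_words act V j = {m. \<forall>w. length w = j \<and> set w \<subseteq> V \<longrightarrow> foldr act w m = 0}"

locale rational_action =
  finite_dimensional_vector_space scale Basis + grp: affine_alg_group G A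
  for scale :: "'k::field \<Rightarrow> 'm::ab_group_add \<Rightarrow> 'm" and Basis :: "'m set"
    and G :: "('g, 'q) monoid_scheme" (structure) and A :: "('g \<Rightarrow> 'k) set" +
  fixes \<rho> :: "'g \<Rightarrow> 'm \<Rightarrow> 'm"
  assumes rational: "rational_module G A scale \<rho>"
begin

lemma A_alg: "function_algebra (carrier G) A"
  using grp.variety function_algebra_fun_alg unfolding affine_variety_def by metis

lemma A_out: "f \<in> A \<Longrightarrow> x \<notin> carrier G \<Longrightarrow> f x = 0"
  using A_alg by (auto simp: function_algebra_def)

text \<open>With one argument fixed, the comultiplication formula expresses a translate as a linear
  combination of elements of A.\<close>

lemma A_ltrans:
  assumes f: "f \<in> A" and g: "g \<in> carrier G"
  shows "ltrans G g f \<in> A"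
proof -
  obtain n :: nat and a b where ab: "\<forall>i<n. a i \<in> A \<and> b i \<in> A"
    "\<forall>x\<in>carrier G. \<forall>y\<in>carrier G. f (x \<otimes> y) = (\<Sum>i<n. a i x * b i y)"
    using grp.comult[OF f] by auto
  have "ltrans G g f = (\<lambda>x. \<Sum>i<n. a i (inv g) * b i x)"
  proof
    fix x show "ltrans G g f x = (\<Sum>i<n. a i (inv g) * b i x)"
      using ab g by (cases "x \<in> carrier G") (auto simp: ltrans_def A_out)
  qed
  also have "\<dots> \<in> A"
    using ab by (intro function_algebra_sum[OF A_alg] function_algebra_cmult[OF A_alg]) auto
  finally show ?thesis .
qed

lemma A_rtrans:
  assumes f: "f \<in> A" and g: "g \<in> carrier G"
  shows "rtrans G g f \<in> A"
proof -
  obtain n :: nat and a b where ab: "\<forall>i<n. a i \<in> A \<and> b i \<in> A"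
    "\<forall>x\<in>carrier G. \<forall>y\<in>carrier G. f (x \<otimes> y) = (\<Sum>i<n. a i x * b i y)"
    using grp.comult[OF f] by auto
  have "rtrans G g f = (\<lambda>x. \<Sum>i<n. b i g * a i x)"
  proof
    fix x show "rtrans G g f x = (\<Sum>i<n. b i g * a i x)"
      using ab g by (cases "x \<in> carrier G") (auto simp: rtrans_def A_out mult.commute)
  qed
  also have "\<dots> \<in> A"
    using ab by (intro function_algebra_sum[OF A_alg] function_algebra_cmult[OF A_alg]) auto
  finally show ?thesis .
qed

lemma rtrans_rtrans:
  "g \<in> carrier G \<Longrightarrow> h \<in> carrier G \<Longrightarrow> rtrans G g (rtrans G h f) = rtrans G (g \<otimes> h) f"
  by (auto simp: rtrans_def cut_def grp.m_assoc)

lemma rtrans_one: "f \<in> A \<Longrightarrow> rtrans G \<one> f = f"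
  by (auto simp: rtrans_def cut_def A_out)

lemma rho_linear: "g \<in> carrier G \<Longrightarrow> Vector_Spaces.linear scale scale (\<rho> g)"
  using rational by (auto simp: rational_module_def)

lemma rho_module_hom: "g \<in> carrier G \<Longrightarrow> module_hom scale scale (\<rho> g)"
  using rho_linear by (simp add: Vector_Spaces.linear_iff_module_hom)

lemma rho_simps [simp]:
  assumes "g \<in> carrier G"
  shows "\<rho> g (v + w) = \<rho> g v + \<rho> g w" "\<rho> g (v - w) = \<rho> g v - \<rho> g w" "\<rho> g (scale c v) = scale c (\<rho> g v)" "\<rho> g 0 = 0"
    "\<rho> g (\<Sum>i\<in>I. f i) = (\<Sum>i\<in>I. \<rho> g (f i))"
  using module_hom.add[OF rho_module_hom[OF assms]] module_hom.scale[OF rho_module_hom[OF assms]]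
    module_hom.zero[OF rho_module_hom[OF assms]] module_hom.sum[OF rho_module_hom[OF assms]]
    module_hom.diff[OF rho_module_hom[OF assms]]
  by auto

lemma rho_one: "\<rho> \<one> m = m"
  using rational by (auto simp: rational_module_def)

lemma rho_mult: "g \<in> carrier G \<Longrightarrow> h \<in> carrier G \<Longrightarrow> \<rho> (g \<otimes> h) m = \<rho> g (\<rho> h m)"
  using rational by (auto simp: rational_module_def)

lemma rho_inv [simp]:
  "g \<in> carrier G \<Longrightarrow> \<rho> g (\<rho> (inv g) m) = m"
  "g \<in> carrier G \<Longrightarrow> \<rho> (inv g) (\<rho> g m) = m"
  by (simp_all add: rho_mult[symmetric] rho_one)

lemma inj_rho: "g \<in> carrier G \<Longrightarrow> inj (\<rho> g)"
  by (metis injI rho_inv(2))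

section \<open>Matrix coefficients and multiplicativity of the action\<close>

definition matrix_coeff :: "'m \<Rightarrow> 'm \<Rightarrow> 'g \<Rightarrow> 'k" where
  "matrix_coeff b m = cut (carrier G) (\<lambda>g. coord b (\<rho> g m))"

lemma matrix_coeff_in: "matrix_coeff b m \<in> A"
proof -
  obtain n :: nat and f v where fv: "\<forall>i<n. f i \<in> A" "\<forall>g\<in>carrier G. \<rho> g m = (\<Sum>i<n. scale (f i g) (v i))"
  proof -
    have "\<forall>m. \<exists>n::nat. \<exists>f v. (\<forall>i<n. f i \<in> A) \<and> (\<forall>g\<in>carrier G. \<rho> g m = (\<Sum>i<n. scale (f i g) (v i)))"
      using rational by (simp add: rational_module_def)
    from spec[OF this, of m] show thesis
      by (elim exE conjE) (rule that)
  qed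
  have "matrix_coeff b m = (\<lambda>g. \<Sum>i<n. coord b (v i) * f i g)"
  proof
    fix g show "matrix_coeff b m g = (\<Sum>i<n. coord b (v i) * f i g)"
      using fv by (cases "g \<in> carrier G") (auto simp: matrix_coeff_def A_out mult.commute)
  qed
  also have "\<dots> \<in> A"
    using fv by (intro function_algebra_sum[OF A_alg] function_algebra_cmult[OF A_alg]) auto
  finally show ?thesis .
qed

lemma matrix_coeff_simps:
  "matrix_coeff b (m + m') = matrix_coeff b m + matrix_coeff b m'"
  "matrix_coeff b (scale c m) = (\<lambda>x. c * matrix_coeff b m x)"
  by (auto simp: matrix_coeff_def cut_def fun_eq_iff)

abbreviation act :: "('g, 'k) oper \<Rightarrow> 'm \<Rightarrow> 'm" where
  "act \<equiv> daction G scale Basis \<rho>"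

lemma act_eq: "act D m = (\<Sum>b\<in>Basis. scale (D (matrix_coeff b m) \<one>) b)"
  by (simp add: daction_def matrix_coeff_def)

lemma act_op_add: "act (D + D') m = act D m + act D' m"
  by (simp add: act_eq scale_left_distrib sum.distrib)

lemma act_op_scale: "act (oscale c D) m = scale c (act D m)"
  by (simp add: act_eq oscale_def scale_sum_right)

lemma act_op_0: "act 0 m = 0"
  by (simp add: act_eq)

lemma invariant_operator_sum:
  assumes D: "invariant_operator G A D" and f: "\<And>i. i \<in> I \<Longrightarrow> f i \<in> A"
  shows "D (\<lambda>x. \<Sum>i\<in>I. c i * f i x) = (\<lambda>x. \<Sum>i\<in>I. c i * D (f i) x)"
proof -
  have D0: "D (\<lambda>_. 0) = (\<lambda>_. 0)"
  proof -
    have "cut (carrier G) (\<lambda>_. 1) \<in> A"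
      using A_alg by (simp add: function_algebra_def)
    then have "D (\<lambda>x. 0 * cut (carrier G) (\<lambda>_. 1) x) = (\<lambda>x. 0 * D (cut (carrier G) (\<lambda>_. 1)) x)"
      using D unfolding invariant_operator_def by blast
    then show ?thesis
      by simp
  qed
  show ?thesis
    using f
  proof (induction I rule: infinite_finite_induct)
    case (insert i I)
    have *: "(\<lambda>x. c i * f i x) \<in> A" "(\<lambda>x. \<Sum>i\<in>I. c i * f i x) \<in> A"
      using insert.prems by (auto intro!: function_algebra_sum[OF A_alg] function_algebra_cmult[OF A_alg])
    have "D (\<lambda>x. \<Sum>i\<in>insert i I. c i * f i x) = D ((\<lambda>x. c i * f i x) + (\<lambda>x. \<Sum>i\<in>I. c i * f i x))"
      using insert.hyps by (simp add: plus_fun_def)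
    also have "\<dots> = D (\<lambda>x. c i * f i x) + D (\<lambda>x. \<Sum>i\<in>I. c i * f i x)"
      using D * by (simp add: invariant_operator_def)
    also have "D (\<lambda>x. c i * f i x) = (\<lambda>x. c i * D (f i) x)"
      using D insert.prems by (simp add: invariant_operator_def)
    finally show ?case
      using insert by (simp add: plus_fun_def)
  qed (simp_all add: D0)
qed

text \<open>A left invariant operator commutes with the comodule map; this is what makes the
  differentiated action multiplicative.\<close>

lemma invariant_operator_matrix_coeff:
  assumes D: "invariant_operator G A D"
  shows "D (matrix_coeff b m) = matrix_coeff b (act D m)"
proof
  fix g show "D (matrix_coeff b m) g = matrix_coeff b (act D m) g"
  proof (cases "g \<in> carrier G")
    case g: True
    \<comment> \<open>Expanding \<rho> x m in the basis: the translate is a combination of the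
      coefficients of m with constants depending on g. D commutes with the translation, and
      evaluation at \<one> then gives its value at g.\<close>
    have "ltrans G (inv g) (matrix_coeff b m) = (\<lambda>x. \<Sum>c\<in>Basis. matrix_coeff b c g * matrix_coeff c m x)"
    proof
      fix x show "ltrans G (inv g) (matrix_coeff b m) x = (\<Sum>c\<in>Basis. matrix_coeff b c g * matrix_coeff c m x)"
      proof (cases "x \<in> carrier G")
        case True
        have "coord b (\<rho> g (\<rho> x m)) = coord b (\<rho> g (\<Sum>c\<in>Basis. scale (coord c (\<rho> x m)) c))"
          by (simp add: sum_coord)
        also have "\<dots> = (\<Sum>c\<in>Basis. coord c (\<rho> x m) * coord b (\<rho> g c))"
          using g by simp
        finally show ?thesis
          using True g by (simp add: ltrans_def matrix_coeff_def rho_mult mult.commute)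
      qed (simp add: ltrans_def matrix_coeff_def)
    qed
    then have "D (ltrans G (inv g) (matrix_coeff b m)) =
        (\<lambda>x. \<Sum>c\<in>Basis. matrix_coeff b c g * D (matrix_coeff c m) x)"
      using invariant_operator_sum[OF D, of Basis "\<lambda>c. matrix_coeff c m" "\<lambda>c. matrix_coeff b c g"]
      by (simp add: matrix_coeff_in)
    moreover have "D (ltrans G (inv g) (matrix_coeff b m)) = ltrans G (inv g) (D (matrix_coeff b m))"
      using D g by (simp add: invariant_operator_def matrix_coeff_in)
    ultimately have "ltrans G (inv g) (D (matrix_coeff b m)) \<one> =
        (\<Sum>c\<in>Basis. matrix_coeff b c g * D (matrix_coeff c m) \<one>)"
      by metis
    moreover have "ltrans G (inv g) (D (matrix_coeff b m)) \<one> = D (matrix_coeff b m) g"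
      using g by (simp add: ltrans_def)
    ultimately show ?thesis
      using g by (simp add: matrix_coeff_def act_eq mult.commute)
  next
    case False
    have "D (matrix_coeff b m) \<in> A"
      using D by (simp add: invariant_operator_def matrix_coeff_in)
    then show ?thesis
      using False by (simp add: A_out matrix_coeff_def)
  qed
qed

lemma act_comp:
  "invariant_operator G A D \<Longrightarrow> invariant_operator G A D' \<Longrightarrow> act (D \<circ> D') m = act D (act D' m)"
  by (simp add: act_eq[of "D \<circ> D'"] act_eq[of D] invariant_operator_matrix_coeff)

lemma act_id: "act id m = m"
  by (simp add: act_eq matrix_coeff_def rho_one sum_coord)

lemma act_funpow: "invariant_operator G A D \<Longrightarrow> act (D ^^ n) m = (act D ^^ n) m"
proof (induction n)
  case 0
  then show ?case
    unfolding funpow.simps(1) by (simp add: act_id del: id_apply) simp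
next
  case (Suc n)
  then show ?case
    using act_comp[OF _ invariant_operator_funpow, of D D n m] by (metis comp_apply funpow.simps(2))
qed

lemma act_add: "invariant_operator G A D \<Longrightarrow> act D (m + m') = act D m + act D m'"
  by (simp add: act_eq matrix_coeff_simps invariant_operator_def matrix_coeff_in scale_left_distrib sum.distrib)

lemma act_scale: "invariant_operator G A D \<Longrightarrow> act D (scale c m) = scale c (act D m)"
  by (simp add: act_eq matrix_coeff_simps invariant_operator_def matrix_coeff_in scale_sum_right)

lemma act_linear: "invariant_operator G A D \<Longrightarrow> Vector_Spaces.linear scale scale (act D)"
  by unfold_locales (simp_all add: act_add act_scale)

lemma act_commute:
  assumes "D \<in> Lie G A" "D' \<in> Lie G A" "bracket D D' = 0"
  shows "act D (act D' m) = act D' (act D m)"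
proof -
  have "D \<circ> D' = D' \<circ> D"
    using assms(3) by (simp add: bracket_def)
  then show ?thesis
    using act_comp invariant_operator_Lie assms by metis
qed

text \<open>Right translation by the inverse of g turns the matrix coefficient of m into that of
  \<rho> (inv g) m, and the outer translation evaluates the result at g instead of \<one>; so Ad
  becomes conjugation by \<rho> g.\<close>

lemma act_Ad:
  assumes D: "invariant_operator G A D" and g: "g \<in> carrier G"
  shows "act (Ad G A g D) m = \<rho> g (act D (\<rho> (inv g) m))"
proof -
  have "rtrans G (inv g) (matrix_coeff b m) = matrix_coeff b (\<rho> (inv g) m)" for b
    using g by (auto simp: rtrans_def matrix_coeff_def cut_def rho_mult)
  then have "Ad G A g D (matrix_coeff b m) \<one> = coord b (\<rho> g (act D (\<rho> (inv g) m)))" for b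
    using g by (simp add: Ad_def matrix_coeff_in invariant_operator_matrix_coeff[OF D])
      (simp add: rtrans_def matrix_coeff_def)
  then show ?thesis
    by (simp add: act_eq[of "Ad G A g D"] sum_coord)
qed

section \<open>The adjoint action on operators\<close>

lemma Ad_mult: "g \<in> carrier G \<Longrightarrow> h \<in> carrier G \<Longrightarrow> Ad G A (g \<otimes> h) D = Ad G A g (Ad G A h D)"
  by (auto simp: Ad_def fun_eq_iff rtrans_rtrans grp.inv_mult_group A_rtrans)

lemma Ad_one: "D \<in> Lie G A \<Longrightarrow> Ad G A \<one> D = D"
  by (auto simp: Ad_def Lie_def rtrans_one)

lemma Ad_image_mult:
  "g \<in> carrier G \<Longrightarrow> h \<in> carrier G \<Longrightarrow> Ad G A (g \<otimes> h) ` V = Ad G A g ` Ad G A h ` V"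
  by (simp add: image_image Ad_mult)

lemma Ad_image_one: "V \<subseteq> Lie G A \<Longrightarrow> Ad G A \<one> ` V = V"
  by (auto simp: Ad_one subset_iff image_iff)

text \<open>\<open>bracket\<close> and \<open>p_op\<close> compare operators on all functions.
  Outside A the operators return 0, and their composites are then evaluated at 0.\<close>

lemma Ad_0_apply:
  assumes "D \<in> Lie G A" "g \<in> carrier G" shows "Ad G A g D 0 = 0"
proof -
  have "D 0 = 0"
    using assms(1) function_algebra_0[OF A_alg] by (auto simp: Lie_def dest: bspec[of A _ 0])
  then show ?thesis
    by (auto simp: Ad_def rtrans_def cut_def zero_fun_def)
qed

lemma Ad_comp_apply:
  assumes D: "D' \<in> Lie G A" and g: "g \<in> carrier G" and f: "f \<in> A"
  shows "Ad G A g D' f \<in> A" "Ad G A g D (Ad G A g D' f) = rtrans G g (D (D' (rtrans G (inv g) f)))"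
proof -
  have D': "D' (rtrans G (inv g) f) \<in> A"
    using D f g by (auto simp: Lie_def A_rtrans)
  then show "Ad G A g D' f \<in> A"
    using f g by (simp add: Ad_def A_rtrans)
  show "Ad G A g D (Ad G A g D' f) = rtrans G g (D (D' (rtrans G (inv g) f)))"
    using f g D' by (simp add: Ad_def A_rtrans rtrans_rtrans rtrans_one)
qed

lemma bracket_Ad:
  assumes D: "D \<in> Lie G A" "D' \<in> Lie G A" and g: "g \<in> carrier G" and "bracket D D' = 0"
  shows "bracket (Ad G A g D) (Ad G A g D') = 0"
proof -
  have DD: "D (D' f) = D' (D f)" for f
    using assms(4) by (simp add: bracket_def fun_eq_iff)
  have "Ad G A g D (Ad G A g D' f) = Ad G A g D' (Ad G A g D f)" for f
  proof (cases "f \<in> A")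
    case True
    then show ?thesis
      using Ad_comp_apply(2) D g DD by simp
  next
    case False
    then have "Ad G A g D f = 0" "Ad G A g D' f = 0"
      by (simp_all add: Ad_def)
    then show ?thesis
      using Ad_0_apply D g by simp
  qed
  then show ?thesis
    by (simp add: bracket_def fun_eq_iff)
qed

lemma p_op_Ad:
  assumes D: "D \<in> Lie G A" and g: "g \<in> carrier G" and p: "CHAR('k) > 0" and "p_op D = 0"
  shows "p_op (Ad G A g D) = 0"
proof -
  \<comment> \<open>Inner translations cancel, so the iterate is conjugated as a whole; membership
    in A is carried along because Ad is defined by cases on it.\<close>
  have *: "(Ad G A g D ^^ n) f = rtrans G g ((D ^^ n) (rtrans G (inv g) f)) \<and> (Ad G A g D ^^ n) f \<in> A"
    if "f \<in> A" for n f
  proof (induction n)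
    case 0
    then show ?case
      using that g by (simp add: rtrans_rtrans rtrans_one)
  next
    case (Suc n)
    have "D h \<in> A" if "h \<in> A" for h
      using that D by (auto simp: Lie_def)
    then have "(D ^^ n) h \<in> A" if "h \<in> A" for h
      using that by (induction n) auto
    then have "(D ^^ n) (rtrans G (inv g) f) \<in> A"
      using that g by (simp add: A_rtrans)
    then have "Ad G A g D (rtrans G g ((D ^^ n) (rtrans G (inv g) f))) =
        rtrans G g (D ((D ^^ n) (rtrans G (inv g) f)))"
      using g by (simp add: Ad_def A_rtrans rtrans_rtrans rtrans_one)
    moreover have "Ad G A g D ((Ad G A g D ^^ n) f) \<in> A"
      using Suc Ad_comp_apply(1)[OF D g] by blast
    ultimately show ?case
      using Suc by simp
  qed
  have Dp: "D ^^ CHAR('k) = 0"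
    using assms(4) by (simp add: p_op_def)
  have 1: "(Ad G A g D ^^ CHAR('k)) f = 0" if "f \<in> A" for f
    using *[OF that, of "CHAR('k)"] Dp by (simp add: rtrans_def cut_def zero_fun_def)
  have 2: "(Ad G A g D ^^ n) 0 = 0" for n
    using Ad_0_apply[OF D g] by (induction n) auto
  \<comment> \<open>Since the characteristic is positive, the iterate applies the operator at least
    once, and the innermost application already gives 0.\<close>
  have "(Ad G A g D ^^ CHAR('k)) f = 0" if "f \<notin> A" for f
  proof -
    obtain n where n: "CHAR('k) = Suc n"
      using p by (metis Suc_pred)
    have "Ad G A g D f = 0"
      using that by (simp add: Ad_def)
    then show ?thesis
      unfolding n funpow_Suc_right by (simp add: 2)
  qed
  with 1 show ?thesis
    by (auto simp: p_op_def fun_eq_iff)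
qed

section \<open>Words in a subalgebra and their conjugates\<close>

abbreviation "Radw \<equiv> Rad_words scale act"
abbreviation "Socw \<equiv> Soc_words act"

lemma foldr_act_Ad:
  assumes V: "V \<subseteq> Lie G A" and g: "g \<in> carrier G" and w: "set w \<subseteq> V"
  shows "foldr act (map (Ad G A g) w) m = \<rho> g (foldr act w (\<rho> (inv g) m))"
  using w
proof (induction w)
  case (Cons D w)
  then have "D \<in> Lie G A"
    using V by auto
  then show ?case
    using Cons g by (simp add: act_Ad invariant_operator_Lie)
qed (use g in simp)

lemma foldr_act_linear:
  "\<forall>D\<in>set w. invariant_operator G A D \<Longrightarrow> Vector_Spaces.linear scale scale (foldr act w)"
proof (induction w)
  case Nil
  then show ?case
    by (simp add: id_def linear_ident)
next
  case (Cons D w)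
  then show ?case
    using Vector_Spaces.linear_compose[of scale scale "foldr act w" scale "act D"] act_linear[of D]
    by (simp add: comp_def)
qed

lemma words_Ad:
  assumes g: "g \<in> carrier G"
  shows "length w = j \<and> set w \<subseteq> Ad G A g ` V \<longleftrightarrow>
    (\<exists>w'. w = map (Ad G A g) w' \<and> length w' = j \<and> set w' \<subseteq> V)"
proof
  assume w: "length w = j \<and> set w \<subseteq> Ad G A g ` V"
  then have "\<exists>w'. w = map (Ad G A g) w' \<and> set w' \<subseteq> V"
  proof (induction w arbitrary: j)
    case (Cons D w)
    then obtain w' where "w = map (Ad G A g) w'" "set w' \<subseteq> V"
      by auto
    moreover obtain D' where "D = Ad G A g D'" "D' \<in> V"
      using Cons.prems by auto
    ultimately show ?case
      by (intro exI[of _ "D' # w'"]) auto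
  qed auto
  with w show "\<exists>w'. w = map (Ad G A g) w' \<and> length w' = j \<and> set w' \<subseteq> V"
    by auto
next
  assume "\<exists>w'. w = map (Ad G A g) w' \<and> length w' = j \<and> set w' \<subseteq> V"
  then obtain w' where "w = map (Ad G A g) w'" "length w' = j" "set w' \<subseteq> V"
    by blast
  then show "length w = j \<and> set w \<subseteq> Ad G A g ` V"
    by (simp add: image_mono)
qed

lemma in_rho_image: "g \<in> carrier G \<Longrightarrow> m \<in> \<rho> g ` S \<longleftrightarrow> \<rho> (inv g) m \<in> S"
  by (metis imageE image_eqI rho_inv)

text \<open>Conjugating every letter of a word conjugates the word, since the inner factors \<rho>
  cancel. This is the homogeneity of the family of layers along the orbit.\<close>

lemma Radw_Ad:
  assumes V: "V \<subseteq> Lie G A" and g: "g \<in> carrier G"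
  shows "Radw (Ad G A g ` V) j = \<rho> g ` Radw V j"
proof -
  have "{foldr act w m |w m. length w = j \<and> set w \<subseteq> Ad G A g ` V} =
      \<rho> g ` {foldr act w m |w m. length w = j \<and> set w \<subseteq> V}" (is "?L = \<rho> g ` ?R")
  proof (intro equalityI subsetI)
    fix v assume "v \<in> ?L"
    then obtain w m where w: "length w = j" "set w \<subseteq> V" "v = foldr act (map (Ad G A g) w) m"
      unfolding words_Ad[OF g] by blast
    then have "v = \<rho> g (foldr act w (\<rho> (inv g) m))"
      by (simp add: foldr_act_Ad[OF V g])
    then show "v \<in> \<rho> g ` ?R"
      using w by blast
  next
    fix v assume "v \<in> \<rho> g ` ?R"
    then obtain w m where w: "v = \<rho> g (foldr act w m)" "length w = j" "set w \<subseteq> V"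
      by auto
    then have "v = foldr act (map (Ad G A g) w) (\<rho> g m)"
      using g by (simp add: foldr_act_Ad[OF V g])
    then show "v \<in> ?L"
      using w by (intro CollectI exI[of _ "map (Ad G A g) w"] exI[of _ "\<rho> g m"]) (simp add: image_mono)
  qed
  moreover have "span (\<rho> g ` S) = \<rho> g ` span S" for S
    using module_hom.span_image[OF rho_module_hom[OF g]] .
  ultimately show ?thesis
    by (simp add: Rad_words_def)
qed

lemma Socw_Ad:
  assumes V: "V \<subseteq> Lie G A" and g: "g \<in> carrier G"
  shows "Socw (Ad G A g ` V) j = \<rho> g ` Socw V j"
proof -
  have inj: "\<rho> g m = 0 \<longleftrightarrow> m = 0" for m
    using g by (metis rho_inv(2) rho_simps(4) grp.inv_closed)
  have "m \<in> Socw (Ad G A g ` V) j \<longleftrightarrow> \<rho> (inv g) m \<in> Socw V j" for m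
    unfolding Soc_words_def words_Ad[OF g] by (auto simp: foldr_act_Ad[OF V g] inj)
  then show ?thesis
    using in_rho_image[OF g] by blast
qed

lemma subspace_Radw: "subspace (Radw V j)"
  by (simp add: Rad_words_def)

lemma subspace_Socw: "V \<subseteq> Lie G A \<Longrightarrow> subspace (Socw V j)"
proof -
  assume V: "V \<subseteq> Lie G A"
  have "module_hom scale scale (foldr act w)" if "set w \<subseteq> V" for w
  proof -
    have "\<forall>D\<in>set w. invariant_operator G A D"
      using that V invariant_operator_Lie by blast
    then show ?thesis
      using foldr_act_linear[of w] by (simp add: Vector_Spaces.linear_iff_module_hom)
  qed
  note * = module_hom.add[OF this] module_hom.zero[OF this] module_hom.scale[OF this]
  show ?thesis
    by (auto simp: subspace_def Soc_words_def *)
qed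

end

subsection \<open>Monomials in a frame\<close>

text \<open>The extra factor is moved past the earlier powers until it meets its own.\<close>

lemma foldr_funpow_step:
  fixes a :: "nat \<Rightarrow> 'm \<Rightarrow> 'm"
  assumes comm: "\<And>s t m. s \<in> set xs \<Longrightarrow> t \<in> set xs \<Longrightarrow> a s (a t m) = a t (a s m)"
    and "distinct xs" "s \<in> set xs"
  shows "a s (foldr (\<lambda>s. a s ^^ J s) xs m) = foldr (\<lambda>t. a t ^^ (J(s := Suc (J s))) t) xs m"
  using assms
proof (induction xs)
  case (Cons x xs)
  show ?case
  proof (cases "x = s")
    case True
    then have "s \<notin> set xs"
      using Cons.prems by auto
    then have "foldr (\<lambda>t. a t ^^ (J(s := Suc (J s))) t) xs m = foldr (\<lambda>t. a t ^^ J t) xs m"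
      by (intro foldr_cong) auto
    then show ?thesis
      using True by simp
  next
    case False
    have c: "a s (a x m) = a x (a s m)" for m
      using Cons.prems(1)[of s x m] Cons.prems(3) by simp
    have "a s ((a x ^^ n) m) = (a x ^^ n) (a s m)" for n m
      by (induction n) (simp_all add: c)
    then show ?thesis
      using Cons False by simp
  qed
qed simp

lemma foldr_replicate_funpow: "foldr a (replicate n x) m = (a x ^^ n) m"
  by (induction n) auto

lemma foldr_concat_funpow:
  "foldr a (concat (map (\<lambda>s. replicate (J s) (z s)) xs)) m = foldr (\<lambda>s. a (z s) ^^ J s) xs m"
  by (induction xs) (auto simp: foldr_replicate_funpow)

lemma finite_multi_indices: "finite (multi_indices r j)"
proof -
  have "J s \<le> j" if "J \<in> multi_indices r j" "s < r" for J s
    using that member_le_sum[of s "{..<r}" J] by (simp add: multi_indices_def)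
  then have "multi_indices r j \<subseteq> {J. \<forall>s. (s \<in> {..<r} \<longrightarrow> J s \<in> {..j}) \<and> (s \<notin> {..<r} \<longrightarrow> J s = 0)}"
    by (auto simp: multi_indices_def)
  then show ?thesis
    by (rule finite_subset) (rule finite_set_of_finite_funs; simp)
qed

context rational_action
begin

definition frame_monomial :: "(nat \<Rightarrow> ('g, 'k) oper) \<Rightarrow> nat \<Rightarrow> (nat \<Rightarrow> nat) \<Rightarrow> 'm \<Rightarrow> 'm" where
  "frame_monomial z r J = foldr (\<lambda>s. act (z s) ^^ J s) [0..<r]"

text \<open>Letters are combinations of the frame and the frame commutes, so a word can be expanded
  and sorted. The vector m is the same on both sides; the socle needs this, as there the vanishing
  of all monomials on m must give the vanishing of all words on m.\<close>

lemma word_in_span_monomials: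
  assumes z: "\<And>s. s < r \<Longrightarrow> z s \<in> Lie G A"
    and comm: "\<And>s t. s < r \<Longrightarrow> t < r \<Longrightarrow> bracket (z s) (z t) = 0"
    and w: "set w \<subseteq> span_map r z" "span_map r z \<subseteq> Lie G A"
  shows "foldr act w m \<in> span {frame_monomial z r J m |J. J \<in> multi_indices r (length w)}"
  using w(1)
proof (induction w)
  case Nil
  have "frame_monomial z r (\<lambda>_. 0) m = m"
    unfolding frame_monomial_def by (induction r) auto
  moreover have "(\<lambda>_. 0) \<in> multi_indices r 0"
    by (simp add: multi_indices_def)
  ultimately show ?case
    by (auto intro!: span_base exI[of _ "\<lambda>_. 0"])
next
  case (Cons x w)
  let ?S = "span {frame_monomial z r J m |J. J \<in> multi_indices r (Suc (length w))}"
  have step: "act x (frame_monomial z r J m) \<in> ?S" if J: "J \<in> multi_indices r (length w)" for J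
  proof -
    \<comment> \<open>The letters for which the claim holds form a subspace, so only members of the
      frame have to be checked.\<close>
    have "op.span (z ` {..<r}) \<subseteq> {x. act x (frame_monomial z r J m) \<in> ?S}"
    proof (rule op.span_minimal)
      show "op.subspace {x. act x (frame_monomial z r J m) \<in> ?S}"
        by (auto simp: op.subspace_def act_op_add act_op_scale act_op_0 span_add span_scale span_zero)
      show "z ` {..<r} \<subseteq> {x. act x (frame_monomial z r J m) \<in> ?S}"
      proof clarify
        fix s assume s: "s < r"
        let ?J = "J(s := Suc (J s))"
        have "act (z s) (frame_monomial z r J m) = frame_monomial z r ?J m"
          unfolding frame_monomial_def
          by (rule foldr_funpow_step) (use s in \<open>auto intro!: act_commute z comm\<close>)
        moreover have "?J \<in> multi_indices r (Suc (length w))"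
        proof -
          have "sum ?J {..<r} = Suc (J s) + sum J ({..<r} - {s})"
            using s by (subst sum.remove[of _ s]) auto
          also have "\<dots> = Suc (sum J {..<r})"
            using s by (subst (2) sum.remove[of _ s]) auto
          finally show ?thesis
            using J s by (auto simp: multi_indices_def)
        qed
        ultimately show "act (z s) (frame_monomial z r J m) \<in> ?S"
          by (auto intro!: span_base)
      qed
    qed
    then show ?thesis
      using Cons.prems by (auto simp: span_map_def)
  qed
  have "invariant_operator G A x"
    using Cons.prems w(2) by (auto intro: invariant_operator_Lie)
  then have x: "module_hom scale scale (act x)"
    using act_linear by (simp add: Vector_Spaces.linear_iff_module_hom)
  have "subspace {v. act x v \<in> ?S}"
    by (auto simp: subspace_def module_hom.add[OF x] module_hom.zero[OF x] module_hom.scale[OF x]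
        span_add span_scale span_zero)
  then have "span {frame_monomial z r J m |J. J \<in> multi_indices r (length w)} \<subseteq> {v. act x v \<in> ?S}"
    by (intro span_minimal) (auto intro: step)
  then show ?case
    using Cons by auto
qed

lemma monomial_word:
  assumes "J \<in> multi_indices r j"
  shows "\<exists>w. length w = j \<and> set w \<subseteq> z ` {..<r} \<and> frame_monomial z r J m = foldr act w m"
proof (intro exI conjI)
  let ?w = "concat (map (\<lambda>s. replicate (J s) (z s)) [0..<r])"
  show "length ?w = j"
    using assms by (simp add: multi_indices_def length_concat comp_def sum_list_distinct_conv_sum_set
        lessThan_atLeast0)
  show "set ?w \<subseteq> z ` {..<r}"
    by auto
  show "frame_monomial z r J m = foldr act ?w m"
    by (simp add: frame_monomial_def foldr_concat_funpow)
qed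

lemma Radw_span_map:
  assumes z: "\<And>s. s < r \<Longrightarrow> z s \<in> Lie G A" "span_map r z \<subseteq> Lie G A"
    and comm: "\<And>s t. s < r \<Longrightarrow> t < r \<Longrightarrow> bracket (z s) (z t) = 0"
  shows "Radw (span_map r z) j = span {frame_monomial z r J m |J m. J \<in> multi_indices r j}"
    and "Socw (span_map r z) j = {m. \<forall>J\<in>multi_indices r j. frame_monomial z r J m = 0}"
proof -
  have mw: "\<exists>w. length w = j \<and> set w \<subseteq> span_map r z \<and> frame_monomial z r J m = foldr act w m"
    if "J \<in> multi_indices r j" for J m
  proof -
    obtain w where "length w = j" "set w \<subseteq> z ` {..<r}" "frame_monomial z r J m = foldr act w m"
      using monomial_word[OF \<open>J \<in> multi_indices r j\<close>] by blast
    moreover have "z ` {..<r} \<subseteq> span_map r z"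
      unfolding span_map_def by (rule op.span_superset)
    ultimately show ?thesis
      by blast
  qed
  have wm: "foldr act w m \<in> span {frame_monomial z r J m |J. J \<in> multi_indices r j}"
    if "length w = j" "set w \<subseteq> span_map r z" for w m
    using word_in_span_monomials[OF z(1) comm that(2) z(2)] that(1) by simp
  show "Radw (span_map r z) j = span {frame_monomial z r J m |J m. J \<in> multi_indices r j}" (is "?L = ?R")
  proof
    have "foldr act w m \<in> ?R" if "length w = j" "set w \<subseteq> span_map r z" for w m
      using wm[OF that, of m] span_mono[of "{frame_monomial z r J m |J. J \<in> multi_indices r j}"
          "{frame_monomial z r J m |J m. J \<in> multi_indices r j}"] by blast
    then show "?L \<subseteq> ?R"
      unfolding Rad_words_def by (intro span_minimal) auto
    show "?R \<subseteq> ?L"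
      unfolding Rad_words_def
    proof (intro span_mono subsetI)
      fix v assume "v \<in> {frame_monomial z r J m |J m. J \<in> multi_indices r j}"
      then show "v \<in> {foldr act w m |w m. length w = j \<and> set w \<subseteq> span_map r z}"
        using mw by blast
    qed
  qed
  show "Socw (span_map r z) j = {m. \<forall>J\<in>multi_indices r j. frame_monomial z r J m = 0}"
  proof (intro equalityI subsetI)
    fix m assume "m \<in> Socw (span_map r z) j"
    then show "m \<in> {m. \<forall>J\<in>multi_indices r j. frame_monomial z r J m = 0}"
    proof (intro CollectI ballI)
      fix J assume "J \<in> multi_indices r j"
      from mw[OF this, of m] obtain w where "length w = j \<and> set w \<subseteq> span_map r z"
        "frame_monomial z r J m = foldr act w m"
        by blast
      then show "frame_monomial z r J m = 0"
        using \<open>m \<in> Socw (span_map r z) j\<close> by (simp add: Soc_words_def)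
    qed
  next
    fix m assume "m \<in> {m. \<forall>J\<in>multi_indices r j. frame_monomial z r J m = 0}"
    then have "{frame_monomial z r J m |J. J \<in> multi_indices r j} \<subseteq> {0}"
      by auto
    then have "span {frame_monomial z r J m |J. J \<in> multi_indices r j} \<subseteq> {0}"
      using span_minimal[OF _ subspace_single_0] by blast
    then show "m \<in> Socw (span_map r z) j"
      using wm unfolding Soc_words_def by blast
  qed
qed

end

section \<open>Radical and socle layers of elementary algebras\<close>

lemma (in ring) ring_idealI:
  assumes "K \<subseteq> carrier R" "\<zero> \<in> K" "\<And>a b. a \<in> K \<Longrightarrow> b \<in> K \<Longrightarrow> a \<oplus> b \<in> K"
    and l: "\<And>a x. a \<in> K \<Longrightarrow> x \<in> carrier R \<Longrightarrow> x \<otimes> a \<in> K"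
    and r: "\<And>a x. a \<in> K \<Longrightarrow> x \<in> carrier R \<Longrightarrow> a \<otimes> x \<in> K"
  shows "ideal K R"
proof (rule idealI[OF ring_axioms])
  have "\<ominus> a \<in> K" if "a \<in> K" for a
  proof -
    have "\<ominus> a = (\<ominus> \<one>) \<otimes> a"
      using that assms(1) by (simp add: l_minus subset_iff)
    then show ?thesis
      using l[OF that, of "\<ominus> \<one>"] by simp
  qed
  then show "subgroup K (add_monoid R)"
    using assms by (intro add.subgroupI) (auto simp: a_inv_def)
qed (use l r in auto)

section \<open>The free algebra\<close>

lemma free_algebra_simps:
  "carrier (free_algebra V) = {a. finite {w. a w \<noteq> 0} \<and> (\<forall>w. a w \<noteq> 0 \<longrightarrow> set w \<subseteq> V)}"
  "\<one>\<^bsub>free_algebra V\<^esub> = (\<lambda>w. if w = [] then 1 else 0)"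
  "\<zero>\<^bsub>free_algebra V\<^esub> = 0" "a \<oplus>\<^bsub>free_algebra V\<^esub> b = a + b"
  by (simp_all add: free_algebra_def)

lemma finite_splits: "finite {(u, v). u @ v = w}"
proof (rule finite_subset)
  show "{(u, v). u @ v = w} \<subseteq> (\<lambda>i. (take i w, drop i w)) ` {..length w}"
  proof clarify
    fix u v assume "w = u @ v"
    then show "(u, v) \<in> (\<lambda>i. (take i (u @ v), drop i (u @ v))) ` {..length (u @ v)}"
      by (intro image_eqI[of _ _ "length u"]) auto
  qed
qed simp

lemma finite_splits_pair: "finite {p. fst p @ snd p = w}"
  using finite_splits[of w] unfolding case_prod_beta .

text \<open>Summing over factorisations w = u @ v rather than over positions makes the ring laws
  re-indexings of finite sums.\<close>

lemma free_mult: "(a \<otimes>\<^bsub>free_algebra V\<^esub> b) w = (\<Sum>(u, v)\<in>{(u, v). u @ v = w}. a u * b v)"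
proof -
  have "(\<Sum>i\<le>length w. a (take i w) * b (drop i w)) = (\<Sum>(u, v)\<in>{(u, v). u @ v = w}. a u * b v)"
    by (rule sum.reindex_bij_witness[of _ "\<lambda>(u, v). length u" "\<lambda>i. (take i w, drop i w)"]) auto
  then show ?thesis
    by (simp add: free_algebra_def)
qed

lemma free_mult_closed:
  assumes a: "a \<in> carrier (free_algebra V)" and b: "b \<in> carrier (free_algebra V)"
  shows "a \<otimes>\<^bsub>free_algebra V\<^esub> b \<in> carrier (free_algebra V)"
proof -
  let ?S = "(\<lambda>(u, v). u @ v) ` ({w. a w \<noteq> 0} \<times> {w. b w \<noteq> 0})"
  have *: "{w. (a \<otimes>\<^bsub>free_algebra V\<^esub> b) w \<noteq> 0} \<subseteq> ?S"
  proof
    fix w assume "w \<in> {w. (a \<otimes>\<^bsub>free_algebra V\<^esub> b) w \<noteq> 0}"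
    then have "(\<Sum>(u, v)\<in>{(u, v). u @ v = w}. a u * b v) \<noteq> 0"
      by (simp add: free_mult)
    then obtain p where "p \<in> {(u, v). u @ v = w}" "(case p of (u, v) \<Rightarrow> a u * b v) \<noteq> 0"
      by (meson sum.neutral)
    then show "w \<in> ?S"
      by (intro image_eqI[of _ _ p]) auto
  qed
  moreover have "finite ?S"
    using a b by (simp add: free_algebra_simps)
  ultimately have "finite {w. (a \<otimes>\<^bsub>free_algebra V\<^esub> b) w \<noteq> 0}"
    by (rule finite_subset)
  moreover have "set w \<subseteq> V" if "w \<in> ?S" for w
    using that a b by (fastforce simp: free_algebra_simps)
  ultimately show ?thesis
    unfolding free_algebra_simps using * by blast
qed

lemma ring_free_algebra: "ring (free_algebra V :: ('v list \<Rightarrow> 'k::field) ring)" (is "ring ?F")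
proof (rule ringI)
  have add: "a + b \<in> carrier ?F" if "a \<in> carrier ?F" "b \<in> carrier ?F" for a b
  proof -
    have "{w. (a + b) w \<noteq> 0} \<subseteq> {w. a w \<noteq> 0} \<union> {w. b w \<noteq> 0}"
      by auto
    then have "finite {w. (a + b) w \<noteq> 0}"
      using that by (auto simp: free_algebra_simps intro: finite_subset)
    moreover have "a w \<noteq> 0 \<or> b w \<noteq> 0" if "(a + b) w \<noteq> 0" for w
      using that by auto
    ultimately show ?thesis
      using that unfolding free_algebra_simps by blast
  qed
  have uminus: "- a \<in> carrier ?F" if "a \<in> carrier ?F" for a
    using that by (simp add: free_algebra_simps)
  show "abelian_group ?F"
  proof (rule abelian_groupI)
    show "\<exists>y\<in>carrier ?F. y \<oplus>\<^bsub>?F\<^esub> x = \<zero>\<^bsub>?F\<^esub>" if "x \<in> carrier ?F" for x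
      using uminus[OF that] by (intro bexI[of _ "- x"]) (simp_all add: free_algebra_simps(3,4))
    show "\<zero>\<^bsub>?F\<^esub> \<in> carrier ?F"
      by (simp add: free_algebra_simps)
  qed (simp_all add: add free_algebra_simps(3,4) add_ac)
  show "Group.monoid ?F"
  proof (rule monoidI)
    show "\<one>\<^bsub>?F\<^esub> \<in> carrier ?F"
      by (auto simp: free_algebra_simps)
    show "x \<otimes>\<^bsub>?F\<^esub> y \<in> carrier ?F" if "x \<in> carrier ?F" "y \<in> carrier ?F" for x y
      by (rule free_mult_closed[OF that])
    show "x \<otimes>\<^bsub>?F\<^esub> y \<otimes>\<^bsub>?F\<^esub> z = x \<otimes>\<^bsub>?F\<^esub> (y \<otimes>\<^bsub>?F\<^esub> z)" for x y z
    proof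
      fix w :: "'v list"
      let ?S = "\<lambda>w :: 'v list. {(u, v). u @ v = w}"
      have "(x \<otimes>\<^bsub>?F\<^esub> y \<otimes>\<^bsub>?F\<^esub> z) w = (\<Sum>p\<in>?S w. \<Sum>q\<in>?S (fst p). x (fst q) * y (snd q) * z (snd p))"
        by (simp add: free_mult case_prod_beta sum_distrib_right)
      also have "\<dots> = (\<Sum>(p, q)\<in>Sigma (?S w) (\<lambda>p. ?S (fst p)). x (fst q) * y (snd q) * z (snd p))"
        by (intro sum.Sigma ballI finite_splits)
      \<comment> \<open>Both sides run over the factorisations of w into three parts; the bijection
        moves the brackets.\<close>
      also have "\<dots> = (\<Sum>(p, q)\<in>Sigma (?S w) (\<lambda>p. ?S (snd p)). x (fst p) * (y (fst q) * z (snd q)))"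
        by (rule sum.reindex_bij_witness[of _ "\<lambda>((u, s), (v, t)). ((u @ v, t), (u, v))"
              "\<lambda>((s, t), (u, v)). ((u, v @ t), (v, t))"]) auto
      also have "\<dots> = (\<Sum>p\<in>?S w. \<Sum>q\<in>?S (snd p). x (fst p) * (y (fst q) * z (snd q)))"
        by (intro sum.Sigma[symmetric] ballI finite_splits)
      also have "\<dots> = (x \<otimes>\<^bsub>?F\<^esub> (y \<otimes>\<^bsub>?F\<^esub> z)) w"
        by (simp add: free_mult case_prod_beta sum_distrib_left)
      finally show "(x \<otimes>\<^bsub>?F\<^esub> y \<otimes>\<^bsub>?F\<^esub> z) w = (x \<otimes>\<^bsub>?F\<^esub> (y \<otimes>\<^bsub>?F\<^esub> z)) w" .
    qed
    show "\<one>\<^bsub>?F\<^esub> \<otimes>\<^bsub>?F\<^esub> x = x" for x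
    proof
      fix w
      have "(\<one>\<^bsub>?F\<^esub> \<otimes>\<^bsub>?F\<^esub> x) w = (\<Sum>p\<in>{([], w)}. \<one>\<^bsub>?F\<^esub> (fst p) * x (snd p))"
        unfolding free_mult case_prod_beta
        by (rule sum.mono_neutral_right) (auto simp: finite_splits finite_splits_pair free_algebra_simps)
      then show "(\<one>\<^bsub>?F\<^esub> \<otimes>\<^bsub>?F\<^esub> x) w = x w"
        by (simp add: free_algebra_simps)
    qed
    show "x \<otimes>\<^bsub>?F\<^esub> \<one>\<^bsub>?F\<^esub> = x" for x
    proof
      fix w
      have "(x \<otimes>\<^bsub>?F\<^esub> \<one>\<^bsub>?F\<^esub>) w = (\<Sum>p\<in>{(w, [])}. x (fst p) * \<one>\<^bsub>?F\<^esub> (snd p))"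
        unfolding free_mult case_prod_beta
        by (rule sum.mono_neutral_right) (auto simp: finite_splits finite_splits_pair free_algebra_simps)
      then show "(x \<otimes>\<^bsub>?F\<^esub> \<one>\<^bsub>?F\<^esub>) w = x w"
        by (simp add: free_algebra_simps)
    qed
  qed
  fix x y z
  show "(x \<oplus>\<^bsub>?F\<^esub> y) \<otimes>\<^bsub>?F\<^esub> z = x \<otimes>\<^bsub>?F\<^esub> z \<oplus>\<^bsub>?F\<^esub> y \<otimes>\<^bsub>?F\<^esub> z"
    by (rule ext) (simp add: free_mult free_algebra_simps(4) case_prod_beta sum.distrib distrib_right)
  show "z \<otimes>\<^bsub>?F\<^esub> (x \<oplus>\<^bsub>?F\<^esub> y) = z \<otimes>\<^bsub>?F\<^esub> x \<oplus>\<^bsub>?F\<^esub> z \<otimes>\<^bsub>?F\<^esub> y"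
    by (rule ext) (simp add: free_mult free_algebra_simps(4) case_prod_beta sum.distrib distrib_left)
qed

text \<open>The image of k in the free algebra. These elements are central
  (\<open>scalar_word_mult\<close>), so scaling by c is a ring multiplication and ideals are closed
  under it.\<close>

definition scalar_word :: "'k::field \<Rightarrow> 'v list \<Rightarrow> 'k" where
  "scalar_word c = (\<lambda>w. c * word [] w)"

lemma scalar_word_carrier: "scalar_word c \<in> carrier (free_algebra V)"
  by (auto simp: free_algebra_simps scalar_word_def word_def)

lemma word_carrier: "set w \<subseteq> V \<Longrightarrow> word w \<in> carrier (free_algebra V)"
  by (auto simp: free_algebra_simps word_def)

lemma scalar_word_mult:
  fixes a :: "'v list \<Rightarrow> 'k::field"
  shows "scalar_word c \<otimes>\<^bsub>free_algebra V\<^esub> a = (\<lambda>w. c * a w)"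
  "a \<otimes>\<^bsub>free_algebra V\<^esub> scalar_word c = (\<lambda>w. c * a w)"
proof -
  show "scalar_word c \<otimes>\<^bsub>free_algebra V\<^esub> a = (\<lambda>w. c * a w)"
  proof
    fix w
    have "(scalar_word c \<otimes>\<^bsub>free_algebra V\<^esub> a) w = (\<Sum>p\<in>{([] :: 'v list, w)}. scalar_word c (fst p) * a (snd p))"
      unfolding free_mult case_prod_beta
      by (rule sum.mono_neutral_right) (auto simp: finite_splits finite_splits_pair scalar_word_def word_def)
    then show "(scalar_word c \<otimes>\<^bsub>free_algebra V\<^esub> a) w = c * a w"
      by (simp add: scalar_word_def word_def)
  qed
  show "a \<otimes>\<^bsub>free_algebra V\<^esub> scalar_word c = (\<lambda>w. c * a w)"
  proof
    fix w
    have "(a \<otimes>\<^bsub>free_algebra V\<^esub> scalar_word c) w = (\<Sum>p\<in>{(w, [] :: 'v list)}. a (fst p) * scalar_word c (snd p))"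
      unfolding free_mult case_prod_beta
      by (rule sum.mono_neutral_right) (auto simp: finite_splits finite_splits_pair scalar_word_def word_def)
    then show "(a \<otimes>\<^bsub>free_algebra V\<^esub> scalar_word c) w = c * a w"
      by (simp add: scalar_word_def word_def)
  qed
qed

lemma word_mult: "word u \<otimes>\<^bsub>free_algebra V\<^esub> word v = (word (u @ v) :: _ \<Rightarrow> 'k::field)"
proof
  fix w
  have "(word u \<otimes>\<^bsub>free_algebra V\<^esub> word v) w = (\<Sum>p\<in>{(x, y). x @ y = w}. if p = (u, v) then 1 else (0::'k))"
    unfolding free_mult by (intro sum.cong) (auto simp: word_def split: if_splits)
  also have "\<dots> = word (u @ v) w"
    using finite_splits[of w] by (simp add: word_def)
  finally show "(word u \<otimes>\<^bsub>free_algebra V\<^esub> word v) w = (word (u @ v) w :: 'k)" .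
qed

text \<open>Words are products of letters, and an element is a finite sum of scalar multiples of
  words; the induction runs over a finite set containing the support.\<close>

lemma free_algebra_induct:
  fixes a :: "'v list \<Rightarrow> 'k::field"
  assumes a: "a \<in> carrier (free_algebra V)"
    and scalar: "\<And>c. P (scalar_word c)"
    and letter: "\<And>x. x \<in> V \<Longrightarrow> P (word [x])"
    and add: "\<And>a b. \<lbrakk>a \<in> carrier (free_algebra V); b \<in> carrier (free_algebra V); P a; P b\<rbrakk> \<Longrightarrow>
      P (a \<oplus>\<^bsub>free_algebra V\<^esub> b)"
    and mult: "\<And>a b. \<lbrakk>a \<in> carrier (free_algebra V); b \<in> carrier (free_algebra V); P a; P b\<rbrakk> \<Longrightarrow>
      P (a \<otimes>\<^bsub>free_algebra V\<^esub> b)"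
  shows "P a"
proof -
  have word: "P (word w)" if "set w \<subseteq> V" for w
    using that
  proof (induction w)
    case Nil
    have "word [] = scalar_word 1"
      by (simp add: scalar_word_def)
    then show ?case
      using scalar by metis
  next
    case (Cons x w)
    then have "P (word [x] \<otimes>\<^bsub>free_algebra V\<^esub> word w)"
      by (intro mult letter word_carrier) auto
    then show ?case
      by (simp add: word_mult)
  qed
  have "P a" if "finite S" "a \<in> carrier (free_algebra V)" "{w. a w \<noteq> 0} \<subseteq> S" for S and a :: "'v list \<Rightarrow> 'k"
    using that
  proof (induction S arbitrary: a rule: finite_induct)
    case empty
    then have "a = scalar_word 0"
      by (auto simp: scalar_word_def)
    then show ?case
      using scalar by metis
  next
    case (insert w S)
    show ?case
    proof (cases "a w = 0")
      case True
      then show ?thesis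
        using insert by blast
    next
      case False
      then have w: "set w \<subseteq> V"
        using insert.prems by (auto simp: free_algebra_simps)
      define b where "b = a(w := 0)"
      have b: "b \<in> carrier (free_algebra V)" "{w. b w \<noteq> 0} \<subseteq> S"
        using insert.prems by (auto simp: b_def free_algebra_simps elim: finite_subset[rotated])
      have "a = b \<oplus>\<^bsub>free_algebra V\<^esub> (scalar_word (a w) \<otimes>\<^bsub>free_algebra V\<^esub> word w)"
        by (auto simp: b_def scalar_word_mult free_algebra_simps word_def fun_eq_iff)
      moreover have "P (b \<oplus>\<^bsub>free_algebra V\<^esub> (scalar_word (a w) \<otimes>\<^bsub>free_algebra V\<^esub> word w))"
        by (intro add mult b free_mult_closed scalar_word_carrier word_carrier w insert.IH scalar word)
      ultimately show ?thesis
        by metis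
    qed
  qed
  from this[OF _ a] show ?thesis
    using a by (auto simp: free_algebra_simps)
qed

section \<open>The free algebra acting on a module\<close>

lemma free_act_superset:
  assumes "module scale" "finite S" "{w. a w \<noteq> 0} \<subseteq> S"
  shows "free_act scale act a m = (\<Sum>w\<in>S. scale (a w) (foldr act w m))"
  unfolding free_act_def
  by (rule sum.mono_neutral_left) (use assms in \<open>auto simp: module.scale_zero_left\<close>)

lemma (in vector_space) free_act_word: "free_act scale act (word w) m = foldr act w m"
proof -
  have "{v. (word w :: _ \<Rightarrow> 'a) v \<noteq> 0} = {w}"
    by (auto simp: word_def)
  then show ?thesis
    by (simp add: free_act_def word_def)
qed

lemma (in vector_space) free_act_add:
  assumes "a \<in> carrier (free_algebra V)" "b \<in> carrier (free_algebra V)"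
  shows "free_act scale act (a + b) m = free_act scale act a m + free_act scale act b m"
proof -
  let ?S = "{w. a w \<noteq> 0} \<union> {w. b w \<noteq> 0}"
  have S: "finite ?S"
    using assms by (simp add: free_algebra_simps)
  have "free_act scale act c m = (\<Sum>w\<in>?S. scale (c w) (foldr act w m))" if "{w. c w \<noteq> 0} \<subseteq> ?S" for c
    by (rule free_act_superset[OF module_axioms S that])
  moreover have "{w. (a + b) w \<noteq> 0} \<subseteq> ?S"
    by auto
  ultimately have "free_act scale act (a + b) m = (\<Sum>w\<in>?S. scale ((a + b) w) (foldr act w m))"
    "free_act scale act a m = (\<Sum>w\<in>?S. scale (a w) (foldr act w m))"
    "free_act scale act b m = (\<Sum>w\<in>?S. scale (b w) (foldr act w m))"
    by blast+
  then show ?thesis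
    by (simp add: scale_left_distrib sum.distrib)
qed

lemma (in vector_space) free_act_cmult:
  assumes "a \<in> carrier (free_algebra V)"
  shows "free_act scale act (\<lambda>w. c * a w) m = scale c (free_act scale act a m)"
proof -
  have S: "finite {w. a w \<noteq> 0}"
    using assms by (simp add: free_algebra_simps)
  have "free_act scale act (\<lambda>w. c * a w) m = (\<Sum>w\<in>{w. a w \<noteq> 0}. scale (c * a w) (foldr act w m))"
    by (rule free_act_superset[OF module_axioms S]) auto
  then show ?thesis
    by (simp add: free_act_def scale_sum_right)
qed

lemma (in vector_space) free_act_diff:
  assumes "a \<in> carrier (free_algebra V)" "b \<in> carrier (free_algebra V)"
  shows "free_act scale act (a - b) m = free_act scale act a m - free_act scale act b m"
proof -
  have "scalar_word (- 1) \<otimes>\<^bsub>free_algebra V\<^esub> b \<in> carrier (free_algebra V)"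
    by (intro free_mult_closed scalar_word_carrier assms)
  then have "(\<lambda>w. - 1 * b w) \<in> carrier (free_algebra V)"
    by (simp add: scalar_word_mult)
  from free_act_add[OF assms(1) this, of act m] free_act_cmult[OF assms(2), of act "- 1" m] show ?thesis
    by (simp add: plus_fun_def fun_diff_def scale_minus_left)
qed

section \<open>The restricted enveloping algebra of an elementary subalgebra\<close>

locale elementary_algebra =
  fixes V :: "('g, 'k::field) oper set"
  assumes subspace: "op.subspace V"
    and abelian: "\<lbrakk>x \<in> V; y \<in> V\<rbrakk> \<Longrightarrow> bracket x y = 0"
    and p_nilpotent: "x \<in> V \<Longrightarrow> p_op x = 0"
    and char: "CHAR('k) > 0"
begin

abbreviation "F \<equiv> free_algebra V :: (('g, 'k) oper list \<Rightarrow> 'k) ring"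
abbreviation "I \<equiv> Idl\<^bsub>F\<^esub> (u_relations V)"
abbreviation "U \<equiv> u_alg V"
abbreviation proj :: "(('g, 'k) oper list \<Rightarrow> 'k) \<Rightarrow> (('g, 'k) oper list \<Rightarrow> 'k) set" where
  "proj a \<equiv> I +>\<^bsub>F\<^esub> a"

sublocale F: ring F
  by (rule ring_free_algebra)

lemma F_minus: "a \<in> carrier F \<Longrightarrow> b \<in> carrier F \<Longrightarrow> a \<ominus>\<^bsub>F\<^esub> b = a - b"
proof -
  assume a: "a \<in> carrier F" and b: "b \<in> carrier F"
  have nb: "- b \<in> carrier F"
    using b by (simp add: free_algebra_simps)
  have "\<ominus>\<^bsub>F\<^esub> b = - b"
    by (rule F.minus_equality) (use b nb in \<open>auto simp: free_algebra_simps\<close>)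
  then show ?thesis
    by (simp add: a_minus_def free_algebra_simps)
qed

lemma F_diff_closed: "a \<in> carrier F \<Longrightarrow> b \<in> carrier F \<Longrightarrow> a - b \<in> carrier F"
  using F.minus_closed F_minus by metis

lemma V_closed: "0 \<in> V" "x \<in> V \<Longrightarrow> y \<in> V \<Longrightarrow> x + y \<in> V" "x \<in> V \<Longrightarrow> oscale c x \<in> V"
  using subspace by (auto simp: op.subspace_def)

text \<open>Brackets and p-th powers vanish in V, yet \<open>word [0]\<close> remains: the letter 0
  is not the zero of the free algebra. It does lie in the ideal of relations
  (\<open>word_0_in\<close>).\<close>

lemma relations_cases:
  assumes "a \<in> u_relations V"
  obtains x y where "x \<in> V" "y \<in> V" "a = word [x + y] - word [x] - word [y]"
  | c x where "x \<in> V" "a = word [oscale c x] - (\<lambda>w. c * word [x] w)"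
  | x y where "x \<in> V" "y \<in> V" "a = word [x, y] - word [y, x] - word [0]"
  | x where "x \<in> V" "a = word (replicate CHAR('k) x) - word [0]"
proof -
  from assms show thesis
    unfolding u_relations_def Un_iff mem_Collect_eq
  proof (elim disjE exE conjE)
    fix x y assume "a = word [x + y] - word [x] - word [y]" "x \<in> V" "y \<in> V"
    then show thesis
      using that(1) by simp
  next
    fix c x assume "a = word [oscale c x] - (\<lambda>w. c * word [x] w)" "x \<in> V"
    then show thesis
      using that(2) by simp
  next
    fix x y assume "a = word [x, y] - word [y, x] - word [bracket x y]" "x \<in> V" "y \<in> V"
    then show thesis
      using that(3) abelian by simp
  next
    fix x assume "a = word (replicate CHAR('k) x) - word [p_op x]" "x \<in> V"
    then show thesis
      using that(4) p_nilpotent by simp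
  qed
qed

lemma cmult_closed: "a \<in> carrier F \<Longrightarrow> (\<lambda>w. c * a w) \<in> carrier F"
  using F.m_closed[OF scalar_word_carrier[of c V]] by (simp add: scalar_word_mult)

lemma relations_carrier: "u_relations V \<subseteq> carrier F"
proof
  fix a assume "a \<in> u_relations V"
  then show "a \<in> carrier F"
    by (cases rule: relations_cases)
      (auto intro!: F_diff_closed cmult_closed word_carrier simp: V_closed)
qed

sublocale I: ideal I F
  by (rule F.genideal_ideal[OF relations_carrier])

sublocale proj: ring_hom_ring F U proj
  unfolding u_alg_def by (rule I.rcos_ring_hom_ring)

lemma U_carrier: "carrier U = proj ` carrier F"
  unfolding u_alg_def FactRing_def A_RCOSETS_def' by auto

lemma proj_eq:
  assumes "a \<in> carrier F" "b \<in> carrier F"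
  shows "proj a = proj b \<longleftrightarrow> a - b \<in> I"
  using F.quotient_eq_iff_same_a_r_cos[OF I.ideal_axioms assms] F_minus[OF assms] by simp

lemma rel_in: "a \<in> u_relations V \<Longrightarrow> a \<in> I"
  using F.genideal_self[OF relations_carrier] by blast

lemma I_add: "a \<in> I \<Longrightarrow> b \<in> I \<Longrightarrow> a + b \<in> I"
  using I.a_closed by (simp add: free_algebra_simps)

lemma word_0_in: "word [0] \<in> I"
proof -
  \<comment> \<open>The scalar relation for c = 0 and the vector 0 is \<open>word [0]\<close>
    itself.\<close>
  have "word [oscale 0 0] - (\<lambda>w. 0 * word [0] w) \<in> u_relations V"
    unfolding u_relations_def using V_closed(1) by blast
  moreover have "word [oscale 0 0] - (\<lambda>w. 0 * word [0] w) = (word [0] :: ('g, 'k) oper list \<Rightarrow> 'k)"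
    by (simp add: fun_eq_iff)
  ultimately show ?thesis
    using rel_in by metis
qed

lemma swap_in:
  assumes "x \<in> V" "y \<in> V"
  shows "word [x, y] - word [y, x] \<in> I"
proof -
  have "word [x, y] - word [y, x] - word [0] \<in> I"
  proof -
    have "word [x, y] - word [y, x] - word [bracket x y] \<in> u_relations V"
      unfolding u_relations_def using assms by blast
    then show ?thesis
      using abelian[OF assms] rel_in by simp
  qed
  from I_add[OF this word_0_in] show ?thesis
    by simp
qed

lemma power_in:
  assumes "x \<in> V"
  shows "word (replicate CHAR('k) x) \<in> I"
proof -
  have "word (replicate CHAR('k) x) - word [0] \<in> I"
  proof -
    have "word (replicate CHAR('k) x) - word [p_op x] \<in> u_relations V"
      unfolding u_relations_def using assms by blast
    then show ?thesis
      using p_nilpotent[OF assms] rel_in by simp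
  qed
  from I_add[OF this word_0_in] show ?thesis
    by simp
qed

definition commuting :: "(('g, 'k) oper list \<Rightarrow> 'k) \<Rightarrow> (('g, 'k) oper list \<Rightarrow> 'k) \<Rightarrow> bool" where
  "commuting b a \<longleftrightarrow> proj a \<otimes>\<^bsub>U\<^esub> proj b = proj b \<otimes>\<^bsub>U\<^esub> proj a"

lemma commuting_closed:
  assumes "a \<in> carrier F" "a' \<in> carrier F" "b \<in> carrier F" "commuting b a" "commuting b a'"
  shows "commuting b (a \<oplus>\<^bsub>F\<^esub> a')" "commuting b (a \<otimes>\<^bsub>F\<^esub> a')"
proof -
  note c = proj.hom_closed[OF assms(1)] proj.hom_closed[OF assms(2)] proj.hom_closed[OF assms(3)]
  show "commuting b (a \<oplus>\<^bsub>F\<^esub> a')"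
    using assms c by (simp add: commuting_def proj.S.l_distr proj.S.r_distr)
  have "proj a \<otimes>\<^bsub>U\<^esub> proj a' \<otimes>\<^bsub>U\<^esub> proj b = proj a \<otimes>\<^bsub>U\<^esub> (proj b \<otimes>\<^bsub>U\<^esub> proj a')"
    using assms c by (simp add: commuting_def proj.S.m_assoc)
  also have "\<dots> = proj b \<otimes>\<^bsub>U\<^esub> (proj a \<otimes>\<^bsub>U\<^esub> proj a')"
    using assms(4) c unfolding commuting_def by (metis proj.S.m_assoc)
  finally show "commuting b (a \<otimes>\<^bsub>F\<^esub> a')"
    using assms by (simp add: commuting_def)
qed

lemma commuting_scalar: "b \<in> carrier F \<Longrightarrow> commuting b (scalar_word c)"
  unfolding commuting_def using scalar_word_carrier[of c V]
  by (simp add: proj.hom_mult[symmetric] scalar_word_mult del: proj.hom_mult)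

text \<open>Commuting with a fixed element is closed under sums and products, so commutation spreads
  from pairs of letters to all elements against letters and then to all pairs. Commutativity makes
  maximal ideals prime below.\<close>

lemma cring_U: "cring U"
proof -
  have letters: "commuting (word [y]) (word [x])" if "x \<in> V" "y \<in> V" for x y
  proof -
    have "proj (word [x, y]) = proj (word [y, x])"
      using that by (subst proj_eq) (auto intro!: word_carrier swap_in)
    moreover have "proj (word [x]) \<otimes>\<^bsub>U\<^esub> proj (word [y]) = proj (word [x, y])" if "x \<in> V" "y \<in> V" for x y
      using that by (subst proj.hom_mult[symmetric]) (auto simp: word_mult intro!: word_carrier)
    ultimately show ?thesis
      using that by (simp add: commuting_def)
  qed
  have 1: "commuting (word [y]) a" if "a \<in> carrier F" "y \<in> V" for a y
  proof -
    have y: "word [y] \<in> carrier F"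
      using that by (simp add: word_carrier)
    show ?thesis
      by (rule free_algebra_induct[OF that(1)])
        (simp_all add: commuting_scalar[OF y] commuting_closed[OF _ _ y] letters that(2))
  qed
  have 2: "commuting a b" if "a \<in> carrier F" "b \<in> carrier F" for a b
  proof -
    have L: "commuting a (word [x])" if "x \<in> V" for x
      using 1[OF \<open>a \<in> carrier F\<close> that] by (simp add: commuting_def)
    show ?thesis
      by (rule free_algebra_induct[OF that(2)])
        (simp_all add: L commuting_scalar[OF that(1)] commuting_closed[OF _ _ that(1)])
  qed
  show ?thesis
  proof (intro cring.intro comm_monoid.intro comm_monoid_axioms.intro)
    show "ring U"
      by (rule proj.S.ring_axioms)
    show "Group.monoid U"
      by (rule proj.S.monoid_axioms)
    show "x \<otimes>\<^bsub>U\<^esub> y = y \<otimes>\<^bsub>U\<^esub> x" if "x \<in> carrier U" "y \<in> carrier U" for x y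
      using that 2 unfolding U_carrier commuting_def by blast
  qed
qed

lemma mult_order:
  assumes "\<And>w. length w < i \<Longrightarrow> a w = 0" "\<And>w. length w < j \<Longrightarrow> b w = 0" "length w < i + j"
  shows "(a \<otimes>\<^bsub>F\<^esub> b) w = 0"
  unfolding free_mult
proof (rule sum.neutral, clarify)
  fix u v assume "w = u @ v"
  then have "length u < i \<or> length v < j"
    using assms(3) by auto
  then show "a u * b v = 0"
    using assms(1,2) by auto
qed

lemma mult_Nil: "(a \<otimes>\<^bsub>F\<^esub> b) [] = a [] * b []"
  by (simp add: free_algebra_def)

lemma ideal_augmentation: "ideal {a \<in> carrier F. a [] = 0} F"
  by (rule F.ring_idealI) (auto simp: mult_Nil, auto simp: free_algebra_simps)

text \<open>No relation has a constant term. For the relation of the p-th power this needs p > 0, as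
  an empty word would be the constant 1.\<close>

lemma I_augmentation: "a \<in> I \<Longrightarrow> a [] = 0"
proof -
  have "u_relations V \<subseteq> {a \<in> carrier F. a [] = 0}"
  proof
    fix a assume a: "a \<in> u_relations V"
    then have "a [] = 0"
      by (cases rule: relations_cases) (use char in \<open>auto simp: word_def\<close>)
    then show "a \<in> {a \<in> carrier F. a [] = 0}"
      using a relations_carrier by auto
  qed
  from F.genideal_minimal[OF ideal_augmentation this] show "a \<in> I \<Longrightarrow> ?thesis"
    by auto
qed

text \<open>The residue field is k: an element with constant term c \<noteq> 0 differs from c by an
  element of the augmentation ideal, so an ideal containing both contains the unit c. This one
  maximal ideal bounds the Jacobson radical from above.\<close>

lemma maximal_augmentation: "maximalideal (proj ` {a \<in> carrier F. a [] = 0}) U"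
  (is "maximalideal (proj ` ?K) U" is "maximalideal ?M U")
proof (rule maximalidealI)
  interpret aug: ideal "{a \<in> carrier F. a [] = 0}" F
    by (rule ideal_augmentation)
  show M: "ideal ?M U"
  proof (rule proj.S.ring_idealI)
    show "?M \<subseteq> carrier U"
      unfolding U_carrier by blast
    show "\<zero>\<^bsub>U\<^esub> \<in> ?M"
      unfolding proj.hom_zero[symmetric] by (rule imageI[OF aug.zero_closed])
    show "a \<oplus>\<^bsub>U\<^esub> b \<in> ?M" if a: "a \<in> ?M" and x: "b \<in> ?M" for a b
    proof -
      obtain c where c: "a = proj c" "c \<in> ?K"
        using a by blast
      obtain d where d: "b = proj d" "d \<in> ?K"
        using x by blast
      have "proj (c \<oplus>\<^bsub>F\<^esub> d) \<in> ?M"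
        by (intro imageI aug.a_closed c(2) d(2))
      moreover have "proj (c \<oplus>\<^bsub>F\<^esub> d) = proj c \<oplus>\<^bsub>U\<^esub> proj d"
        by (rule proj.hom_add) (use c(2) d(2) in blast)+
      ultimately show ?thesis
        by (simp only: c(1) d(1))
    qed
    show "x \<otimes>\<^bsub>U\<^esub> a \<in> ?M" if a: "a \<in> ?M" and x: "x \<in> carrier U" for a x
    proof -
      obtain c where c: "a = proj c" "c \<in> ?K"
        using a by blast
      obtain d where d: "x = proj d" "d \<in> carrier F"
        using x U_carrier by blast
      have "proj (d \<otimes>\<^bsub>F\<^esub> c) \<in> ?M"
        by (intro imageI aug.I_l_closed c(2) d(2))
      moreover have "proj (d \<otimes>\<^bsub>F\<^esub> c) = proj d \<otimes>\<^bsub>U\<^esub> proj c"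
        by (rule proj.hom_mult) (use c(2) d(2) in blast)+
      ultimately show ?thesis
        by (simp only: c(1) d(1))
    qed
    show "a \<otimes>\<^bsub>U\<^esub> x \<in> ?M" if a: "a \<in> ?M" and x: "x \<in> carrier U" for a x
    proof -
      obtain c where c: "a = proj c" "c \<in> ?K"
        using a by blast
      obtain d where d: "x = proj d" "d \<in> carrier F"
        using x U_carrier by blast
      have "proj (c \<otimes>\<^bsub>F\<^esub> d) \<in> ?M"
        by (intro imageI aug.I_r_closed c(2) d(2))
      moreover have "proj (c \<otimes>\<^bsub>F\<^esub> d) = proj c \<otimes>\<^bsub>U\<^esub> proj d"
        by (rule proj.hom_mult) (use c(2) d(2) in blast)+
      ultimately show ?thesis
        by (simp only: c(1) d(1))
    qed
  qed
  show "carrier U \<noteq> ?M"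
  proof
    assume "carrier U = ?M"
    then have "proj ` carrier F = ?M"
      unfolding U_carrier .
    then have "proj \<one>\<^bsub>F\<^esub> \<in> ?M"
      using F.one_closed by blast
    then obtain a where a: "a \<in> carrier F" "a [] = 0" "proj \<one>\<^bsub>F\<^esub> = proj a"
      by blast
    then have "\<one>\<^bsub>F\<^esub> - a \<in> I"
      using proj_eq[OF F.one_closed a(1)] by blast
    then have "(\<one>\<^bsub>F\<^esub> - a) [] = 0"
      by (rule I_augmentation)
    then show False
      using a(2) by (simp add: free_algebra_simps(2))
  qed
  show "J = ?M \<or> J = carrier U" if J: "ideal J U" and MJ: "?M \<subseteq> J" and JU: "J \<subseteq> carrier U" for J
  proof (rule disjCI)
    assume JC: "J \<noteq> carrier U"
    show "J = ?M"
    proof (rule ccontr)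
      assume "J \<noteq> ?M"
      then obtain u where u: "u \<in> J" "u \<notin> ?M"
        using MJ by blast
      then obtain a where a: "u = proj a" "a \<in> carrier F"
        using JU U_carrier by blast
      then have c: "a [] \<noteq> 0"
        using u by blast
      \<comment> \<open>?b is the constant term minus a, a member of the augmentation ideal; ?i is
        the inverse of the constant.\<close>
      let ?b = "scalar_word (a []) - a" and ?i = "scalar_word (inverse (a []))"
      have sc: "scalar_word x \<in> carrier F" for x
        by (rule scalar_word_carrier)
      have b: "?b \<in> carrier F" "?b [] = 0"
        by (rule F_diff_closed[OF sc a(2)]) (simp add: scalar_word_def word_def)
      interpret J: ideal J U
        by fact
      have "proj ?b \<in> J"
        using MJ imageI[of ?b ?K proj] b by blast
      then have "proj ?b \<oplus>\<^bsub>U\<^esub> proj a \<in> J"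
        using J.a_closed u(1) unfolding a(1) by blast
      moreover have "proj (?b \<oplus>\<^bsub>F\<^esub> a) = proj ?b \<oplus>\<^bsub>U\<^esub> proj a"
        by (rule proj.hom_add[OF b(1) a(2)])
      moreover have "?b \<oplus>\<^bsub>F\<^esub> a = scalar_word (a [])"
        by (simp add: free_algebra_simps(4))
      ultimately have "proj (scalar_word (a [])) \<in> J"
        by (simp only:)
      then have "proj ?i \<otimes>\<^bsub>U\<^esub> proj (scalar_word (a [])) \<in> J"
        by (rule J.I_l_closed) (rule proj.hom_closed[OF sc])
      moreover have "proj (?i \<otimes>\<^bsub>F\<^esub> scalar_word (a [])) = proj ?i \<otimes>\<^bsub>U\<^esub> proj (scalar_word (a []))"
        by (rule proj.hom_mult[OF sc sc])
      moreover have "?i \<otimes>\<^bsub>F\<^esub> scalar_word (a []) = \<one>\<^bsub>F\<^esub>"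
        unfolding scalar_word_mult using c by (simp add: scalar_word_def word_def free_algebra_simps(2) fun_eq_iff)
      ultimately have "\<one>\<^bsub>U\<^esub> \<in> J"
        by (simp only: proj.hom_one)
      then show False
        using J.one_imp_carrier JC by blast
    qed
  qed
qed

section \<open>Powers of the Jacobson radical\<close>

abbreviation "Jac \<equiv> jacobson_radical U"

text \<open>The p-th power of x is zero in U, so x lies in every prime ideal and thus in every
  maximal one. This bounds the Jacobson radical from below.\<close>

lemma letter_in_Jac:
  assumes x: "x \<in> V"
  shows "proj (word [x]) \<in> Jac"
proof -
  have wc: "word [x] \<in> carrier F" "word (replicate n x) \<in> carrier F" for n
    using x by (auto intro!: word_carrier)
  have "proj (word [x]) \<in> N" if "maximalideal N U" for N
  proof -
    interpret N: primeideal N U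
      using cring.maximalideal_prime[OF cring_U that] .
    have "proj (word (replicate (Suc n) x)) \<in> N \<Longrightarrow> proj (word [x]) \<in> N" for n
    proof (induction n)
      case (Suc n)
      have "word [x] \<otimes>\<^bsub>F\<^esub> word (replicate (Suc n) x) = word (replicate (Suc (Suc n)) x)"
        by (simp add: word_mult)
      then have "proj (word [x]) \<otimes>\<^bsub>U\<^esub> proj (word (replicate (Suc n) x)) \<in> N"
        using Suc.prems wc proj.hom_mult by metis
      then show ?case
        using N.I_prime wc Suc.IH proj.hom_closed by blast
    qed simp
    moreover have "proj (word (replicate CHAR('k) x)) \<in> N"
    proof -
      have z: "0 \<in> carrier F" "proj 0 = \<zero>\<^bsub>U\<^esub>"
        using F.zero_closed proj.hom_zero by (simp_all add: free_algebra_simps(3))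
      have "proj (word (replicate CHAR('k) x)) = proj 0"
        using power_in[OF x] wc z by (subst proj_eq) simp_all
      then show ?thesis
        using N.zero_closed z by simp
    qed
    ultimately show ?thesis
      using char by (metis Suc_pred)
  qed
  then show ?thesis
    unfolding jacobson_radical_def using wc proj.hom_closed by blast
qed

text \<open>Every factor from the radical lies in the augmentation ideal and raises the order by
  one. Only a suitable representative has this order: adding \<open>word [0]\<close>, which lies in
  the ideal of relations, would spoil it for j > 1.\<close>

lemma Jac_power_order:
  "u \<in> ideal_power U Jac j \<Longrightarrow> \<exists>a\<in>carrier F. u = proj a \<and> (\<forall>w. length w < j \<longrightarrow> a w = 0)"
proof (induction j arbitrary: u)
  case 0
  then show ?case
    by (auto simp: U_carrier)
next
  case (Suc j)
  have "u \<in> ideal_prod U Jac (ideal_power U Jac j)"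
    using Suc.prems by simp
  then show ?case
  proof (induction rule: ideal_prod.induct)
    case (prod x y)
    have "x \<in> proj ` {a \<in> carrier F. a [] = 0}"
      using prod(1) maximal_augmentation by (auto simp: jacobson_radical_def)
    then obtain a where a: "a \<in> carrier F" "x = proj a" "a [] = 0"
      by auto
    obtain b where b: "b \<in> carrier F" "y = proj b" "\<And>w. length w < j \<Longrightarrow> b w = 0"
      using Suc.IH[OF prod(2)] by auto
    have "(a \<otimes>\<^bsub>F\<^esub> b) w = 0" if "length w < Suc j" for w
      using a b that by (intro mult_order[of 1 a j b]) auto
    then show ?case
      using a b by (intro bexI[of _ "a \<otimes>\<^bsub>F\<^esub> b"]) auto
  next
    case (sum x y)
    then obtain a b where "a \<in> carrier F" "x = proj a" "\<forall>w. length w < Suc j \<longrightarrow> a w = 0"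
      "b \<in> carrier F" "y = proj b" "\<forall>w. length w < Suc j \<longrightarrow> b w = 0"
      by blast
    then show ?case
      by (intro bexI[of _ "a \<oplus>\<^bsub>F\<^esub> b"] conjI) (simp_all, simp add: free_algebra_simps)
  qed
qed

text \<open>The converse bound: by \<open>Jac_power_order\<close> the j-th power acts through words
  of length at least j, and here every word of length j is seen to occur.\<close>

lemma word_in_Jac_power: "set w \<subseteq> V \<Longrightarrow> proj (word w) \<in> ideal_power U Jac (length w)"
proof (induction w)
  case Nil
  then show ?case
    by (simp add: U_carrier word_carrier imageI)
next
  case (Cons x w)
  have "proj (word [x]) \<otimes>\<^bsub>U\<^esub> proj (word w) \<in> ideal_prod U Jac (ideal_power U Jac (length w))"
    using Cons by (intro ideal_prod.prod letter_in_Jac) auto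
  moreover have "proj (word [x]) \<otimes>\<^bsub>U\<^esub> proj (word w) = proj (word (x # w))"
    using Cons.prems by (subst proj.hom_mult[symmetric]) (auto simp: word_mult intro!: word_carrier)
  ultimately show ?case
    by simp
qed

end

section \<open>Radical and socle layers of a module\<close>

locale elementary_module = elementary_algebra V + vector_space scale
  for V :: "('g, 'k::field) oper set" and scale :: "'k \<Rightarrow> 'm::ab_group_add \<Rightarrow> 'm" +
  fixes act :: "('g, 'k) oper \<Rightarrow> 'm \<Rightarrow> 'm"
  assumes act_hom: "x \<in> V \<Longrightarrow> module_hom scale scale (act x)"
    and act_plus: "\<lbrakk>x \<in> V; y \<in> V\<rbrakk> \<Longrightarrow> act (x + y) m = act x m + act y m"
    and act_oscale: "x \<in> V \<Longrightarrow> act (oscale c x) m = scale c (act x m)"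
    and act_comm: "\<lbrakk>x \<in> V; y \<in> V\<rbrakk> \<Longrightarrow> act x (act y m) = act y (act x m)"
    and act_nilpotent: "x \<in> V \<Longrightarrow> (act x ^^ CHAR('k)) m = 0"
begin

abbreviation "facts \<equiv> free_act scale act"

lemma act_zero: "act 0 m = 0"
  using act_oscale[OF V_closed(1), of 0 m] by (simp add: oscale_def zero_fun_def)

lemma foldr_hom:
  assumes "set w \<subseteq> V"
  shows "foldr act w (m + m') = foldr act w m + foldr act w m'"
    "foldr act w (scale c m) = scale c (foldr act w m)" "foldr act w 0 = 0"
  using assms
proof (induction w)
  case (Cons x w)
  { case 1
    then show ?case
      using Cons by (simp add: module_hom.add[OF act_hom]) }
  { case 2
    then show ?case
      using Cons by (simp add: module_hom.scale[OF act_hom]) }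
  { case 3
    then show ?case
      using Cons by (simp add: module_hom.zero[OF act_hom]) }
qed auto

lemma foldr_sum:
  assumes "set w \<subseteq> V"
  shows "foldr act w (\<Sum>i\<in>K. f i) = (\<Sum>i\<in>K. foldr act w (f i))"
  by (induction K rule: infinite_finite_induct) (simp_all add: foldr_hom[OF assms])

text \<open>Both sides are sums over pairs of words from the two supports; on the left they are
  grouped by concatenation. Cancellation in a coefficient of the product does no harm, because the
  sum may run over a set larger than the support.\<close>

lemma free_act_mult:
  assumes a: "a \<in> carrier F" and b: "b \<in> carrier F"
  shows "facts (a \<otimes>\<^bsub>F\<^esub> b) m = facts a (facts b m)"
proof -
  let ?A = "{w. a w \<noteq> 0}" and ?B = "{w. b w \<noteq> 0}" and ?c = "\<lambda>p :: _ list \<times> _ list. fst p @ snd p"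
  let ?g = "\<lambda>p. scale (a (fst p) * b (snd p)) (foldr act (?c p) m)"
  have fin: "finite (?A \<times> ?B)" and setA: "\<And>u. u \<in> ?A \<Longrightarrow> set u \<subseteq> V"
    using a b by (auto simp: free_algebra_simps)
  have coeff: "(a \<otimes>\<^bsub>F\<^esub> b) w = (\<Sum>p\<in>{p \<in> ?A \<times> ?B. ?c p = w}. a (fst p) * b (snd p))" for w
    unfolding free_mult case_prod_beta
    by (rule sum.mono_neutral_right) (auto simp: finite_splits_pair)
  have "facts (a \<otimes>\<^bsub>F\<^esub> b) m = (\<Sum>w\<in>?c ` (?A \<times> ?B). scale ((a \<otimes>\<^bsub>F\<^esub> b) w) (foldr act w m))"
  proof (rule free_act_superset[OF module_axioms])
    show "{w. (a \<otimes>\<^bsub>F\<^esub> b) w \<noteq> 0} \<subseteq> ?c ` (?A \<times> ?B)"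
    proof
      fix w assume w: "w \<in> {w. (a \<otimes>\<^bsub>F\<^esub> b) w \<noteq> 0}"
      have "{p \<in> ?A \<times> ?B. ?c p = w} \<noteq> {}"
      proof
        assume *: "{p \<in> ?A \<times> ?B. ?c p = w} = {}"
        have "(a \<otimes>\<^bsub>F\<^esub> b) w = 0"
          unfolding coeff * by simp
        then show False
          using w by simp
      qed
      then show "w \<in> ?c ` (?A \<times> ?B)"
        by blast
    qed
  qed (use fin in simp)
  also have "\<dots> = (\<Sum>w\<in>?c ` (?A \<times> ?B). \<Sum>p\<in>{p \<in> ?A \<times> ?B. ?c p = w}. ?g p)"
    unfolding coeff by (intro sum.cong refl) (auto simp: scale_sum_left intro!: sum.cong)
  also have "\<dots> = (\<Sum>p\<in>?A \<times> ?B. ?g p)"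
    by (rule sum.image_gen[OF fin, symmetric])
  also have "\<dots> = (\<Sum>u\<in>?A. \<Sum>v\<in>?B. scale (a u * b v) (foldr act (u @ v) m))"
    by (simp add: sum.cartesian_product case_prod_beta)
  also have "\<dots> = (\<Sum>u\<in>?A. scale (a u) (foldr act u (facts b m)))"
    by (intro sum.cong refl) (simp add: free_act_def foldr_sum[OF setA] foldr_hom[OF setA] scale_sum_right)
  also have "\<dots> = facts a (facts b m)"
    by (simp add: free_act_def)
  finally show ?thesis .
qed

lemma facts_0: "facts 0 m = 0"
  by (simp add: free_act_def)

lemma facts_zero_right:
  assumes "a \<in> carrier F" shows "facts a 0 = 0"
proof -
  have "foldr act w 0 = 0" if "a w \<noteq> 0" for w
    using that assms foldr_hom(3)[of w] by (auto simp: free_algebra_simps)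
  then show ?thesis
    by (auto simp: free_act_def)
qed

text \<open>The annihilator of the module is an ideal of the free algebra and contains the
  relations: additivity, homogeneity, commutation and nilpotency of \<open>act\<close> are their
  four kinds.\<close>

lemma I_acts_zero: "a \<in> I \<Longrightarrow> facts a m = 0"
proof -
  let ?K = "{a \<in> carrier F. \<forall>m. facts a m = 0}"
  have "ideal ?K F"
  proof (rule F.ring_idealI)
    show "\<zero>\<^bsub>F\<^esub> \<in> ?K"
      using F.zero_closed by (simp add: free_algebra_simps facts_0)
    show "a \<oplus>\<^bsub>F\<^esub> b \<in> ?K" if "a \<in> ?K" "b \<in> ?K" for a b
      using that F.a_closed[of a b] by (simp add: free_algebra_simps(4) free_act_add[of a V b])
    show "x \<otimes>\<^bsub>F\<^esub> a \<in> ?K" if "a \<in> ?K" "x \<in> carrier F" for a x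
      using that by (simp add: free_act_mult facts_zero_right)
    show "a \<otimes>\<^bsub>F\<^esub> x \<in> ?K" if "a \<in> ?K" "x \<in> carrier F" for a x
      using that by (simp add: free_act_mult)
  qed auto
  moreover have "u_relations V \<subseteq> ?K"
  proof
    fix a assume a: "a \<in> u_relations V"
    have w: "word w \<in> carrier F" if "set w \<subseteq> V" for w
      using that by (rule word_carrier)
    have "facts a m = 0" for m
      using a
    proof (cases rule: relations_cases)
      case (1 x y)
      then show ?thesis
        using w[of "[x + y]"] w[of "[x]"] w[of "[y]"] V_closed
        by (simp add: free_act_diff[where V = V] F_diff_closed free_act_word act_plus)
    next
      case (2 c x)
      then show ?thesis
        using w[of "[oscale c x]"] w[of "[x]"] cmult_closed[OF w[of "[x]"]] V_closed
        by (simp add: free_act_diff[where V = V] free_act_cmult[where V = V] free_act_word act_oscale)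
    next
      case (3 x y)
      then show ?thesis
        using w[of "[x, y]"] w[of "[y, x]"] w[of "[0]"] V_closed
        by (simp add: free_act_diff[where V = V] F_diff_closed free_act_word act_comm[of x y] act_zero)
    next
      case (4 x)
      then have "word (replicate CHAR('k) x) \<in> carrier F"
        by (intro w) auto
      with 4 show ?thesis
        using w[of "[0]"] V_closed
        by (simp add: free_act_diff[where V = V] free_act_word act_zero foldr_replicate_funpow act_nilpotent)
    qed
    then show "a \<in> ?K"
      using a relations_carrier by auto
  qed
  ultimately have "I \<subseteq> ?K"
    by (rule F.genideal_minimal)
  then show "a \<in> I \<Longrightarrow> ?thesis"
    by blast
qed

text \<open>All representatives of a class act alike, so \<open>the_elem\<close> in
  \<open>u_act\<close> is applied to a singleton.\<close>

lemma u_act_proj: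
  assumes a: "a \<in> carrier F"
  shows "u_act scale act (proj a) m = facts a m"
proof -
  have "facts b m = facts a m" if b: "b \<in> proj a" for b
  proof -
    obtain i where "i \<in> I" "b = i + a"
      using b by (auto simp: a_r_coset_def' free_algebra_simps)
    then show ?thesis
      using a I.Icarr I_acts_zero by (simp add: free_act_add[where V = V])
  qed
  moreover have "a \<in> proj a"
    using I.a_rcos_self[OF a] .
  ultimately have "(\<lambda>b. facts b m) ` proj a = {facts a m}"
    by blast
  then show ?thesis
    by (simp add: u_act_def)
qed

lemma Rad_eq: "Rad scale act V j = Rad_words scale act V j"
proof
  show "Rad scale act V j \<subseteq> Rad_words scale act V j"
    unfolding Rad_def
  proof (rule span_minimal)
    show "{u_act scale act u m |u m. u \<in> ideal_power U Jac j} \<subseteq> Rad_words scale act V j"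
    proof clarify
      fix u m assume "u \<in> ideal_power U Jac j"
      then obtain a where a: "a \<in> carrier F" "u = proj a" "\<And>w. length w < j \<Longrightarrow> a w = 0"
        using Jac_power_order by blast
      have "foldr act w m \<in> Rad_words scale act V j" if "a w \<noteq> 0" for w
      proof -
        have w: "set w \<subseteq> V" "j \<le> length w"
          using that a by (auto simp: free_algebra_simps not_less[symmetric])
        \<comment> \<open>A longer word is a word of length j applied to another vector: its first j
          letters are the outermost.\<close>
        then have "foldr act (take j w) (foldr act (drop j w) m) \<in> Rad_words scale act V j"
          unfolding Rad_words_def using set_take_subset[of j w]
          by (intro span_base CollectI exI[of _ "take j w"] exI[of _ "foldr act (drop j w) m"]) auto
        then show ?thesis
          by (simp flip: foldr_append comp_apply[of "foldr act (take j w)"])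
      qed
      then show "u_act scale act u m \<in> Rad_words scale act V j"
        unfolding a(2) u_act_proj[OF a(1)] free_act_def
        by (intro subspace_sum subspace_scale) (auto simp: Rad_words_def)
    qed
  qed (simp add: Rad_words_def)
  show "Rad_words scale act V j \<subseteq> Rad scale act V j"
    unfolding Rad_def Rad_words_def
  proof (intro span_mono subsetI)
    fix v assume "v \<in> {foldr act w m |w m. length w = j \<and> set w \<subseteq> V}"
    then obtain w m where w: "v = foldr act w m" "length w = j" "set w \<subseteq> V"
      by auto
    then have "v = u_act scale act (proj (word w)) m"
      by (simp add: u_act_proj word_carrier free_act_word)
    then show "v \<in> {u_act scale act u m |u m. u \<in> ideal_power U Jac j}"
      using word_in_Jac_power w by blast
  qed
qed

lemma Soc_eq: "Soc scale act V j = Soc_words act V j"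
proof (intro equalityI subsetI)
  fix m assume m: "m \<in> Soc scale act V j"
  have "foldr act w m = 0" if w: "length w = j" "set w \<subseteq> V" for w
  proof -
    have "u_act scale act (proj (word w)) m = 0"
      using m word_in_Jac_power[OF w(2)] w by (simp add: Soc_def)
    then show ?thesis
      using w by (simp add: u_act_proj word_carrier free_act_word)
  qed
  then show "m \<in> Soc_words act V j"
    by (simp add: Soc_words_def)
next
  fix m assume m: "m \<in> Soc_words act V j"
  have "u_act scale act u m = 0" if u: "u \<in> ideal_power U Jac j" for u
  proof -
    obtain a where a: "a \<in> carrier F" "u = proj a" "\<And>w. length w < j \<Longrightarrow> a w = 0"
      using Jac_power_order[OF u] by blast
    have "foldr act w m = 0" if "a w \<noteq> 0" for w
    proof -
      have w: "set w \<subseteq> V" "j \<le> length w"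
        using that a by (auto simp: free_algebra_simps not_less[symmetric])
      \<comment> \<open>For the socle the last j letters matter, as they are applied to m first; the
        remaining ones are applied to 0.\<close>
      let ?n = "length w - j"
      have "set (drop ?n w) \<subseteq> V" "set (take ?n w) \<subseteq> V"
        using w set_drop_subset[of ?n w] set_take_subset[of ?n w] by auto
      then have "foldr act (take ?n w) (foldr act (drop ?n w) m) = 0"
        using m w by (simp add: Soc_words_def foldr_hom)
      then show ?thesis
        by (simp flip: foldr_append comp_apply[of "foldr act (take ?n w)"])
    qed
    then show ?thesis
      unfolding a(2) u_act_proj[OF a(1)] by (auto simp: free_act_def)
  qed
  then show "m \<in> Soc scale act V j"
    by (simp add: Soc_def)
qed

end

section \<open>Orbits\<close>

lemma fs_morphism_cong:
  assumes "\<And>y. y \<in> topspace (topo Y) \<Longrightarrow> f y = g y" and f: "fs_morphism Y Z f"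
  shows "fs_morphism Y Z g"
proof -
  have p: "preim (topo Y) f V = preim (topo Y) g V" for V
    using assms(1) by (auto simp: preim_def)
  have c: "cut (preim (topo Y) g V) (s \<circ> f) = cut (preim (topo Y) g V) (s \<circ> g)" for V s
    using assms(1) by (auto simp: preim_def cut_def)
  show ?thesis
    using fs_morphismD[OF f] assms(1) by (intro fs_morphismI) (simp_all add: p c)
qed

lemma (in function_space) fs_morphism_into_sub_space:
  assumes f: "fs_morphism Y Z f" and X: "f ` topspace (topo Y) \<subseteq> X"
  shows "fs_morphism Y (sub_space Z X) f"
proof -
  have p: "preim (topo Y) f (W \<inter> X) = preim (topo Y) f W" for W
    using X by (auto simp: preim_def)
  have op: "openin (topo Y) (preim (topo Y) f V)" if V: "openin (topo (sub_space Z X)) V" for V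
  proof -
    obtain W where "openin (topo Z) W" "V = W \<inter> X"
      using V by (auto simp: openin_sub_space)
    then show ?thesis
      using fs_morphismD(1)[OF f] by (simp add: p)
  qed
  show ?thesis
  proof (rule fs_morphismI)
    show "f y \<in> topspace (topo (sub_space Z X))" if "y \<in> topspace (topo Y)" for y
      using fs_morphismD(3)[OF f that] X that by (auto simp: topspace_sub_space)
    show "cut (preim (topo Y) f V) (s \<circ> f) \<in> regf Y (preim (topo Y) f V)"
      if V: "openin (topo (sub_space Z X)) V" and s: "s \<in> regf (sub_space Z X) V" for V s
    proof (rule regf_local[OF op[OF V]])
      fix y assume y: "y \<in> preim (topo Y) f V"
      then have fy: "f y \<in> V"
        by (simp add: preim_def)
      have "\<forall>x\<in>V. \<exists>W t. openin (topo Z) W \<and> x \<in> W \<and> t \<in> regf Z W \<and> (\<forall>y \<in> W \<inter> V. s y = t y)"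
        using s by (simp add: regf_sub_space)
      from bspec[OF this fy] obtain W t where W: "openin (topo Z) W" "f y \<in> W" "t \<in> regf Z W"
        "\<forall>y \<in> W \<inter> V. s y = t y"
        by (elim exE conjE) (rule that)
      show "\<exists>V' t. openin (topo Y) V' \<and> y \<in> V' \<and> t \<in> regf Y V' \<and>
          (\<forall>x\<in>V' \<inter> preim (topo Y) f V. cut (preim (topo Y) f V) (s \<circ> f) x = t x)"
      proof (intro exI conjI ballI)
        show "openin (topo Y) (preim (topo Y) f W)"
          by (rule fs_morphismD(1)[OF f W(1)])
        show "cut (preim (topo Y) f W) (t \<circ> f) \<in> regf Y (preim (topo Y) f W)"
          by (rule fs_morphismD(2)[OF f W(1,3)])
        show "y \<in> preim (topo Y) f W"
          using y W(2) by (simp add: preim_def)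
        show "cut (preim (topo Y) f V) (s \<circ> f) x = cut (preim (topo Y) f W) (t \<circ> f) x"
          if "x \<in> preim (topo Y) f W \<inter> preim (topo Y) f V" for x
          using that W(4) by (simp add: preim_def)
      qed
    qed simp
  qed (rule op)
qed

text \<open>A space isomorphic to a quotient of Y carries the quotient structure of the composite
  map. Through this lemma the hypothesis X \<simeq> G/H becomes a description of the open sets and
  functions on X.\<close>

lemma fs_iso_quot_space:
  assumes iso: "fs_iso (quot_space Y c) Z \<phi>"
  shows "topspace (topo Z) = \<phi> ` c ` topspace (topo Y)"
    and "openin (topo Z) U \<longleftrightarrow> U \<subseteq> topspace (topo Z) \<and> openin (topo Y) (preim (topo Y) (\<phi> \<circ> c) U)"
    and "function_space Z \<Longrightarrow> openin (topo Z) U \<Longrightarrow> s \<in> regf Z U \<longleftrightarrow> (\<forall>z. z \<notin> U \<longrightarrow> s z = 0) \<and>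
      cut (preim (topo Y) (\<phi> \<circ> c) U) (s \<circ> (\<phi> \<circ> c)) \<in> regf Y (preim (topo Y) (\<phi> \<circ> c) U)"
proof -
  let ?Q = "quot_space Y c"
  define \<psi> where "\<psi> = the_inv_into (topspace (topo ?Q)) \<phi>"
  have bij: "bij_betw \<phi> (topspace (topo ?Q)) (topspace (topo Z))"
    and \<phi>: "fs_morphism ?Q Z \<phi>" and \<psi>: "fs_morphism Z ?Q \<psi>"
    using iso by (auto simp: fs_iso_def \<psi>_def)
  have \<psi>\<phi>: "\<psi> (\<phi> y) = y" if "y \<in> topspace (topo ?Q)" for y
    unfolding \<psi>_def using that bij by (simp add: the_inv_into_f_f bij_betw_def)
  have \<phi>\<psi>: "\<phi> (\<psi> z) = z" if "z \<in> topspace (topo Z)" for z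
    unfolding \<psi>_def using that bij by (simp add: f_the_inv_into_f_bij_betw)
  show ts: "topspace (topo Z) = \<phi> ` c ` topspace (topo Y)"
    using bij by (simp add: bij_betw_def topspace_quot_space)
  have m: "fs_morphism Y Z (\<phi> \<circ> c)"
    by (rule fs_morphism_comp[OF fs_morphism_quot_space \<phi>])
  define U' where "U' = preim (topo ?Q) \<phi> U"
  have pU': "preim (topo Y) c U' = preim (topo Y) (\<phi> \<circ> c) U"
    by (auto simp: U'_def preim_def topspace_quot_space)
  have U'_sub: "U' \<subseteq> c ` topspace (topo Y)"
    by (auto simp: U'_def preim_def topspace_quot_space)
  have p\<psi>: "preim (topo Z) \<psi> U' = U" if "U \<subseteq> topspace (topo Z)"
    using that fs_morphismD(3)[OF \<psi>] \<phi>\<psi> by (auto simp: U'_def preim_def)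
  show op: "openin (topo Z) U \<longleftrightarrow> U \<subseteq> topspace (topo Z) \<and> openin (topo Y) (preim (topo Y) (\<phi> \<circ> c) U)"
  proof
    assume U: "U \<subseteq> topspace (topo Z) \<and> openin (topo Y) (preim (topo Y) (\<phi> \<circ> c) U)"
    then have "openin (topo ?Q) U'"
      using U'_sub by (simp add: openin_quot_space pU')
    then show "openin (topo Z) U"
      using fs_morphismD(1)[OF \<psi>, of U'] p\<psi> U by simp
  qed (use fs_morphismD(1)[OF m] openin_subset in blast)
  assume "function_space Z" and U: "openin (topo Z) U"
  interpret Z: function_space Z
    by fact
  show "s \<in> regf Z U \<longleftrightarrow> (\<forall>z. z \<notin> U \<longrightarrow> s z = 0) \<and>
      cut (preim (topo Y) (\<phi> \<circ> c) U) (s \<circ> (\<phi> \<circ> c)) \<in> regf Y (preim (topo Y) (\<phi> \<circ> c) U)"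
  proof (intro iffI conjI)
    assume "s \<in> regf Z U"
    then show "\<forall>z. z \<notin> U \<longrightarrow> s z = 0"
      "cut (preim (topo Y) (\<phi> \<circ> c) U) (s \<circ> (\<phi> \<circ> c)) \<in> regf Y (preim (topo Y) (\<phi> \<circ> c) U)"
      using Z.regf_out fs_morphismD(2)[OF m U] by auto
  next
    assume s: "(\<forall>z. z \<notin> U \<longrightarrow> s z = 0) \<and>
      cut (preim (topo Y) (\<phi> \<circ> c) U) (s \<circ> (\<phi> \<circ> c)) \<in> regf Y (preim (topo Y) (\<phi> \<circ> c) U)"
    \<comment> \<open>This is s transported to the quotient; carried back by the inverse isomorphism
      it is s again.\<close>
    define s' where "s' = cut U' (s \<circ> \<phi>)"
    have "cut (preim (topo Y) c U') (s' \<circ> c) = cut (preim (topo Y) (\<phi> \<circ> c) U) (s \<circ> (\<phi> \<circ> c))"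
      unfolding pU'[symmetric] by (auto simp: s'_def preim_def cut_def)
    then have s': "s' \<in> regf ?Q U'"
      using s by (simp add: regf_quot_space pU') (simp add: s'_def)
    have U': "openin (topo ?Q) U'"
      unfolding U'_def by (rule fs_morphismD(1)[OF \<phi> U])
    have UZ: "U \<subseteq> topspace (topo Z)"
      using openin_subset[OF U] .
    have "cut U (s' \<circ> \<psi>) = s"
    proof
      fix z show "cut U (s' \<circ> \<psi>) z = s z"
      proof (cases "z \<in> U")
        case True
        then have "\<psi> z \<in> U'"
          using p\<psi>[OF UZ] by (auto simp: preim_def)
        then show ?thesis
          using True UZ \<phi>\<psi> by (auto simp: s'_def)
      qed (use s in simp)
    qed
    then show "s \<in> regf Z U"
      using fs_morphismD(2)[OF \<psi> U' s'] by (simp add: p\<psi>[OF UZ])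
  qed
qed

section \<open>The torsor of frames and its base\<close>

lemma function_space_tuple_space: "function_space (tuple_space G A B r)"
  and topspace_tuple_space: "topspace (topo (tuple_space G A B r)) = tuples G A r"
  unfolding tuple_space_def
  by (intro function_space_affine_space topspace_affine_space function_algebra_fun_alg)+

lemma function_space_base_space: "function_space (base_space G A B r X)"
  unfolding base_space_def Grass_def
  by (intro function_space.function_space_sub_space function_space.function_space_quot_space
      function_space_tuple_space)

lemma function_space_frame_space: "function_space (frame_space G A B r X)"
  unfolding frame_space_def by (intro function_space.function_space_sub_space function_space_tuple_space)

lemma topspace_frame_space:
  "topspace (topo (frame_space G A B r X)) = {x \<in> elem_frames G A r. span_map r x \<in> X}"
  by (auto simp: frame_space_def topspace_sub_space topspace_tuple_space elem_frames_def frames_def)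

lemma topspace_base_space:
  "topspace (topo (base_space G A B r X)) = span_map r ` frames G A r \<inter> X"
  by (auto simp: base_space_def Grass_def topspace_sub_space topspace_quot_space topspace_tuple_space
      frames_def)

text \<open>The frame space is cut out of all tuples, so the map is factored through the space of
  frames, whose quotient is the Grassmannian.\<close>

lemma fs_morphism_span_map:
  "fs_morphism (frame_space G A B r X) (base_space G A B r X) (span_map r)"
proof -
  let ?Y = "frame_space G A B r X" and ?T = "tuple_space G A B r"
  interpret Y: function_space ?Y
    by (rule function_space_frame_space)
  have "fs_morphism ?Y ?T id"
    unfolding frame_space_def by (intro fs_morphism_sub_space function_space_tuple_space)
  then have "fs_morphism ?Y (sub_space ?T (frames G A r)) id"
    by (rule Y.fs_morphism_into_sub_space) (auto simp: topspace_frame_space elem_frames_def)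
  from fs_morphism_comp[OF this fs_morphism_quot_space]
  have "fs_morphism ?Y (Grass G A B r) (span_map r)"
    by (simp add: Grass_def comp_def)
  then show ?thesis
    unfolding base_space_def
    by (rule Y.fs_morphism_into_sub_space) (auto simp: topspace_frame_space)
qed

section \<open>The orbit as a quotient of G\<close>

locale elementary_orbit = rational_action scale Basis G A \<rho>
  for scale :: "'k::field \<Rightarrow> 'm::ab_group_add \<Rightarrow> 'm" and Basis :: "'m set"
    and G :: "('g, 'q) monoid_scheme" (structure) and A :: "('g \<Rightarrow> 'k) set"
    and \<rho> :: "'g \<Rightarrow> 'm \<Rightarrow> 'm" +
  fixes B :: "('g, 'k) oper set" and \<epsilon> :: "('g, 'k) oper set" and r :: nat
  assumes char: "CHAR('k) > 0"
    and B: "lie_basis G A B"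
    and eps: "\<epsilon> \<in> elem_subalgs G A r"
    and iso: "fs_iso (coset_space G A (stabilizer G A \<epsilon>)) (base_space G A B r (orbit G A \<epsilon>)) (orbit_map G A \<epsilon>)"
begin

abbreviation "X \<equiv> orbit G A \<epsilon>"
abbreviation "H \<equiv> stabilizer G A \<epsilon>"
abbreviation "GG \<equiv> affine_space (carrier G) A"
abbreviation "CC \<equiv> coset_space G A H"
abbreviation "XX \<equiv> base_space G A B r X"
abbreviation "YY \<equiv> frame_space G A B r X"
abbreviation "orb \<equiv> orbit_map G A \<epsilon>"

text \<open>Factored through the cosets, so that the isomorphism hypothesis applies to it directly;
  \<open>pi_eq\<close> gives the formula by Ad.\<close>

definition pi :: "'g \<Rightarrow> ('g, 'k) oper set" where
  "pi = orb \<circ> (\<lambda>g. g <# H)"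

abbreviation "ppi \<equiv> preim (topo GG) pi"

sublocale GG: function_space GG
  by (rule function_space_affine_space[OF A_alg])

sublocale XX: function_space XX
  by (rule function_space_base_space)

sublocale YY: function_space YY
  by (rule function_space_frame_space)

sublocale CC: function_space CC
  unfolding coset_space_def by (rule GG.function_space_quot_space)

lemma topspace_GG [simp]: "topspace (topo GG) = carrier G"
  by (rule topspace_affine_space[OF A_alg])

lemma eps_Lie: "\<epsilon> \<subseteq> Lie G A"
  using eps by (simp add: elem_subalgs_def)

lemma H_carrier: "h \<in> H \<Longrightarrow> h \<in> carrier G"
  by (simp add: stabilizer_def)

lemma H_one: "\<one> \<in> H"
  by (simp add: stabilizer_def Ad_image_one[OF eps_Lie])

lemma H_inv: "h \<in> H \<Longrightarrow> inv h \<in> H"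
proof -
  assume h: "h \<in> H"
  then have "Ad G A (inv h) ` Ad G A h ` \<epsilon> = \<epsilon>"
    by (simp add: H_carrier Ad_image_mult[symmetric] Ad_image_one[OF eps_Lie])
  with h show ?thesis
    by (simp add: stabilizer_def)
qed

lemma mem_coset: "x \<in> g <# H \<longleftrightarrow> (\<exists>h\<in>H. x = g \<otimes> h)"
  by (auto simp: l_coset_def)

lemma self_coset: "g \<in> carrier G \<Longrightarrow> g \<in> g <# H"
  unfolding mem_coset using H_one by (metis grp.r_one)

lemma Ad_coset: "g \<in> carrier G \<Longrightarrow> h \<in> H \<Longrightarrow> Ad G A (g \<otimes> h) ` \<epsilon> = Ad G A g ` \<epsilon>"
  using Ad_image_mult[of g h \<epsilon>] by (simp add: stabilizer_def)

lemma pi_eq: "g \<in> carrier G \<Longrightarrow> pi g = Ad G A g ` \<epsilon>"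
proof -
  assume g: "g \<in> carrier G"
  have "Ad G A x ` \<epsilon> = Ad G A g ` \<epsilon>" if "x \<in> g <# H" for x
    using that Ad_coset[OF g] by (auto simp only: mem_coset)
  then have "(\<lambda>x. Ad G A x ` \<epsilon>) ` (g <# H) = {Ad G A g ` \<epsilon>}"
    using self_coset[OF g] by blast
  then show ?thesis
    by (simp add: pi_def orbit_map_def)
qed

lemma iso': "fs_iso (quot_space GG (\<lambda>g. g <# H)) XX orb"
  using iso by (simp add: coset_space_def)

lemma topspace_XX: "topspace (topo XX) = pi ` carrier G"
  using fs_iso_quot_space(1)[OF iso'] by (simp add: pi_def image_comp)

lemma openin_XX: "openin (topo XX) U \<longleftrightarrow> U \<subseteq> pi ` carrier G \<and> openin (topo GG) (ppi U)"
  using fs_iso_quot_space(2)[OF iso', of U] topspace_XX by (simp add: pi_def)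

lemma regf_XX:
  "openin (topo XX) U \<Longrightarrow> s \<in> regf XX U \<longleftrightarrow>
     (\<forall>x. x \<notin> U \<longrightarrow> s x = 0) \<and> cut (ppi U) (s \<circ> pi) \<in> regf GG (ppi U)"
  using fs_iso_quot_space(3)[OF iso' function_space_base_space, of U s] by (simp add: pi_def)

lemma pi_mult: "g \<in> carrier G \<Longrightarrow> x \<in> carrier G \<Longrightarrow> pi (g \<otimes> x) = Ad G A g ` pi x"
  by (simp add: pi_eq Ad_image_mult)

lemma pi_H: "g \<in> carrier G \<Longrightarrow> h \<in> H \<Longrightarrow> pi (g \<otimes> h) = pi g"
  by (simp add: H_carrier pi_eq Ad_coset)

lemma pi_eqD:
  assumes g: "g \<in> carrier G" "g' \<in> carrier G" and eq: "pi g = pi g'"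
  shows "g <# H = g' <# H"
proof -
  have "inj_on orb (topspace (topo CC))"
    using iso by (auto simp: fs_iso_def bij_betw_def)
  moreover have "g <# H \<in> topspace (topo CC)" "g' <# H \<in> topspace (topo CC)"
    using g by (auto simp: coset_space_def topspace_quot_space)
  ultimately show ?thesis
    using eq by (auto simp: pi_def dest: inj_onD)
qed

lemma regf_GG: "f \<in> A \<Longrightarrow> f \<in> regf GG (carrier G)"
  by (rule regf_affine_space_top[OF A_alg])

lemma fs_morphism_translation:
  assumes \<psi>: "\<And>x. x \<in> carrier G \<Longrightarrow> \<psi> x \<in> carrier G"
    and A: "\<And>f. f \<in> A \<Longrightarrow> cut (carrier G) (f \<circ> \<psi>) \<in> A"
  shows "fs_morphism GG GG \<psi>"
proof -
  obtain S where S: "A = fun_alg (carrier G) S"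
    using grp.variety by (auto simp: affine_variety_def)
  have "fs_morphism GG (affine_space (carrier G) (fun_alg (carrier G) S)) \<psi>"
  proof (rule GG.fs_morphism_affine_space)
    fix f assume "f \<in> S"
    then have "cut (carrier G) f \<in> A"
      unfolding S by (rule fun_alg.gen)
    then have "cut (carrier G) (cut (carrier G) f \<circ> \<psi>) \<in> A"
      by (rule A)
    moreover have "cut (carrier G) (cut (carrier G) f \<circ> \<psi>) = cut (carrier G) (f \<circ> \<psi>)"
      using \<psi> by (auto simp: cut_def)
    ultimately show "cut (topspace (topo GG)) (f \<circ> \<psi>) \<in> regf GG (topspace (topo GG))"
      by (simp add: regf_GG)
  qed (use \<psi> in auto)
  then show ?thesis
    by (simp add: S)
qed

lemma fs_morphism_rtranslation: "h \<in> carrier G \<Longrightarrow> fs_morphism GG GG (\<lambda>x. x \<otimes> h)"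
  using A_rtrans[of _ h] by (intro fs_morphism_translation) (auto simp: rtrans_def comp_def)

lemma fs_morphism_ltranslation: "h \<in> carrier G \<Longrightarrow> fs_morphism GG GG (\<lambda>x. h \<otimes> x)"
  using A_ltrans[of _ "inv h"] by (intro fs_morphism_translation) (auto simp: ltrans_def comp_def)

sublocale TO: trivial_bundle scale Basis GG ..

sublocale TX: trivial_bundle scale Basis XX ..

sublocale TY: trivial_bundle scale Basis YY ..

lemma triv_XX:
  assumes U: "openin (topo XX) U"
  shows "s \<in> TX.triv U \<longleftrightarrow> (\<forall>x. x \<notin> U \<longrightarrow> s x = 0) \<and> cut (ppi U) (s \<circ> pi) \<in> TO.triv (ppi U)"
proof -
  have c: "(\<lambda>x. coord b (cut (ppi U) (s \<circ> pi) x)) = cut (ppi U) ((\<lambda>x. coord b (s x)) \<circ> pi)" for b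
    by (auto simp: cut_def)
  have "(\<forall>b\<in>Basis. \<forall>x. x \<notin> U \<longrightarrow> coord b (s x) = 0) \<longleftrightarrow> (\<forall>x. x \<notin> U \<longrightarrow> s x = 0)"
    using coord_eqI[of _ 0] by auto
  then show ?thesis
    unfolding TX.triv_iff TO.triv_iff regf_XX[OF U] c by auto
qed

lemma bsec_XX:
  assumes U: "openin (topo XX) U"
  shows "s \<in> TX.bsec E U \<longleftrightarrow> (\<forall>x. x \<notin> U \<longrightarrow> s x = 0) \<and> cut (ppi U) (s \<circ> pi) \<in> TO.triv (ppi U) \<and>
    (\<forall>x\<in>U. s x \<in> E x)"
  using U by (simp add: bundle_sections_def triv_XX)

end

text \<open>Radical and socle layers enter what follows only through this translation property of E,
  so image and kernel sheaf are treated at once.\<close>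

locale homogeneous_bundle = elementary_orbit scale Basis G A \<rho> B \<epsilon> r
  for scale :: "'k::field \<Rightarrow> 'm::ab_group_add \<Rightarrow> 'm" and Basis :: "'m set"
    and G :: "('g, 'q) monoid_scheme" (structure) and A :: "('g \<Rightarrow> 'k) set"
    and \<rho> :: "'g \<Rightarrow> 'm \<Rightarrow> 'm" and B :: "('g, 'k) oper set" and \<epsilon> :: "('g, 'k) oper set" and r :: nat +
  fixes E :: "('g, 'k) oper set \<Rightarrow> 'm set" and W :: "'m set"
  assumes W: "subspace W" and E: "g \<in> carrier G \<Longrightarrow> E (pi g) = \<rho> g ` W"
begin

lemma subspace_E: "g \<in> carrier G \<Longrightarrow> subspace (E (pi g))"
  using module_hom.subspace_image[OF rho_module_hom W] by (simp add: E)

lemma dim_E: "g \<in> carrier G \<Longrightarrow> dim (E (pi g)) = dim W"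
proof -
  assume g: "g \<in> carrier G"
  interpret finite_dimensional_vector_space_pair scale Basis scale Basis ..
  show ?thesis
    unfolding E[OF g] by (rule dim_image_eq[OF rho_linear[OF g] inj_on_subset[OF inj_rho[OF g]]]) simp
qed

lemma vector_subbundle_GG: "vector_subbundle GG scale Basis (E \<circ> pi) (dim W)"
  unfolding vector_subbundle_def
proof (intro ballI conjI)
  fix g assume "g \<in> topspace (topo GG)"
  then have g: "g \<in> carrier G"
    by simp
  show "subspace ((E \<circ> pi) g)" "dim ((E \<circ> pi) g) = dim W"
    using subspace_E dim_E g by auto
  have "\<exists>U bb v. g \<in> U \<and> echelon_frame GG scale Basis (E \<circ> pi) U (dim W) bb v \<and>
      (\<forall>i<dim W. v i \<in> TO.bsec (E \<circ> pi) U)"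
  proof (rule TO.echelon_frame_exists)
    show "subsheaf GG scale Basis (TO.bsec (E \<circ> pi))"
      by (rule TO.bsec_subsheaf) (simp add: subspace_E)
    show "\<exists>U s. g \<in> U \<and> s \<in> TO.bsec (E \<circ> pi) U \<and> s g = w" if "w \<in> (E \<circ> pi) g" for w
    proof -
      obtain w0 where w0: "w0 \<in> W" "w = \<rho> g w0"
        using \<open>w \<in> (E \<circ> pi) g\<close> E[OF g] by auto
      \<comment> \<open>The orbit section through w0: its coordinates are matrix coefficients, and
        its value at x lies in \<rho> x W, the fibre of E at pi x.\<close>
      let ?s = "cut (carrier G) (\<lambda>x. \<rho> x w0)"
      have "openin (topo GG) (carrier G)"
        using openin_topspace[of "topo GG"] by simp
      moreover have "(\<lambda>x. coord b (?s x)) = matrix_coeff b w0" for b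
        by (auto simp: matrix_coeff_def cut_def)
      ultimately have "?s \<in> TO.bsec (E \<circ> pi) (carrier G)"
        using w0 by (auto simp: bundle_sections_def TO.triv_iff E regf_GG matrix_coeff_in)
      then show ?thesis
        using w0 g by (intro exI[of _ "carrier G"] exI[of _ ?s]) simp
    qed
  qed (use g in \<open>auto simp: subspace_E dim_E\<close>)
  then show "\<exists>U bb v. g \<in> U \<and> echelon_frame GG scale Basis (E \<circ> pi) U (dim W) bb v"
    by blast
qed

text \<open>Two points of N with the same image under pi have the same fibre of E, hence the same
  vector with prescribed pivot coordinates (\<open>canon\<close>). So the frame descends to the
  image of N, although pi may have no local section there.\<close>

lemma vector_subbundle_XX: "vector_subbundle XX scale Basis E (dim W)"
  unfolding vector_subbundle_def
proof (intro ballI conjI)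
  fix x0 assume "x0 \<in> topspace (topo XX)"
  then obtain g0 where g0: "g0 \<in> carrier G" "x0 = pi g0"
    by (auto simp: topspace_XX)
  show "subspace (E x0)" "dim (E x0) = dim W"
    using subspace_E dim_E g0 by auto
  let ?d = "dim W"
  obtain N bb v where N: "g0 \<in> N" and fr: "echelon_frame GG scale Basis (E \<circ> pi) N ?d bb v"
    using vector_subbundle_GG g0 by (auto simp: vector_subbundle_def)
  have oN: "openin (topo GG) N" and v: "\<And>i. i < ?d \<Longrightarrow> bb i \<in> Basis \<and> v i \<in> TO.bsec (E \<circ> pi) N"
    and delta: "\<And>y i l. y \<in> N \<Longrightarrow> i < ?d \<Longrightarrow> l < ?d \<Longrightarrow> coord (bb l) (v i y) = (if i = l then 1 else 0)"
    and ex: "\<And>y e. y \<in> N \<Longrightarrow> e \<in> E (pi y) \<Longrightarrow> e = (\<Sum>i<?d. scale (coord (bb i) e) (v i y))"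
    using fr by (auto simp: echelon_frame_def)
  have NG: "N \<subseteq> carrier G"
    using openin_subset[OF oN] by simp
  have vE: "v i y \<in> E (pi y)" if "i < ?d" "y \<in> N" for i y
    using v[OF that(1)] that oN by (simp add: bundle_sections_def)
  have vt: "v i \<in> TO.triv N" if "i < ?d" for i
    using v[OF that(1)] oN by (simp add: bundle_sections_def)
  have canon: "v i n = v i n'" if i: "i < ?d" and n: "n \<in> N" "n' \<in> N" "pi n = pi n'" for i n n'
  proof -
    have "v i n = (\<Sum>l<?d. scale (coord (bb l) (v i n)) (v l n'))"
      by (rule ex) (use n vE[OF i n(1)] in simp_all)
    also have "\<dots> = (\<Sum>l<?d. if l = i then v l n' else 0)"
      using delta[OF n(1) i] by (intro sum.cong) auto
    finally show ?thesis
      using i by simp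
  qed
  define U where "U = pi ` N"
  \<comment> \<open>Any preimage in N may be chosen: by \<open>canon\<close> the value does not
    depend on it, and the choice itself carries no regularity.\<close>
  define e where "e i = cut U (\<lambda>x. v i (SOME n. n \<in> N \<and> pi n = x))" for i
  have e: "e i (pi n) = v i n" if i: "i < ?d" and n: "n \<in> N" for i n
  proof -
    define n' where "n' = (SOME n'. n' \<in> N \<and> pi n' = pi n)"
    have n': "n' \<in> N \<and> pi n' = pi n"
      unfolding n'_def by (rule someI[where P = "\<lambda>n'. n' \<in> N \<and> pi n' = pi n"]) (use n in simp)
    have "e i (pi n) = v i n'"
      using n by (simp add: e_def U_def n'_def)
    also have "\<dots> = v i n"
      using n' by (intro canon[OF i _ n]) blast+
    finally show ?thesis .
  qed
  \<comment> \<open>Nh h is the right translate N h. The full preimage of U is the union of these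
    translates over H, which shows that U is open.\<close>
  define Nh where "Nh h = preim (topo GG) (\<lambda>x. x \<otimes> inv h) N" for h
  have oNh: "openin (topo GG) (Nh h)" if "h \<in> H" for h
    unfolding Nh_def using that by (intro fs_morphismD(1)[OF fs_morphism_rtranslation oN]) (simp add: H_carrier)
  have NhI: "\<exists>h\<in>H. g \<in> Nh h" if g: "g \<in> carrier G" and gU: "pi g \<in> U" for g
  proof -
    obtain n where n: "n \<in> N" "pi g = pi n"
      using gU by (auto simp: U_def)
    then have "g \<in> n <# H"
      using pi_eqD[OF g _ n(2)] self_coset[OF g] NG by auto
    then obtain h where h: "h \<in> H" "g = n \<otimes> h"
      by (auto simp: mem_coset)
    then have "g \<otimes> inv h = n"
      using n NG by (auto simp: grp.m_assoc H_carrier)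
    then show ?thesis
      using h n g by (intro bexI[of _ h]) (simp_all add: Nh_def preim_def)
  qed
  have Nh_pi: "g \<otimes> inv h \<in> N \<and> pi (g \<otimes> inv h) = pi g \<and> g \<in> carrier G" if "h \<in> H" "g \<in> Nh h" for g h
    using that by (auto simp: Nh_def preim_def pi_H H_inv)
  have ppU: "ppi U = (\<Union>h\<in>H. Nh h)"
  proof (intro equalityI subsetI)
    fix g assume "g \<in> (\<Union>h\<in>H. Nh h)"
    then obtain h where h: "h \<in> H" "g \<in> Nh h"
      by blast
    from Nh_pi[OF h] have "pi g \<in> U"
      unfolding U_def by (metis imageI)
    then show "g \<in> ppi U"
      using Nh_pi[OF h] by (simp add: preim_def)
  qed (use NhI in \<open>auto simp: preim_def\<close>)
  have oU: "openin (topo XX) U"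
    unfolding openin_XX ppU using NG oNh by (auto simp: U_def)
  have opU: "openin (topo GG) (ppi U)"
    using oU openin_XX by blast
  have et: "e i \<in> TX.triv U" if i: "i < ?d" for i
    unfolding triv_XX[OF oU]
  proof (intro conjI allI impI)
    show "cut (ppi U) (e i \<circ> pi) \<in> TO.triv (ppi U)"
    proof (rule TO.triv_local[OF opU])
      fix g assume g: "g \<in> ppi U"
      then obtain h where h: "h \<in> H" "g \<in> Nh h"
        unfolding ppU by blast
      \<comment> \<open>On Nh h the pull-back of e i is v i composed with a right translation, which
        is a morphism of G; regularity is then a local matter.\<close>
      let ?t = "cut (Nh h) (v i \<circ> (\<lambda>x. x \<otimes> inv h))"
      have m: "fs_morphism GG GG (\<lambda>x. x \<otimes> inv h)"
        using h by (intro fs_morphism_rtranslation) (simp add: H_carrier)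
      interpret bundle_morphism scale Basis GG GG "\<lambda>x. x \<otimes> inv h"
        by unfold_locales (rule m)
      have "?t \<in> TO.triv (Nh h)"
        using triv_pullback[OF oN vt[OF i]] by (simp add: Nh_def)
      moreover have "cut (ppi U) (e i \<circ> pi) y = ?t y" if "y \<in> Nh h \<inter> ppi U" for y
      proof -
        have "y \<otimes> inv h \<in> N" "pi (y \<otimes> inv h) = pi y"
          using Nh_pi[OF h(1), of y] that by simp_all
        then have "e i (pi y) = v i (y \<otimes> inv h)"
          using e[OF i, of "y \<otimes> inv h"] by simp
        then show ?thesis
          using that by simp
      qed
      ultimately show "\<exists>V t. openin (topo GG) V \<and> g \<in> V \<and> t \<in> TO.triv V \<and>
          (\<forall>y\<in>V \<inter> ppi U. cut (ppi U) (e i \<circ> pi) y = t y)"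
        using oNh[OF h(1)] h(2) by blast
    qed simp
  qed (simp add: e_def)
  have "echelon_frame XX scale Basis E U ?d bb e"
    unfolding echelon_frame_def
  proof (intro conjI allI impI ballI oU)
    fix i assume i: "i < ?d"
    show "bb i \<in> Basis"
      using v[OF i] by simp
    show "e i \<in> TX.bsec E U"
      using oU et[OF i] vE[OF i] e[OF i] by (auto simp: bundle_sections_def U_def)
  next
    fix y i l assume "y \<in> U" "i < ?d" "l < ?d"
    then show "coord (bb l) (e i y) = (if i = l then 1 else 0)"
      using e delta by (auto simp: U_def)
  next
    fix y w assume "y \<in> U" "w \<in> E y"
    then obtain n where n: "n \<in> N" "w \<in> E (pi n)" "y = pi n"
      by (auto simp: U_def)
    have "w = (\<Sum>i<?d. scale (coord (bb i) w) (v i n))"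
      by (rule ex[OF n(1,2)])
    also have "\<dots> = (\<Sum>i<?d. scale (coord (bb i) w) (e i y))"
      using n e by simp
    finally show "w = (\<Sum>i<?d. scale (coord (bb i) w) (e i y))" .
  qed
  moreover have "x0 \<in> U"
    using g0 N by (simp add: U_def)
  ultimately show "\<exists>U bb v. x0 \<in> U \<and> echelon_frame XX scale Basis E U ?d bb v"
    by blast
qed

end

section \<open>Image and kernel sheaves on the frame space\<close>

lemma sum_fun_apply: "(\<Sum>i\<in>I. f i) x = (\<Sum>i\<in>I. f i x)"
  by (induction I rule: infinite_finite_induct) auto

lemma linear_zero_apply: "Vector_Spaces.linear s1 s2 f \<Longrightarrow> f 0 = 0"
  by (simp add: Vector_Spaces.linear_iff_module_hom module_hom.zero)

lemma linear_funpow: "Vector_Spaces.linear s s f \<Longrightarrow> Vector_Spaces.linear s s (f ^^ n)"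
proof (induction n)
  case 0
  then show ?case
    using vector_space.linear_id[of s] by (simp add: Vector_Spaces.linear_def id_def)
next
  case (Suc n)
  then show ?case
    using Vector_Spaces.linear_compose[of s s "f ^^ n" s f] by (simp add: comp_def)
qed

lemma (in trivial_bundle) triv_linear:
  assumes L: "Vector_Spaces.linear scale scale L" and U: "openin (topo Y) U" and t: "t \<in> triv U"
  shows "(\<lambda>x. L (t x)) \<in> triv U"
  unfolding triv_iff
proof
  fix c
  interpret L: module_hom scale scale L
    using L by (simp add: Vector_Spaces.linear_iff_module_hom)
  have "coord c (L (t x)) = (\<Sum>b\<in>Basis. coord c (L b) * coord b (t x))" for x
  proof -
    have "L (t x) = L (\<Sum>b\<in>Basis. scale (coord b (t x)) b)"
      by (simp add: sum_coord)
    then show ?thesis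
      by (simp add: L.sum L.scale mult.commute)
  qed
  moreover have "(\<lambda>x. \<Sum>b\<in>Basis. coord c (L b) * coord b (t x)) \<in> regf Y U"
    using t by (intro regf_sum U regf_cmult) (simp_all add: triv_iff)
  ultimately show "(\<lambda>x. coord c (L (t x))) \<in> regf Y U"
    by simp
qed

context elementary_orbit
begin

lemma Lie_span: "Lie G A = op.span B" and finite_B: "finite B" and independent_B: "\<not> op.dependent B"
  using B by (auto simp: lie_basis_def)

lemma B_Lie: "b \<in> B \<Longrightarrow> b \<in> Lie G A"
  unfolding Lie_span by (rule op.span_base)

lemma YY_D:
  assumes "z \<in> topspace (topo YY)"
  shows "z \<in> tuples G A r" "s < r \<Longrightarrow> z s \<in> Lie G A" "s < r \<Longrightarrow> t < r \<Longrightarrow> bracket (z s) (z t) = 0"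
    "span_map r z \<in> X" "span_map r z \<subseteq> Lie G A"
proof -
  show z: "z \<in> tuples G A r" "s < r \<Longrightarrow> t < r \<Longrightarrow> bracket (z s) (z t) = 0" "span_map r z \<in> X" for s t
    using assms by (auto simp: topspace_frame_space elem_frames_def frames_def)
  show zL: "s < r \<Longrightarrow> z s \<in> Lie G A" for s
    using z(1) by (auto simp: tuples_def)
  show "span_map r z \<subseteq> Lie G A"
    unfolding span_map_def Lie_span by (intro op.span_minimal op.subspace_span) (use zL Lie_span in auto)
qed

text \<open>Any frame of a point Ad(g) \<epsilon> of X consists of conjugates of elements of
  \<epsilon>, so its members commute and have vanishing p-th powers. Restricting to elementary
  frames therefore loses no point of X.\<close>

lemma span_map_surj: "span_map r ` topspace (topo YY) = topspace (topo XX)"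
proof (intro equalityI subsetI)
  fix x assume "x \<in> span_map r ` topspace (topo YY)"
  then show "x \<in> topspace (topo XX)"
    using fs_morphismD(3)[OF fs_morphism_span_map] by auto
next
  fix x assume "x \<in> topspace (topo XX)"
  then obtain z g where z: "z \<in> frames G A r" "x = span_map r z" and x: "x \<in> X"
    and g: "g \<in> carrier G" "x = Ad G A g ` \<epsilon>"
    by (auto simp: topspace_base_space orbit_def)
  have "\<exists>D\<in>\<epsilon>. z s = Ad G A g D" if "s < r" for s
  proof -
    have "z s \<in> span_map r z"
      unfolding span_map_def using that by (intro op.span_base) auto
    then show ?thesis
      using z(2) g(2) by auto
  qed
  then obtain D where D: "\<And>s. s < r \<Longrightarrow> D s \<in> \<epsilon> \<and> z s = Ad G A g (D s)"
    by metis
  have DL: "D s \<in> Lie G A" if "s < r" for s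
    using D[OF that] eps_Lie by auto
  have "bracket (z s) (z t) = 0" if "s < r" "t < r" for s t
    using D[OF that(1)] D[OF that(2)] bracket_Ad[OF DL[OF that(1)] DL[OF that(2)] g(1)] eps
    by (simp add: elem_subalgs_def)
  moreover have "p_op (z s) = 0" if "s < r" for s
    using D[OF that] p_op_Ad[OF DL[OF that] g(1) char] eps by (simp add: elem_subalgs_def)
  ultimately have "z \<in> topspace (topo YY)"
    using z x by (simp add: topspace_frame_space elem_frames_def)
  then show "x \<in> span_map r ` topspace (topo YY)"
    using z by blast
qed

text \<open>\<open>theta\<close> is linear over functions, so it acts at each point z by an operator
  on M. On tuples this is the action of z s, and the basis B disappears
  (\<open>theta_op_act\<close>).\<close>

definition theta_op :: "(nat \<Rightarrow> ('g, 'k) oper) \<Rightarrow> nat \<Rightarrow> 'm \<Rightarrow> 'm" where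
  "theta_op z s m = (\<Sum>b\<in>B. scale (coordY B b s z) (act b m))"

definition theta_mono :: "(nat \<Rightarrow> ('g, 'k) oper) \<Rightarrow> (nat \<Rightarrow> nat) \<Rightarrow> 'm \<Rightarrow> 'm" where
  "theta_mono z J = foldr (\<lambda>s. theta_op z s ^^ J s) [0..<r]"

abbreviation "Theta \<equiv> theta scale act B"
abbreviation "ThM \<equiv> theta_monomial scale act B r"

lemma theta_apply: "Theta s t z = theta_op z s (t z)"
  by (simp add: theta_def theta_op_def)

lemma theta_funpow_apply: "(Theta s ^^ n) t z = (theta_op z s ^^ n) (t z)"
  by (induction n) (simp_all add: theta_apply)

lemma theta_monomial_apply: "ThM J t z = theta_mono z J (t z)"
proof -
  have "foldr (\<lambda>s. Theta s ^^ J s) xs t z = foldr (\<lambda>s. theta_op z s ^^ J s) xs (t z)" for xs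
    by (induction xs) (simp_all add: theta_funpow_apply)
  then show ?thesis
    by (simp add: theta_monomial_def theta_mono_def)
qed

lemma theta_op_linear: "Vector_Spaces.linear scale scale (theta_op z s)"
  by unfold_locales
    (simp_all add: theta_op_def act_add act_scale invariant_operator_Lie B_Lie scale_right_distrib
      sum.distrib scale_sum_right mult.commute)

lemma theta_mono_linear: "Vector_Spaces.linear scale scale (theta_mono z J)"
proof -
  have "Vector_Spaces.linear scale scale (foldr (\<lambda>s. theta_op z s ^^ J s) xs)" for xs
  proof (induction xs)
    case Nil
    then show ?case
      by (simp add: id_def linear_ident)
  next
    case (Cons s xs)
    then show ?case
      using Vector_Spaces.linear_compose[of scale scale "foldr (\<lambda>s. theta_op z s ^^ J s) xs" scale
          "theta_op z s ^^ J s"] linear_funpow[OF theta_op_linear]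
      by (simp add: comp_def)
  qed
  then show ?thesis
    by (simp add: theta_mono_def)
qed

lemma theta_mono_simps [simp]:
  "theta_mono z J 0 = 0" "theta_mono z J (v + w) = theta_mono z J v + theta_mono z J w"
  "theta_mono z J (scale c v) = scale c (theta_mono z J v)"
proof -
  have h: "module_hom scale scale (theta_mono z J)"
    using theta_mono_linear by (simp add: Vector_Spaces.linear_iff_module_hom)
  show "theta_mono z J 0 = 0" "theta_mono z J (v + w) = theta_mono z J v + theta_mono z J w"
    "theta_mono z J (scale c v) = scale c (theta_mono z J v)"
    using module_hom.zero[OF h] module_hom.add[OF h] module_hom.scale[OF h] by auto
qed

lemma theta_op_act:
  assumes "z \<in> tuples G A r" "s < r"
  shows "theta_op z s m = act (z s) m"
proof -
  have zs: "z s \<in> op.span B"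
    using assms by (auto simp: tuples_def Lie_span)
  have "act (\<Sum>b\<in>K. oscale (c b) b) m = (\<Sum>b\<in>K. scale (c b) (act b m))" for K c
    by (induction K rule: infinite_finite_induct)
      (simp_all only: sum.empty sum.infinite sum.insert act_op_0 act_op_add act_op_scale not_False_eq_True)
  from this[of "op.representation B (z s)" B] show ?thesis
    using op.sum_representation_eq[OF independent_B zs finite_B subset_refl]
    by (simp add: theta_op_def coordY_def)
qed

lemma theta_mono_frame:
  assumes "z \<in> tuples G A r"
  shows "theta_mono z J = frame_monomial z r J"
proof -
  have "theta_op z s = act (z s)" if "s < r" for s
    using theta_op_act[OF assms that] by auto
  then show ?thesis
    unfolding theta_mono_def frame_monomial_def by (intro ext foldr_cong) auto
qed

text \<open>Identifies the fibres at z of image and kernel; they depend on z only through its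
  span.\<close>

lemma words_YY:
  assumes z: "z \<in> topspace (topo YY)"
  shows "Radw (span_map r z) j = span {theta_mono z J m |J m. J \<in> multi_indices r j}"
    and "Socw (span_map r z) j = {m. \<forall>J\<in>multi_indices r j. theta_mono z J m = 0}"
  unfolding theta_mono_frame[OF YY_D(1)[OF z]]
  by (rule Radw_span_map; rule YY_D[OF z]; assumption)+

lemma regf_coordY:
  assumes b: "b \<in> B" and s: "s < r" and W: "openin (topo YY) W"
  shows "cut W (coordY B b s) \<in> regf YY W"
proof -
  let ?T = "tuple_space G A B r" and ?f = "cut (tuples G A r) (coordY B b s)"
  have "?f \<in> regf ?T (tuples G A r)"
    unfolding tuple_space_def using b s
    by (intro regf_affine_space_top function_algebra_fun_alg fun_alg.gen) auto
  moreover have "openin (topo ?T) (tuples G A r)"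
    using openin_topspace[of "topo ?T"] by (simp add: topspace_tuple_space)
  moreover have "fs_morphism YY ?T id"
    unfolding frame_space_def by (intro fs_morphism_sub_space function_space_tuple_space)
  ultimately have "cut (preim (topo YY) id (tuples G A r)) (?f \<circ> id) \<in> regf YY (preim (topo YY) id (tuples G A r))"
    by (intro fs_morphismD(2))
  moreover have "preim (topo YY) id (tuples G A r) = topspace (topo YY)"
    using YY_D(1) by (auto simp: preim_def)
  ultimately have "cut (topspace (topo YY)) ?f \<in> regf YY (topspace (topo YY))"
    by simp
  moreover have WT: "W \<subseteq> topspace (topo YY)"
    by (rule openin_subset[OF W])
  ultimately have "cut W (cut (topspace (topo YY)) ?f) \<in> regf YY W"
    using YY.regf_cut[OF openin_topspace] W by blast
  moreover have "cut W (cut (topspace (topo YY)) ?f) = cut W (coordY B b s)"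
    using WT YY_D(1) by (auto simp: cut_def fun_eq_iff)
  ultimately show ?thesis
    by simp
qed

lemma theta_triv:
  assumes s: "s < r" and W: "openin (topo YY) W" and t: "t \<in> TY.triv W"
  shows "Theta s t \<in> TY.triv W"
proof -
  have "(\<lambda>x. \<Sum>b\<in>B. scale (cut W (coordY B b s) x) (act b (t x))) \<in> TY.triv W"
  proof (rule TY.triv_sum[OF W])
    fix b assume b: "b \<in> B"
    have "(\<lambda>x. act b (t x)) \<in> TY.triv W"
      by (rule TY.triv_linear[OF act_linear[OF invariant_operator_Lie[OF B_Lie[OF b]]] W t])
    then show "(\<lambda>x. scale (cut W (coordY B b s) x) (act b (t x))) \<in> TY.triv W"
      by (rule TY.triv_smult[OF W regf_coordY[OF b s W]])
  qed
  \<comment> \<open>Outside W both sides vanish with t, so the coordinate functions may be cut to W,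
    where they are regular.\<close>
  moreover have "Theta s t = (\<lambda>x. \<Sum>b\<in>B. scale (cut W (coordY B b s) x) (act b (t x)))"
  proof
    fix x show "Theta s t x = (\<Sum>b\<in>B. scale (cut W (coordY B b s) x) (act b (t x)))"
    proof (cases "x \<in> W")
      case False
      then have "t x = 0"
        by (rule TY.triv_out[OF t])
      then show ?thesis
        using False linear_zero_apply[OF theta_op_linear] by (simp add: theta_apply)
    qed (simp add: theta_def)
  qed
  ultimately show ?thesis
    by simp
qed

lemma theta_monomial_triv:
  assumes W: "openin (topo YY) W" and t: "t \<in> TY.triv W"
  shows "ThM J t \<in> TY.triv W"
proof -
  have "(Theta s ^^ n) u \<in> TY.triv W" if "s < r" "u \<in> TY.triv W" for s n u
    using that by (induction n) (auto intro: theta_triv W)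
  then have "foldr (\<lambda>s. Theta s ^^ J s) xs t \<in> TY.triv W" if "set xs \<subseteq> {..<r}" for xs
    using that by (induction xs) (auto simp: t)
  from this[of "[0..<r]"] show ?thesis
    by (simp add: theta_monomial_def atLeast0LessThan)
qed

section \<open>The two sheaves as sections of a family of subspaces\<close>

abbreviation "imF \<equiv> im_frames YY scale Basis act B r"
abbreviation "kerF \<equiv> ker_frames YY scale Basis act B r"

text \<open>Vanishing under operators that act point by point is itself a pointwise condition, so no
  frames are involved; the image needs more (\<open>imF_eq\<close>).\<close>

lemma kerF_eq: "kerF j = TY.bsec ((\<lambda>x. Socw x j) \<circ> span_map r)"
proof
  fix V show "kerF j V = TY.bsec ((\<lambda>x. Socw x j) \<circ> span_map r) V"
  proof (cases "openin (topo YY) V")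
    case V: True
    have "(\<forall>J\<in>multi_indices r j. ThM J s = 0) \<longleftrightarrow> (\<forall>z\<in>V. s z \<in> Socw (span_map r z) j)"
      if s: "s \<in> TY.triv V" for s
    proof -
      have Soc: "s z \<in> Socw (span_map r z) j \<longleftrightarrow> (\<forall>J\<in>multi_indices r j. ThM J s z = 0)" if "z \<in> V" for z
      proof -
        have z: "z \<in> topspace (topo YY)"
          using that openin_subset[OF V] by auto
        show ?thesis
          unfolding words_YY(2)[OF z] theta_monomial_apply by simp
      qed
      have "ThM J s z = 0" if "z \<notin> V" for J z
        using TY.triv_out[OF s that] by (simp add: theta_monomial_apply)
      then show ?thesis
        using Soc by (fastforce simp: fun_eq_iff)
    qed
    then show ?thesis
      using V by (auto simp: ker_frames_def bundle_sections_def)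
  qed (simp add: ker_frames_def bundle_sections_def)
qed

lemma imF_iff:
  assumes V: "openin (topo YY) V"
  shows "s \<in> imF j V \<longleftrightarrow> s \<in> TY.triv V \<and> (\<forall>x\<in>V. \<exists>W t. openin (topo YY) W \<and> x \<in> W \<and> W \<subseteq> V \<and>
        (\<forall>J\<in>multi_indices r j. t J \<in> TY.triv W) \<and>
        (\<forall>z\<in>W. s z = (\<Sum>J\<in>multi_indices r j. theta_mono z J (t J z))))"
proof -
  have "cut W s = (\<Sum>J\<in>multi_indices r j. ThM J (t J)) \<longleftrightarrow>
      (\<forall>z\<in>W. s z = (\<Sum>J\<in>multi_indices r j. theta_mono z J (t J z)))"
    if "\<forall>J\<in>multi_indices r j. t J \<in> TY.triv W" for W t
  proof -
    have "(\<Sum>J\<in>multi_indices r j. theta_mono z J (t J z)) = 0" if "z \<notin> W" for z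
    proof (intro sum.neutral ballI)
      fix J assume "J \<in> multi_indices r j"
      then have "t J z = 0"
        using \<open>\<forall>J\<in>multi_indices r j. t J \<in> TY.triv W\<close> \<open>z \<notin> W\<close> TY.triv_out by blast
      then show "theta_mono z J (t J z) = 0"
        by simp
    qed
    then show ?thesis
      by (auto simp: fun_eq_iff sum_fun_apply theta_monomial_apply cut_def)
  qed
  then show ?thesis
    using V unfolding im_frames_def by (auto cong: conj_cong)
qed

lemma imF_subsheaf: "subsheaf YY scale Basis (imF j)"
  unfolding subsheaf_def
proof (intro conjI allI impI ballI)
  let ?MI = "multi_indices r j"
  fix U assume U: "openin (topo YY) U"
  show "imF j U \<subseteq> TY.triv U"
    using U by (auto simp: im_frames_def)
  show "0 \<in> imF j U"
    unfolding imF_iff[OF U]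
  proof (intro conjI ballI)
    fix x assume "x \<in> U"
    then show "\<exists>W t. openin (topo YY) W \<and> x \<in> W \<and> W \<subseteq> U \<and> (\<forall>J\<in>?MI. t J \<in> TY.triv W) \<and>
        (\<forall>z\<in>W. 0 z = (\<Sum>J\<in>?MI. theta_mono z J (t J z)))"
      using U by (intro exI[of _ U] exI[of _ "\<lambda>_. 0"]) (simp add: TY.triv_0)
  qed (rule TY.triv_0[OF U])
  show "s + s' \<in> imF j U" if s: "s \<in> imF j U" and s': "s' \<in> imF j U" for s s'
    unfolding imF_iff[OF U]
  proof (intro conjI ballI)
    show "s + s' \<in> TY.triv U"
      using s s' U by (intro TY.triv_add) (auto simp: imF_iff)
    fix x assume x: "x \<in> U"
    obtain W t where W: "openin (topo YY) W" "x \<in> W" "W \<subseteq> U" "\<forall>J\<in>?MI. t J \<in> TY.triv W"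
      "\<forall>z\<in>W. s z = (\<Sum>J\<in>?MI. theta_mono z J (t J z))"
      using s x unfolding imF_iff[OF U] by blast
    obtain W' t' where W': "openin (topo YY) W'" "x \<in> W'" "W' \<subseteq> U" "\<forall>J\<in>?MI. t' J \<in> TY.triv W'"
      "\<forall>z\<in>W'. s' z = (\<Sum>J\<in>?MI. theta_mono z J (t' J z))"
      using s' x unfolding imF_iff[OF U] by blast
    have "cut (W \<inter> W') (t J) + cut (W \<inter> W') (t' J) \<in> TY.triv (W \<inter> W')" if "J \<in> ?MI" for J
      using W W' that by (intro TY.triv_add TY.triv_cut[of W] TY.triv_cut[of W']) auto
    then show "\<exists>W t. openin (topo YY) W \<and> x \<in> W \<and> W \<subseteq> U \<and> (\<forall>J\<in>?MI. t J \<in> TY.triv W) \<and>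
        (\<forall>z\<in>W. (s + s') z = (\<Sum>J\<in>?MI. theta_mono z J (t J z)))"
      using W W'
      by (intro exI[of _ "W \<inter> W'"] exI[of _ "\<lambda>J. cut (W \<inter> W') (t J) + cut (W \<inter> W') (t' J)"])
        (auto simp: sum.distrib)
  qed
  show "(\<lambda>x. scale (f x) (s x)) \<in> imF j U" if f: "f \<in> regf YY U" and s: "s \<in> imF j U" for f s
    unfolding imF_iff[OF U]
  proof (intro conjI ballI)
    show "(\<lambda>x. scale (f x) (s x)) \<in> TY.triv U"
      using s f U by (intro TY.triv_smult) (auto simp: imF_iff)
    fix x assume x: "x \<in> U"
    obtain W t where W: "openin (topo YY) W" "x \<in> W" "W \<subseteq> U" "\<forall>J\<in>?MI. t J \<in> TY.triv W"
      "\<forall>z\<in>W. s z = (\<Sum>J\<in>?MI. theta_mono z J (t J z))"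
      using s x unfolding imF_iff[OF U] by blast
    have "(\<lambda>x. scale (cut W f x) (t J x)) \<in> TY.triv W" if "J \<in> ?MI" for J
      using W that f U by (intro TY.triv_smult YY.regf_cut[of U]) auto
    then show "\<exists>W t. openin (topo YY) W \<and> x \<in> W \<and> W \<subseteq> U \<and> (\<forall>J\<in>?MI. t J \<in> TY.triv W) \<and>
        (\<forall>z\<in>W. scale (f z) (s z) = (\<Sum>J\<in>?MI. theta_mono z J (t J z)))"
      using W by (intro exI[of _ W] exI[of _ "\<lambda>J x. scale (cut W f x) (t J x)"])
        (auto simp: scale_sum_right)
  qed
  show "cut V s \<in> imF j V" if V: "openin (topo YY) V \<and> V \<subseteq> U" and s: "s \<in> imF j U" for V s
  proof -
    have oV: "openin (topo YY) V" "V \<subseteq> U"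
      using V by auto
    show ?thesis
      unfolding imF_iff[OF oV(1)]
    proof (intro conjI ballI)
      show "cut V s \<in> TY.triv V"
        using s oV U by (intro TY.triv_cut[of U]) (auto simp: imF_iff)
      fix x assume x: "x \<in> V"
      then have xU: "x \<in> U"
        using oV by auto
      obtain W t where W: "openin (topo YY) W" "x \<in> W" "W \<subseteq> U" "\<forall>J\<in>?MI. t J \<in> TY.triv W"
        "\<forall>z\<in>W. s z = (\<Sum>J\<in>?MI. theta_mono z J (t J z))"
        using s xU unfolding imF_iff[OF U] by blast
      have "cut (W \<inter> V) (t J) \<in> TY.triv (W \<inter> V)" if "J \<in> ?MI" for J
        using W that oV by (intro TY.triv_cut[of W]) auto
      then show "\<exists>W t. openin (topo YY) W \<and> x \<in> W \<and> W \<subseteq> V \<and> (\<forall>J\<in>?MI. t J \<in> TY.triv W) \<and>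
          (\<forall>z\<in>W. cut V s z = (\<Sum>J\<in>?MI. theta_mono z J (t J z)))"
        using W oV x by (intro exI[of _ "W \<inter> V"] exI[of _ "\<lambda>J. cut (W \<inter> V) (t J)"]) auto
    qed
  qed
  show "s \<in> imF j U" if s: "s \<in> TY.triv U"
    and loc: "\<forall>x\<in>U. \<exists>V. openin (topo YY) V \<and> x \<in> V \<and> V \<subseteq> U \<and> cut V s \<in> imF j V" for s
    unfolding imF_iff[OF U]
  proof (intro conjI ballI s)
    fix x assume "x \<in> U"
    from bspec[OF loc this] obtain V where V: "openin (topo YY) V" "x \<in> V" "V \<subseteq> U" "cut V s \<in> imF j V"
      by blast
    obtain W t where W: "openin (topo YY) W" "x \<in> W" "W \<subseteq> V" "\<forall>J\<in>?MI. t J \<in> TY.triv W"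
      "\<forall>z\<in>W. cut V s z = (\<Sum>J\<in>?MI. theta_mono z J (t J z))"
      using V(2,4) unfolding imF_iff[OF V(1)] by blast
    have "\<forall>z\<in>W. s z = (\<Sum>J\<in>?MI. theta_mono z J (t J z))"
    proof
      fix z assume "z \<in> W"
      then have "z \<in> V" "cut V s z = (\<Sum>J\<in>?MI. theta_mono z J (t J z))"
        using W(3,5) by blast+
      then show "s z = (\<Sum>J\<in>?MI. theta_mono z J (t J z))"
        by simp
    qed
    then show "\<exists>W t. openin (topo YY) W \<and> x \<in> W \<and> W \<subseteq> U \<and> (\<forall>J\<in>?MI. t J \<in> TY.triv W) \<and>
        (\<forall>z\<in>W. s z = (\<Sum>J\<in>?MI. theta_mono z J (t J z)))"
      using W(1,2,4) order_trans[OF W(3) V(3)] by (intro exI[of _ W] exI[of _ t] conjI)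
  qed
qed (simp add: im_frames_def)

lemma homogeneous_Rad: "homogeneous_bundle scale Basis G A \<rho> B \<epsilon> r (\<lambda>x. Radw x j) (Radw \<epsilon> j)"
  by unfold_locales (simp_all add: subspace_Radw pi_eq Radw_Ad[OF eps_Lie])

lemma homogeneous_Soc: "homogeneous_bundle scale Basis G A \<rho> B \<epsilon> r (\<lambda>x. Socw x j) (Socw \<epsilon> j)"
  by unfold_locales (simp_all add: subspace_Socw[OF eps_Lie] pi_eq Socw_Ad[OF eps_Lie])

text \<open>Membership in the image asks for regular preimages near each point, which values alone
  do not provide. The gap is closed by \<open>subsheaf_eq_bsec\<close>: the values fill the fibres,
  and the dimension of the fibres is constant because they are translates of one layer.\<close>

lemma imF_eq: "imF j = TY.bsec ((\<lambda>x. Radw x j) \<circ> span_map r)"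
proof (rule TY.subsheaf_eq_bsec[OF imF_subsheaf])
  let ?MI = "multi_indices r j"
  interpret hb: homogeneous_bundle scale Basis G A \<rho> B \<epsilon> r "\<lambda>x. Radw x j" "Radw \<epsilon> j"
    by (rule homogeneous_Rad)
  note Rad = words_YY(1)
  show "imF j U \<subseteq> TY.bsec ((\<lambda>x. Radw x j) \<circ> span_map r) U" for U
  proof
    fix s assume s: "s \<in> imF j U"
    note U = TY.subsheaf_D(2)[OF imF_subsheaf s]
    have "s z \<in> Radw (span_map r z) j" if z: "z \<in> U" for z
    proof -
      obtain W t where W: "z \<in> W" "\<forall>z\<in>W. s z = (\<Sum>J\<in>?MI. theta_mono z J (t J z))"
        using s z unfolding imF_iff[OF U] by blast
      have "z \<in> topspace (topo YY)"
        using z openin_subset[OF U] by auto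
      moreover have "s z = (\<Sum>J\<in>?MI. theta_mono z J (t J z))"
        using W by blast
      moreover have "\<dots> \<in> span {theta_mono z J m |J m. J \<in> ?MI}"
        by (intro span_sum span_base) blast
      ultimately show ?thesis
        by (simp add: Rad)
    qed
    then show "s \<in> TY.bsec ((\<lambda>x. Radw x j) \<circ> span_map r) U"
      using s U by (simp add: bundle_sections_def imF_iff)
  qed
  show "subspace (((\<lambda>x. Radw x j) \<circ> span_map r) z) \<and> dim (((\<lambda>x. Radw x j) \<circ> span_map r) z) = dim (Radw \<epsilon> j)"
    if "z \<in> topspace (topo YY)" for z
  proof -
    have "span_map r z \<in> topspace (topo XX)"
      using span_map_surj that by blast
    then obtain g where "g \<in> carrier G" "span_map r z = pi g"
      by (auto simp: topspace_XX)
    then show ?thesis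
      using hb.subspace_E hb.dim_E by simp
  qed
  show "\<exists>U s. z \<in> U \<and> s \<in> imF j U \<and> s z = w"
    if z: "z \<in> topspace (topo YY)" and w: "w \<in> ((\<lambda>x. Radw x j) \<circ> span_map r) z" for z w
  proof -
    note F = imF_subsheaf[of j]
    \<comment> \<open>The values at z of sections of the image form a subspace, so it suffices to
      reach the generators \<open>theta_mono z J m\<close>.\<close>
    let ?S = "{w. \<exists>U s. z \<in> U \<and> s \<in> imF j U \<and> s z = w}"
    have T: "openin (topo YY) (topspace (topo YY))"
      by simp
    have "subspace ?S"
      unfolding subspace_def
    proof (intro conjI ballI allI)
      show "0 \<in> ?S"
        using TY.subsheaf_D(4)[OF F T] z by (intro CollectI exI[of _ "topspace (topo YY)"] exI[of _ 0]) simp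
    next
      fix v w assume "v \<in> ?S" "w \<in> ?S"
      then obtain U s U' s' where s: "z \<in> U" "s \<in> imF j U" "s z = v" and s': "z \<in> U'" "s' \<in> imF j U'" "s' z = w"
        by blast
      have o: "openin (topo YY) (U \<inter> U')"
        using TY.subsheaf_D(2)[OF F s(2)] TY.subsheaf_D(2)[OF F s'(2)] by auto
      have "(\<lambda>x. cut (U \<inter> U') s x + cut (U \<inter> U') s' x) \<in> imF j (U \<inter> U')"
        using TY.subsheaf_D(7)[OF F s(2) o] TY.subsheaf_D(7)[OF F s'(2) o]
        by (intro TY.subsheaf_D(5)[OF F]) auto
      then show "v + w \<in> ?S"
        using s s' by (intro CollectI exI[of _ "U \<inter> U'"]
            exI[of _ "\<lambda>x. cut (U \<inter> U') s x + cut (U \<inter> U') s' x"]) simp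
    next
      fix c v assume "v \<in> ?S"
      then obtain U s where s: "z \<in> U" "s \<in> imF j U" "s z = v"
        by blast
      have "(\<lambda>x. scale (cut U (\<lambda>_. c) x) (s x)) \<in> imF j U"
        using TY.subsheaf_D(2)[OF F s(2)] s by (intro TY.subsheaf_D(6)[OF F] YY.regf_const)
      then show "scale c v \<in> ?S"
        using s by (intro CollectI exI[of _ U] exI[of _ "\<lambda>x. scale (cut U (\<lambda>_. c) x) (s x)"]) simp
    qed
    moreover have "theta_mono z J m \<in> ?S" if J: "J \<in> ?MI" for J m
    proof -
      let ?T = "topspace (topo YY)"
      \<comment> \<open>The generator is hit by the constant section m placed at the index
        J.\<close>
      let ?t = "\<lambda>J'. if J' = J then cut ?T (\<lambda>_. m) else 0"
      have t: "?t J' \<in> TY.triv ?T" for J'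
        by (simp add: TY.triv_const TY.triv_0)
      have eq: "(\<Sum>J'\<in>?MI. theta_mono x J' (?t J' x)) = ThM J (cut ?T (\<lambda>_. m)) x" for x
      proof -
        have "(\<Sum>J'\<in>?MI. theta_mono x J' (?t J' x)) =
            (\<Sum>J'\<in>?MI. if J' = J then theta_mono x J (cut ?T (\<lambda>_. m) x) else 0)"
          by (intro sum.cong) auto
        then show ?thesis
          using J by (simp add: finite_multi_indices theta_monomial_apply)
      qed
      have "ThM J (cut ?T (\<lambda>_. m)) \<in> imF j ?T"
        unfolding imF_iff[OF T]
      proof (intro conjI ballI)
        show "ThM J (cut ?T (\<lambda>_. m)) \<in> TY.triv ?T"
          by (intro theta_monomial_triv TY.triv_const) simp_all
        fix x assume "x \<in> ?T"
        then show "\<exists>W t. openin (topo YY) W \<and> x \<in> W \<and> W \<subseteq> ?T \<and> (\<forall>J\<in>?MI. t J \<in> TY.triv W) \<and>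
          (\<forall>z\<in>W. ThM J (cut ?T (\<lambda>_. m)) z = (\<Sum>J\<in>?MI. theta_mono z J (t J z)))"
          using t eq by (intro exI[of _ ?T] exI[of _ ?t]) simp
      qed
      then show ?thesis
        using z by (intro CollectI exI[of _ ?T] exI[of _ "ThM J (cut ?T (\<lambda>_. m))"])
          (simp add: theta_monomial_apply)
    qed
    ultimately have "span {theta_mono z J m |J m. J \<in> ?MI} \<subseteq> ?S"
      by (intro span_minimal) auto
    then show ?thesis
      using w Rad[OF z] by auto
  qed
qed

end

section \<open>Associated bundles\<close>

context homogeneous_bundle
begin

section \<open>Equivariance of the subbundle\<close>

lemma openin_translate:
  assumes U: "openin (topo XX) U" and g: "g \<in> carrier G"
  shows "ppi ((`) (Ad G A g) ` U) = preim (topo GG) (\<lambda>x. inv g \<otimes> x) (ppi U)"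
    and "openin (topo XX) ((`) (Ad G A g) ` U)"
proof -
  have U_pi: "\<exists>y\<in>carrier G. u = pi y" if "u \<in> U" for u
    using that U by (auto simp: openin_XX)
  show eq: "ppi ((`) (Ad G A g) ` U) = preim (topo GG) (\<lambda>x. inv g \<otimes> x) (ppi U)"
  proof (intro equalityI subsetI)
    fix x assume "x \<in> ppi ((`) (Ad G A g) ` U)"
    then obtain u where x: "x \<in> carrier G" and u: "u \<in> U" "pi x = Ad G A g ` u"
      by (auto simp: preim_def)
    obtain y where y: "y \<in> carrier G" "u = pi y"
      using U_pi u by blast
    have "pi (inv g \<otimes> x) = Ad G A (inv g) ` pi (g \<otimes> y)"
      using x u y g by (simp add: pi_mult)
    also have "\<dots> = u"
      using y g by (simp add: pi_mult[symmetric] grp.m_assoc[symmetric])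
    finally show "x \<in> preim (topo GG) (\<lambda>x. inv g \<otimes> x) (ppi U)"
      using u x g by (simp add: preim_def)
  next
    fix x assume "x \<in> preim (topo GG) (\<lambda>x. inv g \<otimes> x) (ppi U)"
    then have x: "x \<in> carrier G" "pi (inv g \<otimes> x) \<in> U"
      by (auto simp: preim_def)
    have "pi x = pi (g \<otimes> (inv g \<otimes> x))"
      using x g by (simp add: grp.m_assoc[symmetric])
    also have "\<dots> = Ad G A g ` pi (inv g \<otimes> x)"
      using x g by (simp add: pi_mult del: image_image)
    finally show "x \<in> ppi ((`) (Ad G A g) ` U)"
      using x by (auto simp: preim_def)
  qed
  have "openin (topo GG) (ppi ((`) (Ad G A g) ` U))"
    unfolding eq using U g by (intro fs_morphismD(1)[OF fs_morphism_ltranslation]) (simp_all add: openin_XX)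
  moreover have "(`) (Ad G A g) ` U \<subseteq> pi ` carrier G"
  proof clarify
    fix u assume "u \<in> U"
    then obtain y where y: "y \<in> carrier G" "u = pi y"
      using U_pi by blast
    then have "Ad G A g ` u = pi (g \<otimes> y)"
      using g by (simp add: pi_mult)
    then show "Ad G A g ` u \<in> pi ` carrier G"
      using y g by auto
  qed
  ultimately show "openin (topo XX) ((`) (Ad G A g) ` U)"
    by (simp add: openin_XX)
qed

text \<open>After pull-back to G the translated section is s composed with a left translation,
  followed by the linear map \<rho> g. Its value at pi x lies in the image of W under \<rho> g and
  \<rho> (inv g \<otimes> x), which is the fibre \<rho> x W.\<close>

lemma triv_trans_bsec:
  assumes U: "openin (topo XX) U" and g: "g \<in> carrier G" and s: "s \<in> TX.bsec E U"
  shows "triv_trans G A \<rho> g U s \<in> TX.bsec E ((`) (Ad G A g) ` U)"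
proof -
  let ?U = "(`) (Ad G A g) ` U" and ?l = "\<lambda>x. inv g \<otimes> x"
  note oU = openin_translate[OF U g]
  have s': "cut (ppi U) (s \<circ> pi) \<in> TO.triv (ppi U)" and sE: "\<And>x. x \<in> U \<Longrightarrow> s x \<in> E x"
    using s by (auto simp: bsec_XX[OF U])
  have val: "triv_trans G A \<rho> g U s (pi x) = \<rho> g (s (pi (inv g \<otimes> x)))" and mem: "pi (inv g \<otimes> x) \<in> U"
    "x \<in> carrier G"
    if x: "x \<in> ppi ?U" for x
  proof -
    show "pi (inv g \<otimes> x) \<in> U" "x \<in> carrier G"
      using x unfolding oU(1) by (auto simp: preim_def)
    have "pi x \<in> ?U"
      using x by (simp add: preim_def)
    then show "triv_trans G A \<rho> g U s (pi x) = \<rho> g (s (pi (inv g \<otimes> x)))"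
      using \<open>x \<in> carrier G\<close> g by (simp add: triv_trans_def pi_mult)
  qed
  interpret bundle_morphism scale Basis GG GG ?l
    by unfold_locales (use g in \<open>simp add: fs_morphism_ltranslation\<close>)
  have opp: "openin (topo GG) (ppi U)"
    using U by (simp add: openin_XX)
  have "cut (ppi ?U) (cut (ppi U) (s \<circ> pi) \<circ> ?l) \<in> TO.triv (ppi ?U)"
    using triv_pullback[OF opp s'] by (simp add: oU(1))
  moreover have "openin (topo GG) (ppi ?U)"
    using oU(2) openin_XX by blast
  ultimately have "(\<lambda>x. \<rho> g (cut (ppi ?U) (cut (ppi U) (s \<circ> pi) \<circ> ?l) x)) \<in> TO.triv (ppi ?U)"
    using TO.triv_linear[OF rho_linear[OF g]] by blast
  moreover have "(\<lambda>x. \<rho> g (cut (ppi ?U) (cut (ppi U) (s \<circ> pi) \<circ> ?l) x)) =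
      cut (ppi ?U) (triv_trans G A \<rho> g U s \<circ> pi)"
  proof
    fix x show "\<rho> g (cut (ppi ?U) (cut (ppi U) (s \<circ> pi) \<circ> ?l) x) = cut (ppi ?U) (triv_trans G A \<rho> g U s \<circ> pi) x"
    proof (cases "x \<in> ppi ?U")
      case True
      then have "inv g \<otimes> x \<in> ppi U"
        using mem[OF True] g by (simp add: preim_def)
      then show ?thesis
        using True val[OF True] by simp
    qed (use g in simp)
  qed
  ultimately have "cut (ppi ?U) (triv_trans G A \<rho> g U s \<circ> pi) \<in> TO.triv (ppi ?U)"
    by simp
  moreover have "triv_trans G A \<rho> g U s y \<in> E y" if y: "y \<in> ?U" for y
  proof -
    obtain x where x: "x \<in> carrier G" "y = pi x"
      using y openin_XX[of ?U] oU(2) by auto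
    then have xp: "x \<in> ppi ?U"
      using y by (simp add: preim_def)
    have "s (pi (inv g \<otimes> x)) \<in> \<rho> (inv g \<otimes> x) ` W"
      using sE[OF mem(1)[OF xp]] x g by (simp add: E)
    then show ?thesis
      unfolding x(2) val[OF xp] E[OF x(1)] using x g by (auto simp: rho_mult)
  qed
  ultimately show ?thesis
    by (simp add: bsec_XX[OF oU(2)]) (simp add: triv_trans_def)
qed

lemma equivariant_subbundle_bsec: "equivariant_subbundle G A XX scale Basis \<rho> (TX.bsec E)"
  unfolding equivariant_subbundle_def
  by (intro conjI ballI allI impI TX.vector_subbundle_subsheaf[OF vector_subbundle_XX]
      TX.vector_subbundle_frame[OF vector_subbundle_XX] triv_trans_bsec)

text \<open>Elements of H fix the base point, and the fibre there is W itself.\<close>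

lemma H_stable: "h \<in> H \<Longrightarrow> \<rho> h ` W \<subseteq> W"
proof -
  assume h: "h \<in> H"
  have "E (pi h) = E (pi \<one>)"
    using pi_H[OF grp.one_closed h] h by (simp add: H_carrier)
  then show "\<rho> h ` W \<subseteq> W"
    using h by (simp add: E H_carrier rho_one)
qed

text \<open>The class of \<open>(x, \<rho> x\<^sup>-\<^sup>1 m)\<close>, which depends only on the coset \<open>y = x H\<close> and on \<open>m\<close>.\<close>

definition cls :: "'g set \<Rightarrow> 'm \<Rightarrow> ('g \<times> 'm) set" where
  "cls y m = (\<lambda>x. (x, \<rho> (inv x) m)) ` y"

section \<open>Points and functions of the associated bundle\<close>

abbreviation "BB \<equiv> assoc_bundle G A H scale Basis \<rho> W"
abbreviation "PP \<equiv> affine_space (carrier G \<times> W) (prod_alg G A scale Basis W)"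
abbreviation "tw \<equiv> twist G H \<rho>"
abbreviation "LL \<equiv> L_sheaf G A H scale Basis \<rho> W"

lemma topspace_CC: "topspace (topo CC) = (\<lambda>g. g <# H) ` carrier G"
  by (simp add: coset_space_def topspace_quot_space)

lemma coset_carrier: "x \<in> carrier G \<Longrightarrow> g \<in> x <# H \<Longrightarrow> g \<in> carrier G"
  by (auto simp: mem_coset H_carrier)

lemma topspace_CC_D: "y \<in> topspace (topo CC) \<Longrightarrow> y \<noteq> {} \<and> y \<subseteq> carrier G"
  using self_coset coset_carrier by (auto simp: topspace_CC)

lemma cls_value: "y \<in> topspace (topo CC) \<Longrightarrow> p \<in> cls y m \<Longrightarrow> \<rho> (fst p) (snd p) = m"
  using topspace_CC_D[of y] by (auto simp: cls_def)

lemma cls_nonempty: "y \<in> topspace (topo CC) \<Longrightarrow> cls y m \<noteq> {}"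
  using topspace_CC_D[of y] by (auto simp: cls_def)

lemma fst_cls: "fst ` cls y m = y"
  by (force simp: cls_def)

text \<open>With m = \<rho> x w the second component at x \<otimes> h is \<rho> (inv (x \<otimes>
  h)) m: a class is the graph over its coset of a function determined by m alone. This replaces
  classes by vectors of M.\<close>

lemma twist_eq:
  assumes x: "x \<in> carrier G"
  shows "tw (x, w) = cls (x <# H) (\<rho> x w)"
proof -
  have "\<rho> (inv (x \<otimes> h)) (\<rho> x w) = \<rho> (inv h) w" if "h \<in> H" for h
    using that x by (simp add: grp.inv_mult_group H_carrier rho_mult)
  then show ?thesis
    by (auto simp: twist_def cls_def l_coset_def image_iff)
qed

lemma orb_coset: "orb (x <# H) = pi x"
  by (simp add: pi_def)

lemma inj_orb: "inj_on orb (topspace (topo CC))"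
  using iso by (auto simp: fs_iso_def bij_betw_def)

lemma openin_CC: "openin (topo CC) U \<longleftrightarrow>
    U \<subseteq> topspace (topo CC) \<and> openin (topo GG) (preim (topo GG) (\<lambda>g. g <# H) U)"
  by (simp add: topspace_CC) (simp add: coset_space_def openin_quot_space)

lemma ppi_orb:
  assumes "U \<subseteq> topspace (topo CC)"
  shows "ppi (orb ` U) = preim (topo GG) (\<lambda>g. g <# H) U"
proof -
  have "orb (g <# H) \<in> orb ` U \<longleftrightarrow> g <# H \<in> U" if "g \<in> carrier G" for g
    using that assms inj_on_image_mem_iff[OF inj_orb _ assms] by (simp add: topspace_CC)
  then show ?thesis
    by (auto simp: preim_def pi_def)
qed

lemma openin_orb:
  assumes U: "openin (topo CC) U"
  shows "openin (topo XX) (orb ` U)"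
proof -
  have "U \<subseteq> topspace (topo CC)"
    using openin_subset[OF U] .
  then show ?thesis
    using U unfolding openin_XX by (auto simp: ppi_orb openin_CC topspace_CC orb_coset)
qed

lemma prod_alg_algebra: "function_algebra (carrier G \<times> W) (prod_alg G A scale Basis W)"
  unfolding prod_alg_def by (rule function_algebra_fun_alg)

lemma topspace_PP: "topspace (topo PP) = carrier G \<times> W"
  by (rule topspace_affine_space[OF prod_alg_algebra])

lemma topspace_BB: "topspace (topo BB) = tw ` (carrier G \<times> W)"
  by (simp add: assoc_bundle_def topspace_quot_space topspace_PP)

text \<open>A coordinate of the map to M that sends the class of (x, w) to \<rho> x w. All
  representatives of a class give the same vector, so the choice does not matter.\<close>

definition class_coord :: "'m \<Rightarrow> ('g \<times> 'm) set \<Rightarrow> 'k" where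
  "class_coord b = cut (topspace (topo BB)) (\<lambda>c. let p = SOME p. p \<in> c in coord b (\<rho> (fst p) (snd p)))"

lemma class_coord_cls:
  assumes y: "y \<in> topspace (topo CC)" and c: "cls y m \<in> topspace (topo BB)"
  shows "class_coord b (cls y m) = coord b m"
proof -
  have "(SOME p. p \<in> cls y m) \<in> cls y m"
    using cls_nonempty[OF y] by (simp add: some_in_eq)
  then show ?thesis
    using c cls_value[OF y] by (simp add: class_coord_def Let_def)
qed

lemma regf_class_coord: "class_coord b \<in> regf BB (topspace (topo BB))"
proof -
  let ?P = "carrier G \<times> W"
  have pre: "preim (topo PP) tw (topspace (topo BB)) = ?P"
    by (auto simp: preim_def topspace_PP topspace_BB)
  \<comment> \<open>The pull-back to G \<times> W is polynomial: matrix coefficients in x times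
    coordinates of w.\<close>
  let ?f = "\<lambda>z. \<Sum>c\<in>Basis. (cut ?P (matrix_coeff b c \<circ> fst) * cut ?P ((\<lambda>m. coord c m) \<circ> snd)) z"
  have "cut ?P (matrix_coeff b c \<circ> fst) \<in> prod_alg G A scale Basis W" for c
    unfolding prod_alg_def using matrix_coeff_in[of b c] by (intro fun_alg.gen) blast
  moreover have "cut ?P ((\<lambda>m. coord c m) \<circ> snd) \<in> prod_alg G A scale Basis W" if "c \<in> Basis" for c
    unfolding prod_alg_def using that by (intro fun_alg.gen) blast
  ultimately have "cut ?P (matrix_coeff b c \<circ> fst) * cut ?P ((\<lambda>m. coord c m) \<circ> snd) \<in>
      prod_alg G A scale Basis W" if "c \<in> Basis" for c
    using prod_alg_algebra that unfolding function_algebra_def by blast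
  then have "?f \<in> prod_alg G A scale Basis W"
    by (rule function_algebra_sum[OF prod_alg_algebra])
  then have "?f \<in> regf PP ?P"
    by (rule regf_affine_space_top[OF prod_alg_algebra])
  moreover have "cut ?P (class_coord b \<circ> tw) = ?f"
  proof
    fix z show "cut ?P (class_coord b \<circ> tw) z = ?f z"
    proof (cases "z \<in> ?P")
      case True
      then obtain x w where z: "z = (x, w)" "x \<in> carrier G" "w \<in> W"
        by auto
      have "tw (x, w) \<in> topspace (topo BB)"
        unfolding topspace_BB using z by blast
      then have "class_coord b (tw z) = coord b (\<rho> x w)"
        unfolding z(1) twist_eq[OF z(2)] using z(2) by (intro class_coord_cls) (auto simp: topspace_CC)
      also have "\<rho> x w = \<rho> x (\<Sum>c\<in>Basis. scale (coord c w) c)"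
        by (simp add: sum_coord)
      also have "coord b \<dots> = (\<Sum>c\<in>Basis. coord b (\<rho> x c) * coord c w)"
        using z by (simp add: mult.commute)
      finally show ?thesis
        using True z by (simp add: matrix_coeff_def)
    qed simp
  qed
  ultimately show ?thesis
    unfolding assoc_bundle_def regf_quot_space
    by (simp add: pre[unfolded assoc_bundle_def]) (simp add: class_coord_def assoc_bundle_def)
qed

text \<open>Composing the morphism \<sigma> with the regular functions \<open>class_coord\<close>
  gives the coordinates of the wanted function; this is why s is regular.\<close>

lemma L_sheaf_section:
  assumes U: "openin (topo CC) U" and \<sigma>: "\<sigma> \<in> LL U"
  shows "\<exists>s\<in>TX.bsec E (orb ` U). \<forall>y\<in>U. \<sigma> y = cls y (s (orb y))"
proof -
  have UC: "U \<subseteq> topspace (topo CC)"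
    using openin_subset[OF U] .
  have m: "fs_morphism (sub_space CC U) BB \<sigma>" and fst: "\<And>y. y \<in> U \<Longrightarrow> fst ` \<sigma> y = y"
    using \<sigma> by (auto simp: L_sheaf_def)
  have tU: "topspace (topo (sub_space CC U)) = U"
    using UC by (auto simp: topspace_sub_space)
  have \<sigma>B: "\<sigma> y \<in> topspace (topo BB)" if "y \<in> U" for y
    using fs_morphismD(3)[OF m] that by (simp add: tU)
  have "\<exists>m\<in>E (orb y). \<sigma> y = cls y m" if y: "y \<in> U" for y
  proof -
    obtain x w where x: "x \<in> carrier G" "w \<in> W" "\<sigma> y = tw (x, w)"
      using \<sigma>B[OF y] by (auto simp: topspace_BB)
    have "\<sigma> y = cls (x <# H) (\<rho> x w)"
      using x by (simp add: twist_eq)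
    \<comment> \<open>The section property of \<sigma> fixes the coset.\<close>
    moreover from this have "y = x <# H"
      using fst[OF y] fst_cls by metis
    ultimately show ?thesis
      using x by (auto simp: orb_coset E)
  qed
  then obtain m where m_def: "\<And>y. y \<in> U \<Longrightarrow> m y \<in> E (orb y) \<and> \<sigma> y = cls y (m y)"
    by metis
  define s where "s = cut (orb ` U) (\<lambda>x. m (the_inv_into (topspace (topo CC)) orb x))"
  have s: "s (orb y) = m y" if "y \<in> U" for y
  proof -
    have "the_inv_into (topspace (topo CC)) orb (orb y) = y"
      using that UC by (intro the_inv_into_f_f[OF inj_orb]) auto
    then show ?thesis
      using that by (simp add: s_def)
  qed
  let ?N = "preim (topo GG) (\<lambda>g. g <# H) U"
  have "s \<in> TX.bsec E (orb ` U)"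
    unfolding bsec_XX[OF openin_orb[OF U]] ppi_orb[OF UC]
  proof (intro conjI allI impI ballI)
    show "s x = 0" if "x \<notin> orb ` U" for x
      using that by (simp add: s_def)
    show "s x \<in> E x" if "x \<in> orb ` U" for x
      using that s m_def by auto
    show "cut ?N (s \<circ> pi) \<in> TO.triv ?N"
      unfolding TO.triv_iff
    proof
      fix b assume "b \<in> Basis"
      have pre: "preim (topo (sub_space CC U)) \<sigma> (topspace (topo BB)) = U"
        using \<sigma>B by (auto simp: preim_def tU)
      have "cut U (class_coord b \<circ> \<sigma>) \<in> regf (sub_space CC U) U"
        using fs_morphismD(2)[OF m _ regf_class_coord[of b]] unfolding pre by simp
      then have "cut U (class_coord b \<circ> \<sigma>) \<in> regf CC U"
        using CC.sub_space_open(2)[OF U U] by simp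
      then have "cut ?N (cut U (class_coord b \<circ> \<sigma>) \<circ> (\<lambda>g. g <# H)) \<in> regf GG ?N"
        by (simp add: coset_space_def regf_quot_space)
      moreover have "cut ?N (cut U (class_coord b \<circ> \<sigma>) \<circ> (\<lambda>g. g <# H)) = (\<lambda>x. coord b (cut ?N (s \<circ> pi) x))"
      proof
        fix g show "cut ?N (cut U (class_coord b \<circ> \<sigma>) \<circ> (\<lambda>g. g <# H)) g = coord b (cut ?N (s \<circ> pi) g)"
        proof (cases "g \<in> ?N")
          case True
          then have gU: "g <# H \<in> U"
            by (simp add: preim_def)
          then have "class_coord b (\<sigma> (g <# H)) = coord b (m (g <# H))"
            using \<sigma>B[OF gU] m_def[OF gU] UC by (auto intro: class_coord_cls)
          then show ?thesis
            using True gU s[OF gU] by (simp add: orb_coset)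
        qed simp
      qed
      ultimately show "(\<lambda>x. coord b (cut ?N (s \<circ> pi) x)) \<in> regf GG ?N"
        by simp
    qed
  qed
  then show ?thesis
    using s m_def by (intro bexI[of _ s]) auto
qed

text \<open>G/H and the associated bundle are both quotients, and the section need not lift to G
  \<times> W over G/H. Over G it does, by sending g to (g, \<rho> (inv g) (s (pi g))), and a map out
  of a quotient is a morphism if its composite with the projection is.\<close>

lemma section_L_sheaf:
  assumes U: "openin (topo CC) U" and s: "s \<in> TX.bsec E (orb ` U)"
  shows "restrict (\<lambda>y. cls y (s (orb y))) U \<in> LL U" (is "?\<sigma> \<in> _")
proof -
  have UC: "U \<subseteq> topspace (topo CC)"
    using openin_subset[OF U] .
  let ?N = "preim (topo GG) (\<lambda>g. g <# H) U"
  let ?GN = "sub_space GG ?N"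
  have oN: "openin (topo GG) ?N"
    using U by (simp add: openin_CC)
  have NG: "?N \<subseteq> carrier G"
    by (auto simp: preim_def)
  have tN: "topspace (topo ?GN) = ?N"
    using NG by (auto simp: topspace_sub_space)
  interpret GN: function_space ?GN
    by (rule GG.function_space_sub_space)
  have st: "cut ?N (s \<circ> pi) \<in> TO.triv ?N" and sE: "\<And>y. y \<in> U \<Longrightarrow> s (orb y) \<in> E (orb y)"
    using s unfolding bsec_XX[OF openin_orb[OF U]] ppi_orb[OF UC] by auto
  define \<psi> where "\<psi> g = (g, \<rho> (inv g) (s (pi g)))" for g
  have \<psi>W: "\<psi> g \<in> carrier G \<times> W" if g: "g \<in> ?N" for g
  proof -
    have gc: "g \<in> carrier G" "g <# H \<in> U"
      using g by (auto simp: preim_def)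
    then have "s (pi g) \<in> \<rho> g ` W"
      using sE[OF gc(2)] by (simp add: orb_coset E)
    then show ?thesis
      using gc by (auto simp: \<psi>_def)
  qed
  have "fs_morphism ?GN PP \<psi>"
    unfolding prod_alg_def
  proof (rule GN.fs_morphism_affine_space)
    show "\<psi> ` topspace (topo ?GN) \<subseteq> carrier G \<times> W"
      unfolding tN using \<psi>W by blast
    fix f assume f: "f \<in> {f \<circ> fst |f. f \<in> A} \<union> {(\<lambda>m. coord b m) \<circ> snd |b. b \<in> Basis}"
    have "cut ?N (f \<circ> \<psi>) \<in> regf GG ?N"
    proof (cases "f \<in> {f \<circ> fst |f. f \<in> A}")
      case True
      then obtain h where h: "h \<in> A" "f = h \<circ> fst"
        by blast
      have "cut ?N h \<in> regf GG ?N"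
        using GG.regf_cut[OF openin_topspace, of h ?N] regf_GG[OF h(1)] oN NG by simp
      moreover have "cut ?N (f \<circ> \<psi>) = cut ?N h"
        by (auto simp: h \<psi>_def cut_def)
      ultimately show ?thesis
        by simp
    next
      case False
      then obtain b where b: "b \<in> Basis" "f = (\<lambda>m. coord b m) \<circ> snd"
        using f by blast
      \<comment> \<open>Entries of \<rho> (inv g); the antipode makes them regular.\<close>
      define k where "k c = cut (carrier G) (\<lambda>x. matrix_coeff b c (inv x))" for c
      have k: "cut ?N (k c) \<in> regf GG ?N" for c
      proof -
        have "k c \<in> A"
          unfolding k_def by (rule grp.antipode[OF matrix_coeff_in])
        then show ?thesis
          using GG.regf_cut[OF openin_topspace, of "k c" ?N] regf_GG[of "k c"] oN NG by simp
      qed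
      have "(\<lambda>g. \<Sum>c\<in>Basis. cut ?N (k c) g * coord c (cut ?N (s \<circ> pi) g)) \<in> regf GG ?N"
        using st by (intro GG.regf_sum oN GG.regf_mult' k) (simp add: TO.triv_iff)
      moreover have "cut ?N (f \<circ> \<psi>) = (\<lambda>g. \<Sum>c\<in>Basis. cut ?N (k c) g * coord c (cut ?N (s \<circ> pi) g))"
      proof
        fix g show "cut ?N (f \<circ> \<psi>) g = (\<Sum>c\<in>Basis. cut ?N (k c) g * coord c (cut ?N (s \<circ> pi) g))"
        proof (cases "g \<in> ?N")
          case True
          then have g: "g \<in> carrier G"
            using NG by auto
          have "coord b (\<rho> (inv g) (s (pi g))) = coord b (\<rho> (inv g) (\<Sum>c\<in>Basis. scale (coord c (s (pi g))) c))"
            by (simp add: sum_coord)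
          also have "\<dots> = (\<Sum>c\<in>Basis. coord b (\<rho> (inv g) c) * coord c (s (pi g)))"
            using g by (simp add: mult.commute)
          finally show ?thesis
            using True g by (simp add: b \<psi>_def k_def matrix_coeff_def)
        qed simp
      qed
      ultimately show ?thesis
        by simp
    qed
    then show "cut (topspace (topo ?GN)) (f \<circ> \<psi>) \<in> regf ?GN (topspace (topo ?GN))"
      unfolding tN using GG.sub_space_open(2)[OF oN oN] by simp
  qed
  moreover have "fs_morphism PP BB tw"
    unfolding assoc_bundle_def by (rule fs_morphism_quot_space)
  ultimately have "fs_morphism ?GN BB (tw \<circ> \<psi>)"
    by (rule fs_morphism_comp)
  then have m: "fs_morphism ?GN BB (\<lambda>g. ?\<sigma> (g <# H))"
  proof (rule fs_morphism_cong[rotated])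
    fix g assume "g \<in> topspace (topo ?GN)"
    then have "g \<in> carrier G" "g <# H \<in> U"
      unfolding tN by (auto simp: preim_def)
    then show "(tw \<circ> \<psi>) g = ?\<sigma> (g <# H)"
      by (simp add: \<psi>_def twist_eq orb_coset)
  qed
  have tU: "topspace (topo (sub_space CC U)) = U"
    using UC by (auto simp: topspace_sub_space)
  have pre: "preim (topo ?GN) (\<lambda>g. ?\<sigma> (g <# H)) V =
      preim (topo GG) (\<lambda>g. g <# H) (preim (topo (sub_space CC U)) ?\<sigma> V)" for V
  proof -
    have "g \<in> preim (topo ?GN) (\<lambda>g. ?\<sigma> (g <# H)) V \<longleftrightarrow> g \<in> ?N \<and> ?\<sigma> (g <# H) \<in> V" for g
      unfolding preim_def[of "topo ?GN"] tN by simp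
    moreover have "y \<in> preim (topo (sub_space CC U)) ?\<sigma> V \<longleftrightarrow> y \<in> U \<and> ?\<sigma> y \<in> V" for y
      unfolding preim_def tU by simp
    ultimately show ?thesis
      unfolding preim_def[of "topo GG"] by blast
  qed
  have "fs_morphism (sub_space CC U) BB ?\<sigma>"
  proof (rule fs_morphismI)
    fix y assume "y \<in> topspace (topo (sub_space CC U))"
    then have "y \<in> U"
      by (simp add: tU)
    then obtain g where g: "g \<in> carrier G" "y = g <# H"
      using UC by (auto simp: topspace_CC)
    then have "g \<in> topspace (topo ?GN)"
      using \<open>y \<in> U\<close> unfolding tN by (simp add: preim_def)
    then show "?\<sigma> y \<in> topspace (topo BB)"
      using fs_morphismD(3)[OF m] g by blast
  next
    fix V assume V: "openin (topo BB) V"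
    let ?V = "preim (topo (sub_space CC U)) ?\<sigma> V"
    have VU: "?V \<subseteq> U"
      unfolding preim_def tU by blast
    have oV: "openin (topo GG) (preim (topo GG) (\<lambda>g. g <# H) ?V)"
      using fs_morphismD(1)[OF m V] unfolding pre GG.sub_space_open(1)[OF oN] by simp
    then have oVC: "openin (topo CC) ?V"
      using VU UC by (simp add: openin_CC)
    then show "openin (topo (sub_space CC U)) ?V"
      using VU by (simp add: CC.sub_space_open(1)[OF U])
    fix f assume f: "f \<in> regf BB V"
    have "cut (preim (topo GG) (\<lambda>g. g <# H) ?V) (f \<circ> (\<lambda>g. ?\<sigma> (g <# H))) \<in>
        regf GG (preim (topo GG) (\<lambda>g. g <# H) ?V)"
      using fs_morphismD(2)[OF m V f] unfolding pre GG.sub_space_open(2)[OF oN oV] .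
    moreover have "cut (preim (topo GG) (\<lambda>g. g <# H) ?V) (f \<circ> (\<lambda>g. ?\<sigma> (g <# H))) =
        cut (preim (topo GG) (\<lambda>g. g <# H) ?V) (cut ?V (f \<circ> ?\<sigma>) \<circ> (\<lambda>g. g <# H))"
      by (rule ext) (simp add: cut_def preim_def[of "topo GG"])
    ultimately have "cut ?V (f \<circ> ?\<sigma>) \<in> regf CC ?V"
      unfolding coset_space_def regf_quot_space by simp
    then show "cut ?V (f \<circ> ?\<sigma>) \<in> regf (sub_space CC U) ?V"
      unfolding CC.sub_space_open(2)[OF U oVC] .
  qed
  then show ?thesis
    by (simp add: L_sheaf_def fst_cls)
qed

section \<open>The isomorphism with the sections of E\<close>

definition Phi :: "'g set set \<Rightarrow> ('g set \<Rightarrow> ('g \<times> 'm) set) \<Rightarrow> ('g, 'k) oper set \<Rightarrow> 'm" where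
  "Phi U \<sigma> = cut (orb ` U) (\<lambda>x. let p = SOME p. p \<in> \<sigma> (the_inv_into (topspace (topo CC)) orb x)
     in \<rho> (fst p) (snd p))"

lemma Phi_apply:
  assumes y: "y \<in> U" "U \<subseteq> topspace (topo CC)" and "\<sigma> y \<noteq> {}"
    and val: "\<And>p. p \<in> \<sigma> y \<Longrightarrow> \<rho> (fst p) (snd p) = m"
  shows "Phi U \<sigma> (orb y) = m"
proof -
  have "the_inv_into (topspace (topo CC)) orb (orb y) = y"
    using y by (intro the_inv_into_f_f[OF inj_orb]) auto
  moreover have "(SOME p. p \<in> \<sigma> y) \<in> \<sigma> y"
    using assms(3) by (simp add: some_in_eq)
  ultimately show ?thesis
    using y(1) val by (simp add: Phi_def Let_def)
qed

lemma Phi_out: "x \<notin> orb ` U \<Longrightarrow> Phi U \<sigma> x = 0"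
  by (simp add: Phi_def)

text \<open>Any representative (x, w) yields the same vector \<rho> x w. The compatibilities with
  sums, scalars and restriction follow by naming the function whose classes form the given
  section.\<close>

lemma Phi_section:
  assumes U: "openin (topo CC) U" and s: "\<And>x. x \<notin> orb ` U \<Longrightarrow> s x = 0"
    and \<sigma>: "\<And>y. y \<in> U \<Longrightarrow> \<sigma> y = cls y (s (orb y))"
  shows "Phi U \<sigma> = s"
proof
  fix x show "Phi U \<sigma> x = s x"
  proof (cases "x \<in> orb ` U")
    case True
    then obtain y where y: "y \<in> U" "x = orb y"
      by auto
    have yC: "y \<in> topspace (topo CC)"
      using y openin_subset[OF U] by auto
    show ?thesis
      unfolding y(2)
      by (rule Phi_apply) (use y yC \<sigma> cls_nonempty cls_value openin_subset[OF U] in auto)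
  qed (simp add: s Phi_out)
qed

lemma L_sheaf_Phi:
  assumes U: "openin (topo CC) U" and \<sigma>: "\<sigma> \<in> LL U"
  shows "Phi U \<sigma> \<in> TX.bsec E (orb ` U)" and "\<And>y. y \<in> U \<Longrightarrow> \<sigma> y = cls y (Phi U \<sigma> (orb y))"
proof -
  obtain s where s: "s \<in> TX.bsec E (orb ` U)" "\<And>y. y \<in> U \<Longrightarrow> \<sigma> y = cls y (s (orb y))"
    using L_sheaf_section[OF U \<sigma>] by blast
  have "s x = 0" if "x \<notin> orb ` U" for x
    using s(1) that unfolding bsec_XX[OF openin_orb[OF U]] by blast
  then have "Phi U \<sigma> = s"
    by (rule Phi_section[OF U _ s(2)])
  with s show "Phi U \<sigma> \<in> TX.bsec E (orb ` U)" "\<And>y. y \<in> U \<Longrightarrow> \<sigma> y = cls y (Phi U \<sigma> (orb y))"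
    by simp_all
qed

lemma coset_translate:
  assumes g: "g \<in> carrier G" and y: "y \<in> topspace (topo CC)"
  shows "inv g <# (g <# y) = y" "g <# y \<in> topspace (topo CC)" "orb (g <# y) = Ad G A g ` orb y"
proof -
  obtain x where x: "x \<in> carrier G" "y = x <# H"
    using y by (auto simp: topspace_CC)
  have HG: "H \<subseteq> carrier G"
    using H_carrier by auto
  have gy: "g <# y = (g \<otimes> x) <# H"
    using x g HG by (simp add: grp.lcos_m_assoc)
  show "inv g <# (g <# y) = y"
    unfolding gy using x g HG by (simp add: grp.lcos_m_assoc grp.m_assoc[symmetric])
  show "g <# y \<in> topspace (topo CC)"
    unfolding gy topspace_CC using x g by blast
  show "orb (g <# y) = Ad G A g ` orb y"
    unfolding gy unfolding x(2) orb_coset using x g by (simp add: pi_mult)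
qed

lemma Phi_bij:
  assumes U: "openin (topo CC) U"
  shows "bij_betw (Phi U) (LL U) (TX.bsec E (orb ` U))"
  unfolding bij_betw_def
proof (intro conjI inj_onI equalityI subsetI)
  fix \<sigma> \<tau> assume st: "\<sigma> \<in> LL U" "\<tau> \<in> LL U" "Phi U \<sigma> = Phi U \<tau>"
  show "\<sigma> = \<tau>"
  proof (rule extensionalityI[of _ U])
    show "\<sigma> \<in> extensional U" "\<tau> \<in> extensional U"
      using st by (auto simp: L_sheaf_def)
    show "\<sigma> y = \<tau> y" if "y \<in> U" for y
      using L_sheaf_Phi(2)[OF U st(1) that] L_sheaf_Phi(2)[OF U st(2) that] st(3) by simp
  qed
next
  fix s assume "s \<in> Phi U ` LL U"
  then show "s \<in> TX.bsec E (orb ` U)"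
    using L_sheaf_Phi(1)[OF U] by auto
next
  fix s assume s: "s \<in> TX.bsec E (orb ` U)"
  have eq: "Phi U (restrict (\<lambda>y. cls y (s (orb y))) U) = s"
  proof (rule Phi_section[OF U])
    show "s x = 0" if "x \<notin> orb ` U" for x
      using s that unfolding bsec_XX[OF openin_orb[OF U]] by blast
  qed simp
  show "s \<in> Phi U ` LL U"
    using imageI[OF section_L_sheaf[OF U s], of "Phi U"] unfolding eq .
qed

lemma Phi_add:
  assumes U: "openin (topo CC) U" and st: "\<sigma> \<in> LL U" "\<tau> \<in> LL U"
  shows "Phi U (\<lambda>y\<in>U. cls_add (\<sigma> y) (\<tau> y)) = Phi U \<sigma> + Phi U \<tau>"
proof (rule Phi_section[OF U])
  show "(Phi U \<sigma> + Phi U \<tau>) x = 0" if "x \<notin> orb ` U" for x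
    using that by (simp add: Phi_out)
  fix y assume y: "y \<in> U"
  then have "y \<subseteq> carrier G"
    using openin_subset[OF U] topspace_CC_D by blast
  then have "cls_add (cls y v) (cls y w) = cls y (v + w)" for v w
    by (force simp: cls_add_def cls_def image_iff)
  then show "(\<lambda>y\<in>U. cls_add (\<sigma> y) (\<tau> y)) y = cls y ((Phi U \<sigma> + Phi U \<tau>) (orb y))"
    using y L_sheaf_Phi(2)[OF U st(1) y] L_sheaf_Phi(2)[OF U st(2) y] by simp
qed

lemma Phi_scale:
  assumes U: "openin (topo CC) U" and \<sigma>: "\<sigma> \<in> LL U"
  shows "Phi U (\<lambda>y\<in>U. cls_scale scale (f (orb y)) (\<sigma> y)) = (\<lambda>x. scale (f x) (Phi U \<sigma> x))"
proof (rule Phi_section[OF U])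
  show "scale (f x) (Phi U \<sigma> x) = 0" if "x \<notin> orb ` U" for x
    using that by (simp add: Phi_out)
  fix y assume y: "y \<in> U"
  then have "y \<subseteq> carrier G"
    using openin_subset[OF U] topspace_CC_D by blast
  then have "cls_scale scale c (cls y v) = cls y (scale c v)" for c v
    by (force simp: cls_scale_def cls_def image_iff)
  then show "(\<lambda>y\<in>U. cls_scale scale (f (orb y)) (\<sigma> y)) y = cls y (scale (f (orb y)) (Phi U \<sigma> (orb y)))"
    using y L_sheaf_Phi(2)[OF U \<sigma> y] by simp
qed

lemma Phi_restrict:
  assumes U: "openin (topo CC) U" and V: "openin (topo CC) V" "V \<subseteq> U" and \<sigma>: "\<sigma> \<in> LL U"
  shows "Phi V (restrict \<sigma> V) = cut (orb ` V) (Phi U \<sigma>)"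
proof (rule Phi_section[OF V(1)])
  fix y assume y: "y \<in> V"
  then show "restrict \<sigma> V y = cls y (cut (orb ` V) (Phi U \<sigma>) (orb y))"
    using L_sheaf_Phi(2)[OF U \<sigma>, of y] V(2) by auto
qed simp

text \<open>Translation moves (a, \<rho> (inv a) m) to (g \<otimes> a, \<rho> (inv a) m), which
  evaluates to \<rho> g m. Comparing values through \<open>Phi_apply\<close> is enough.\<close>

lemma Phi_trans:
  assumes U: "openin (topo CC) U" and g: "g \<in> carrier G" and \<sigma>: "\<sigma> \<in> LL U"
  shows "Phi ((\<lambda>y. g <# y) ` U) (L_trans G g U \<sigma>) = triv_trans G A \<rho> g (orb ` U) (Phi U \<sigma>)"
proof
  let ?U = "(\<lambda>y. g <# y) ` U"
  have UC: "U \<subseteq> topspace (topo CC)"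
    using openin_subset[OF U] .
  have orbU: "orb ` ?U = (`) (Ad G A g) ` orb ` U"
    unfolding image_image using coset_translate(3)[OF g] UC by (intro image_cong) auto
  fix x show "Phi ?U (L_trans G g U \<sigma>) x = triv_trans G A \<rho> g (orb ` U) (Phi U \<sigma>) x"
  proof (cases "x \<in> orb ` ?U")
    case False
    then show ?thesis
      by (simp add: Phi_out orbU[symmetric] triv_trans_def)
  next
    case True
    then obtain y where y: "y \<in> U" "x = orb (g <# y)"
      by auto
    then have yC: "y \<in> topspace (topo CC)"
      using UC by auto
    note ct = coset_translate[OF g yC]
    have inv: "Ad G A (inv g) ` x = orb y"
      using coset_translate(3)[of "inv g", OF _ ct(2)] g unfolding ct(1) y(2) by simp
    have "Phi ?U (L_trans G g U \<sigma>) (orb (g <# y)) = \<rho> g (Phi U \<sigma> (orb y))"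
    proof (rule Phi_apply)
      show "g <# y \<in> ?U"
        using y by blast
      show "?U \<subseteq> topspace (topo CC)"
        using coset_translate(2)[OF g] UC by auto
      have L: "L_trans G g U \<sigma> (g <# y) = cls_trans G g (cls y (Phi U \<sigma> (orb y)))"
        using y L_sheaf_Phi(2)[OF U \<sigma> y(1)] by (simp add: L_trans_def ct(1))
      show "L_trans G g U \<sigma> (g <# y) \<noteq> {}"
        unfolding L cls_trans_def using cls_nonempty[OF yC] by simp
      fix p assume "p \<in> L_trans G g U \<sigma> (g <# y)"
      then obtain a where a: "a \<in> y" "p = (g \<otimes> a, \<rho> (inv a) (Phi U \<sigma> (orb y)))"
        unfolding L by (auto simp: cls_trans_def cls_def)
      then show "\<rho> (fst p) (snd p) = \<rho> g (Phi U \<sigma> (orb y))"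
        using g topspace_CC_D[OF yC] by (auto simp: rho_mult subset_iff)
    qed
    moreover have "x \<in> (`) (Ad G A g) ` orb ` U"
      using True orbU by simp
    ultimately show ?thesis
      unfolding triv_trans_def using inv y(2) by simp
  qed
qed

lemma equivariant_iso_Phi: "equivariant_iso G A H scale Basis \<rho> W XX orb (TX.bsec E) Phi"
  unfolding equivariant_iso_def Let_def
  using Phi_bij Phi_add Phi_scale Phi_restrict Phi_trans by simp

lemma over_trivial_bundle_Phi: "over_trivial_bundle G A H scale Basis \<rho> W orb Phi"
  unfolding over_trivial_bundle_def
proof (intro allI impI ballI, clarify)
  fix U \<sigma> y x m
  assume U: "openin (topo CC) U" and \<sigma>: "\<sigma> \<in> LL U" and y: "y \<in> U" and xm: "(x, m) \<in> \<sigma> y"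
  have "y \<in> topspace (topo CC)"
    using y openin_subset[OF U] by auto
  then show "Phi U \<sigma> (orb y) = \<rho> x m"
    using cls_value[of y "(x, m)"] xm L_sheaf_Phi(2)[OF U \<sigma> y] by simp
qed

lemma associated_bundle:
  "subspace W \<and> (\<forall>h\<in>H. \<rho> h ` W \<subseteq> W) \<and> equivariant_subbundle G A XX scale Basis \<rho> (TX.bsec E) \<and>
    (\<exists>\<Phi>. equivariant_iso G A H scale Basis \<rho> W XX orb (TX.bsec E) \<Phi> \<and>
      over_trivial_bundle G A H scale Basis \<rho> W orb \<Phi>)"
  using W H_stable equivariant_subbundle_bsec equivariant_iso_Phi over_trivial_bundle_Phi by blast

lemma descend_bundle: "descend YY XX (span_map r) scale Basis (TY.bsec (E \<circ> span_map r)) = TX.bsec E"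
proof -
  interpret bundle_morphism scale Basis YY XX "span_map r"
    by unfold_locales (rule fs_morphism_span_map)
  show ?thesis
    by (rule descend_bsec[OF vector_subbundle_XX span_map_surj])
qed

end

section \<open>M as a module over the enveloping algebra of \<epsilon>\<close>

context elementary_orbit
begin

lemma elementary_module_eps: "elementary_module \<epsilon> scale act"
proof (intro elementary_module.intro elementary_algebra.intro elementary_module_axioms.intro)
  note e = eps[unfolded elem_subalgs_def]
  have L: "x \<in> \<epsilon> \<Longrightarrow> x \<in> Lie G A" for x
    using eps_Lie by auto
  show "vector_space scale"
    by (rule vector_space_axioms)
  show "op.subspace \<epsilon>"
    using e by simp
  show "bracket x y = 0" if "x \<in> \<epsilon>" "y \<in> \<epsilon>" for x y
    using e that by simp
  show "p_op x = 0" if "x \<in> \<epsilon>" for x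
    using e that by simp
  show "CHAR('k) > 0"
    by (rule char)
  show "module_hom scale scale (act x)" if "x \<in> \<epsilon>" for x
    using act_linear[OF invariant_operator_Lie[OF L[OF that]]] by (simp add: Vector_Spaces.linear_iff_module_hom)
  show "act (x + y) m = act x m + act y m" for x y m
    by (rule act_op_add)
  show "act (oscale c x) m = scale c (act x m)" for c x m
    by (rule act_op_scale)
  show "act x (act y m) = act y (act x m)" if "x \<in> \<epsilon>" "y \<in> \<epsilon>" for x y m
    using act_commute[OF L[OF that(1)] L[OF that(2)]] e that by simp
  \<comment> \<open>The p-operation is the p-th iterate, so its vanishing says that the iterate of x
    is the zero operator; the action respects iterates.\<close>
  show "(act x ^^ CHAR('k)) m = 0" if "x \<in> \<epsilon>" for x m
  proof -
    have "x ^^ CHAR('k) = 0"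
      using e that by (simp add: p_op_def)
    then show ?thesis
      using act_funpow[OF invariant_operator_Lie[OF L[OF that]], of "CHAR('k)" m] act_op_0 by metis
  qed
qed

end

theorem theorem4p6:
  fixes G :: "('g, 'q) monoid_scheme"
    and A :: "('g \<Rightarrow> 'k::alg_closed_field) set"
    and scale :: "'k \<Rightarrow> 'm::ab_group_add \<Rightarrow> 'm" and Basis :: "'m set"
    and \<rho> :: "'g \<Rightarrow> 'm \<Rightarrow> 'm"
    and B :: "('g, 'k) oper set" and \<epsilon> :: "('g, 'k) oper set"
    and X :: "('g, 'k) oper set set" and H :: "'g set"
    and p r j :: nat
  assumes "CHAR('k) = p" and "p > 0"
    and "affine_alg_group G A"
    and "finite_dimensional_vector_space scale Basis"
    and "rational_module G A scale \<rho>"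
    and "lie_basis G A B"
    and "r > 0" and "\<epsilon> \<in> elem_subalgs G A r"
    and "X = orbit G A \<epsilon>" and "H = stabilizer G A \<epsilon>"
    and "fs_iso (coset_space G A H) (base_space G A B r X) (orbit_map G A \<epsilon>)"
    and "1 \<le> j" and "j \<le> (p - 1) * r"
  shows "\<forall>(F, W) \<in>
      {(Im_sheaf G A B r X scale Basis \<rho> j, Rad scale (daction G scale Basis \<rho>) \<epsilon> j),
       (Ker_sheaf G A B r X scale Basis \<rho> j, Soc scale (daction G scale Basis \<rho>) \<epsilon> j)}.
    Modules.module.subspace scale W \<and> (\<forall>h\<in>H. \<rho> h ` W \<subseteq> W) \<and>
    equivariant_subbundle G A (base_space G A B r X) scale Basis \<rho> F \<and>
    (\<exists>\<Phi>. equivariant_iso G A H scale Basis \<rho> W (base_space G A B r X) (orbit_map G A \<epsilon>) F \<Phi> \<and>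
         over_trivial_bundle G A H scale Basis \<rho> W (orbit_map G A \<epsilon>) \<Phi>)"
proof -
  interpret affine_alg_group G A
    by fact
  interpret finite_dimensional_vector_space scale Basis
    by fact
  interpret elementary_orbit scale Basis G A \<rho> B \<epsilon> r
    by unfold_locales (use assms in simp_all)
  interpret em: elementary_module \<epsilon> scale "daction G scale Basis \<rho>"
    by (rule elementary_module_eps)
  interpret R: homogeneous_bundle scale Basis G A \<rho> B \<epsilon> r "\<lambda>x. Radw x j" "Radw \<epsilon> j"
    by (rule homogeneous_Rad)
  interpret S: homogeneous_bundle scale Basis G A \<rho> B \<epsilon> r "\<lambda>x. Socw x j" "Socw \<epsilon> j"
    by (rule homogeneous_Soc)
  \<comment> \<open>Both sheaves become sections of a family of word layers, upstairs and hence
    after descent; words are exchanged for powers of the Jacobson radical at \<epsilon>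
    only.\<close>
  have im: "Im_sheaf G A B r X scale Basis \<rho> j = TX.bsec (\<lambda>x. Radw x j)"
    unfolding Im_sheaf_def assms(9) imF_eq by (rule R.descend_bundle)
  have ker: "Ker_sheaf G A B r X scale Basis \<rho> j = TX.bsec (\<lambda>x. Socw x j)"
    unfolding Ker_sheaf_def assms(9) kerF_eq by (rule S.descend_bundle)
  show ?thesis
    unfolding im ker unfolding em.Rad_eq em.Soc_eq assms(9,10)
    using R.associated_bundle S.associated_bundle by simp
qed

end
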